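(* Let $G$ be a finite group and $R$ a faithful complex representation of $G$ of dimension $d$. Let $D[R]=(D[R]^i_j)_{0\le i,j\le n}$ be the matrix of polynomials in $q$ and $M[R_A(-q)]$ the Clebsch–Gordan matrix defined in the context. Write $N^{(i)}$ for the $i$-th derivative of a matrix $N$ with respect to $q$ and $N^{i}$ (no parentheses) for the $i$-th power of the matrix $N$. Then for $i=0,1,\dots,d-1$ $$D[R]^{(i)}\,M[R_A(-q)]^{i+1}\big|_{q=1}=0,\qquad D[R]^{i+1}\,M[R_A(-q)]^{(i)}\big|_{q=1}=0,$$ and moreover $$D[R]^{(d)}\,M[R_A(-q)]^{d+1}\big|_{q=1}=(-1)^d\,d!\,\mu_0|G|\,M[R_A(-1)]^d,$$ $$D[R]^{d+1}\,M[R_A(-q)]^{d+1}\big|_{q=1}=\mu_0|G|\,M[\det R]\,M[R_A(-1)]^d.$$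
   Context: $R_0$ (trivial), $R_1,\dots,R_n$ are the irreducible complex representations of the finite group $G$ up to isomorphism. With $(R,Q)=\frac1{|G|}\sum_{g\in G}\chi^R(g)\overline{\chi^Q(g)}$ ($\chi^R$ the character of $R$), the Clebsch–Gordan matrix $M[Q]$ of a representation $Q$ is the matrix with entries $M[Q]^i_j=(Q\otimes R_i,R_j)$ (row $i$, column $j$), $0\le i,j\le n$; it is extended linearly to formal power series in $q$ with coefficients in the representation ring. $R_S(q)=\sum_{m\ge0}R_S^mq^m$ and $R_A(q)=\sum_{m\ge0}R_A^mq^m$, where $R_S^m$, $R_A^m$ are the $m$-th symmetric and exterior powers of $R$; $M[R_A(-q)]=\sum_m(-q)^mM[R_A^m]$ and $M[R_A(-1)]$ is its value at $q=1$; $\det R=R_A^d$. Let $V$ be the space of $R$ and $S=\mathrm{Sym}(V)$. Fix a homogeneous system of parameters $\theta_1,\dots,\theta_d$ of the invariant algebra $S^G$, $n_k=\deg\theta_k$. For each $j$ the graded module of covariants $\mathrm{Hom}_G(R_j,S)$ is a free $\mathbb C[\theta_1,\dots,\theta_d]$-module of finite rank $\mu_j$; let $m_{1j},\dots,m_{\mu_jj}$ be the degrees of a homogeneous basis. Put $D[R]^0_j=\sum_{k=1}^{\mu_j}q^{m_{kj}}$ and $(1-q)^dD(R)=\prod_{k=1}^d(1-q^{n_k})$, so that $M[R_S(q)]^0_j=\frac{1}{(1-q)^d}\frac{D[R]^0_j}{D(R)}$ and $\mu_0|G|=n_1\cdots n_d$. Put $D[R]^i_j=\sum_{k=0}^n(R_i\otimes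 R_k,R_j)\,D[R]^0_k$ for $0\le i,j\le n$.
   Formalization: The last printed identity is false (G=Z/2, R=sign: left side 0, right side nonzero). It is replaced by D[R]^{d+1}M[R_A(-q)]^{(d)} = (-1)^d d! μ_0|G| D[R]^d and D[R]^{d+1}M[det R] = μ_0|G| D[R]^d at q=1. *)

theory Defs
  imports
    Complex_Main
    "HOL-Library.Poly_Mapping"
    "HOL-Library.FuncSet"
    "HOL-Algebra.Group"
    "Jordan_Normal_Form.Determinant"
    "Jordan_Normal_Form.VS_Connect"
begin

section \<open>Complex representations in matrix form\<close>

text \<open>A representation of dimension \<open>d\<close> is given by its matrices with respect to a basis of its
  space, which is thereby identified with \<open>carrier_vec d\<close>.\<close>

definition representation :: "('g, 'b) monoid_scheme \<Rightarrow> nat \<Rightarrow> ('g \<Rightarrow> complex mat) \<Rightarrow> bool" where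
  "representation G d \<rho> \<longleftrightarrow>
     (\<forall>g\<in>carrier G. \<rho> g \<in> carrier_mat d d) \<and>
     \<rho> \<one>\<^bsub>G\<^esub> = 1\<^sub>m d \<and>
     (\<forall>g\<in>carrier G. \<forall>h\<in>carrier G. \<rho> (g \<otimes>\<^bsub>G\<^esub> h) = \<rho> g * \<rho> h)"

definition faithful :: "('g, 'b) monoid_scheme \<Rightarrow> ('g \<Rightarrow> complex mat) \<Rightarrow> bool" where
  "faithful G \<rho> \<longleftrightarrow> inj_on \<rho> (carrier G)"

definition irreducible_rep :: "('g, 'b) monoid_scheme \<Rightarrow> nat \<Rightarrow> ('g \<Rightarrow> complex mat) \<Rightarrow> bool" where
  "irreducible_rep G d \<rho> \<longleftrightarrow>
     representation G d \<rho> \<and> d > 0 \<and>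
     (\<forall>W. subspace class_ring W (module_vec TYPE(complex) d) \<and>
          (\<forall>g\<in>carrier G. \<forall>w\<in>W. \<rho> g *\<^sub>v w \<in> W) \<longrightarrow> W = {0\<^sub>v d} \<or> W = carrier_vec d)"

definition isomorphic_reps ::
  "('g, 'b) monoid_scheme \<Rightarrow> nat \<Rightarrow> ('g \<Rightarrow> complex mat) \<Rightarrow> nat \<Rightarrow> ('g \<Rightarrow> complex mat) \<Rightarrow> bool" where
  "isomorphic_reps G d \<rho> d' \<rho>' \<longleftrightarrow>
     d = d' \<and> (\<exists>P\<in>carrier_mat d d. invertible_mat P \<and> (\<forall>g\<in>carrier G. P * \<rho> g = \<rho>' g * P))"

text \<open>\<open>R\<^sub>0, \<dots>, R\<^sub>n\<close> of dimensions \<open>e\<^sub>0, \<dots>, e\<^sub>n\<close> are the irreducible representations up to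
  isomorphism, each occurring once, with \<open>R\<^sub>0\<close> trivial.\<close>

definition irreducibles ::
  "('g, 'b) monoid_scheme \<Rightarrow> nat \<Rightarrow> (nat \<Rightarrow> nat) \<Rightarrow> (nat \<Rightarrow> 'g \<Rightarrow> complex mat) \<Rightarrow> bool" where
  "irreducibles G n e Rs \<longleftrightarrow>
     (\<forall>i\<le>n. irreducible_rep G (e i) (Rs i)) \<and>
     (\<forall>i\<le>n. \<forall>j\<le>n. isomorphic_reps G (e i) (Rs i) (e j) (Rs j) \<longrightarrow> i = j) \<and>
     (\<forall>d \<rho>. irreducible_rep G d \<rho> \<longrightarrow> (\<exists>i\<le>n. isomorphic_reps G d \<rho> (e i) (Rs i))) \<and>
     e 0 = 1 \<and> (\<forall>g\<in>carrier G. Rs 0 g = 1\<^sub>m 1)"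

definition character :: "('g \<Rightarrow> complex mat) \<Rightarrow> 'g \<Rightarrow> complex" where
  "character \<rho> g = (\<Sum>i<dim_row (\<rho> g). \<rho> g $$ (i, i))"

definition char_inner ::
  "('g, 'b) monoid_scheme \<Rightarrow> ('g \<Rightarrow> complex mat) \<Rightarrow> ('g \<Rightarrow> complex mat) \<Rightarrow> complex" where
  "char_inner G \<rho> \<sigma> =
     (1 / of_nat (card (carrier G))) * (\<Sum>g\<in>carrier G. character \<rho> g * cnj (character \<sigma> g))"

text \<open>The Kronecker product of matrices: the basis vector \<open>u\<^sub>a \<otimes> v\<^sub>b\<close> of the tensor product is the
  one with index \<open>a * dim W + b\<close>, where \<open>v\<^sub>b\<close> runs through the basis of the second factor \<open>W\<close>.\<close>

definition tensor_rep :: "('g \<Rightarrow> complex mat) \<Rightarrow> ('g \<Rightarrow> complex mat) \<Rightarrow> 'g \<Rightarrow> complex mat" where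
  "tensor_rep \<rho> \<sigma> g =
     mat (dim_row (\<rho> g) * dim_row (\<sigma> g)) (dim_col (\<rho> g) * dim_col (\<sigma> g))
       (\<lambda>(r, c). \<rho> g $$ (r div dim_row (\<sigma> g), c div dim_col (\<sigma> g)) *
                 \<sigma> g $$ (r mod dim_row (\<sigma> g), c mod dim_col (\<sigma> g)))"

text \<open>The basis of the \<open>m\<close>-th exterior power of a space with basis \<open>x\<^sub>0, \<dots>, x\<^sub>d\<^sub>-\<^sub>1\<close> consists of
  \<open>x\<^sub>I = x\<^bsub>I!0\<^esub> \<and> \<dots> \<and> x\<^bsub>I!(m-1)\<^esub>\<close> for the increasing lists \<open>I\<close> of length \<open>m\<close> over \<open>{0..<d}\<close>.
  Expanding \<open>A x\<^bsub>J!0\<^esub> \<and> \<dots> \<and> A x\<^bsub>J!(m-1)\<^esub>\<close> in it, the coefficient of \<open>x\<^sub>I\<close> is the minor of \<open>A\<close> with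
  rows \<open>I\<close> and columns \<open>J\<close>.\<close>

definition ext_basis :: "nat \<Rightarrow> nat \<Rightarrow> nat list list" where
  "ext_basis d m = filter (\<lambda>I. length I = m) (subseqs [0..<d])"

definition ext_power :: "nat \<Rightarrow> nat \<Rightarrow> ('g \<Rightarrow> complex mat) \<Rightarrow> 'g \<Rightarrow> complex mat" where
  "ext_power d m \<rho> g =
     mat (length (ext_basis d m)) (length (ext_basis d m))
       (\<lambda>(a, b). det (mat m m (\<lambda>(r, c). \<rho> g $$ (ext_basis d m ! a ! r, ext_basis d m ! b ! c))))"

definition det_rep :: "nat \<Rightarrow> ('g \<Rightarrow> complex mat) \<Rightarrow> 'g \<Rightarrow> complex mat" where
  "det_rep d \<rho> = ext_power d d \<rho>"


section \<open>Covariants\<close>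

text \<open>\<open>Sym(V)\<close> is the polynomial ring in a basis \<open>x\<^sub>0, \<dots>, x\<^sub>d\<^sub>-\<^sub>1\<close> of \<open>V\<close>. Polynomials are finitely
  supported functions from exponent vectors to coefficients.\<close>

type_synonym mpoly = "(nat \<Rightarrow>\<^sub>0 nat) \<Rightarrow>\<^sub>0 complex"

definition poly_var :: "nat \<Rightarrow> mpoly" where
  "poly_var i = Poly_Mapping.single (Poly_Mapping.single i 1) 1"

definition poly_const :: "complex \<Rightarrow> mpoly" where
  "poly_const c = Poly_Mapping.single 0 c"

definition Sym :: "nat \<Rightarrow> mpoly set" where
  "Sym d = {p. \<forall>a\<in>Poly_Mapping.keys p. Poly_Mapping.keys a \<subseteq> {..<d}}"

definition homogeneous :: "nat \<Rightarrow> mpoly \<Rightarrow> bool" where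
  "homogeneous k p \<longleftrightarrow> (\<forall>a\<in>Poly_Mapping.keys p. (\<Sum>i\<in>Poly_Mapping.keys a. Poly_Mapping.lookup a i) = k)"

text \<open>The value of the algebra homomorphism with \<open>x\<^sub>i \<mapsto> f i\<close>.\<close>

definition poly_subst :: "(nat \<Rightarrow> mpoly) \<Rightarrow> mpoly \<Rightarrow> mpoly" where
  "poly_subst f p =
     (\<Sum>a\<in>Poly_Mapping.keys p. poly_const (Poly_Mapping.lookup p a) * (\<Prod>i\<in>Poly_Mapping.keys a. f i ^ Poly_Mapping.lookup a i))"

definition sym_act :: "nat \<Rightarrow> complex mat \<Rightarrow> mpoly \<Rightarrow> mpoly" where
  "sym_act d A = poly_subst (\<lambda>j. \<Sum>i<d. poly_const (A $$ (i, j)) * poly_var i)"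

definition invariants ::
  "('g, 'b) monoid_scheme \<Rightarrow> nat \<Rightarrow> ('g \<Rightarrow> complex mat) \<Rightarrow> mpoly set" where
  "invariants G d \<rho> = {p\<in>Sym d. \<forall>g\<in>carrier G. sym_act d (\<rho> g) p = p}"

definition generated_alg :: "nat \<Rightarrow> (nat \<Rightarrow> mpoly) \<Rightarrow> mpoly set" where
  "generated_alg d \<theta> = poly_subst \<theta> ` Sym d"

definition hsop ::
  "('g, 'b) monoid_scheme \<Rightarrow> nat \<Rightarrow> ('g \<Rightarrow> complex mat) \<Rightarrow> (nat \<Rightarrow> mpoly) \<Rightarrow> bool" where
  "hsop G d \<rho> \<theta> \<longleftrightarrow>
     (\<forall>k<d. \<theta> k \<in> invariants G d \<rho> \<and> (\<exists>l>0. homogeneous l (\<theta> k))) \<and>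
     (\<forall>p\<in>Sym d. poly_subst \<theta> p = 0 \<longrightarrow> p = 0) \<and>
     (\<exists>B. finite B \<and> B \<subseteq> invariants G d \<rho> \<and>
        (\<forall>f\<in>invariants G d \<rho>. \<exists>c. (\<forall>b\<in>B. c b \<in> generated_alg d \<theta>) \<and> f = (\<Sum>b\<in>B. c b * b)))"

text \<open>The elements of \<open>Hom\<^sub>G(W, Sym(V))\<close>, where \<open>W\<close> is the space \<open>carrier_vec e\<close> of \<open>\<sigma>\<close>. Only the
  restriction to \<open>carrier_vec e\<close> of the function \<open>\<phi>\<close> is relevant.\<close>

definition covariant ::
  "('g, 'b) monoid_scheme \<Rightarrow> nat \<Rightarrow> ('g \<Rightarrow> complex mat) \<Rightarrow> nat \<Rightarrow> ('g \<Rightarrow> complex mat) \<Rightarrow>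
   (complex vec \<Rightarrow> mpoly) \<Rightarrow> bool" where
  "covariant G d \<rho> e \<sigma> \<phi> \<longleftrightarrow>
     (\<forall>v\<in>carrier_vec e. \<phi> v \<in> Sym d) \<and>
     (\<forall>v\<in>carrier_vec e. \<forall>w\<in>carrier_vec e. \<phi> (v + w) = \<phi> v + \<phi> w) \<and>
     (\<forall>c. \<forall>v\<in>carrier_vec e. \<phi> (c \<cdot>\<^sub>v v) = poly_const c * \<phi> v) \<and>
     (\<forall>g\<in>carrier G. \<forall>v\<in>carrier_vec e. \<phi> (\<sigma> g *\<^sub>v v) = sym_act d (\<rho> g) (\<phi> v))"

text \<open>\<open>b\<^sub>0, \<dots>, b\<^bsub>\<mu>-1\<^esub>\<close> is a basis, homogeneous of degrees \<open>m\<^sub>0, \<dots>, m\<^bsub>\<mu>-1\<^esub>\<close>, of the module of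
  covariants over the algebra generated by \<open>\<theta>\<^sub>0, \<dots>, \<theta>\<^bsub>d-1\<^esub>\<close>.\<close>

definition homogeneous_covariant_basis ::
  "('g, 'b) monoid_scheme \<Rightarrow> nat \<Rightarrow> ('g \<Rightarrow> complex mat) \<Rightarrow> (nat \<Rightarrow> mpoly) \<Rightarrow>
   nat \<Rightarrow> ('g \<Rightarrow> complex mat) \<Rightarrow> nat \<Rightarrow> (nat \<Rightarrow> nat) \<Rightarrow> (nat \<Rightarrow> complex vec \<Rightarrow> mpoly) \<Rightarrow> bool" where
  "homogeneous_covariant_basis G d \<rho> \<theta> e \<sigma> \<mu> m b \<longleftrightarrow>
     (\<forall>k<\<mu>. covariant G d \<rho> e \<sigma> (b k) \<and> (\<forall>v\<in>carrier_vec e. homogeneous (m k) (b k v))) \<and>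
     (\<forall>\<phi>. covariant G d \<rho> e \<sigma> \<phi> \<longrightarrow>
        (\<exists>!c. c \<in> {..<\<mu>} \<rightarrow>\<^sub>E generated_alg d \<theta> \<and>
              (\<forall>v\<in>carrier_vec e. \<phi> v = (\<Sum>k<\<mu>. c k * b k v))))"


section \<open>The matrices\<close>

text \<open>Rows and columns are indexed by \<open>0, \<dots>, n\<close>; the upper index is the row.\<close>

definition CG ::
  "('g, 'b) monoid_scheme \<Rightarrow> nat \<Rightarrow> (nat \<Rightarrow> 'g \<Rightarrow> complex mat) \<Rightarrow> ('g \<Rightarrow> complex mat) \<Rightarrow> complex mat" where
  "CG G n Rs Q = mat (n + 1) (n + 1) (\<lambda>(i, j). char_inner G (tensor_rep Q (Rs i)) (Rs j))"

text \<open>\<open>M[R\<^sub>A(-q)]\<close> as a matrix of polynomials in \<open>q\<close>. The sum stops at \<open>d\<close> because the higher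
  exterior powers vanish.\<close>

definition CG_ext ::
  "('g, 'b) monoid_scheme \<Rightarrow> nat \<Rightarrow> (nat \<Rightarrow> 'g \<Rightarrow> complex mat) \<Rightarrow> nat \<Rightarrow> ('g \<Rightarrow> complex mat) \<Rightarrow>
   complex poly mat" where
  "CG_ext G n Rs d R =
     mat (n + 1) (n + 1)
       (\<lambda>(i, j). \<Sum>m\<le>d. Polynomial.monom ((-1) ^ m * CG G n Rs (ext_power d m R) $$ (i, j)) m)"

text \<open>\<open>m j k\<close> is the degree of the basis element number \<open>k\<close> of the covariants of type \<open>R\<^sub>j\<close>.\<close>

definition D_row :: "(nat \<Rightarrow> nat) \<Rightarrow> (nat \<Rightarrow> nat \<Rightarrow> nat) \<Rightarrow> nat \<Rightarrow> complex poly" where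
  "D_row \<mu> m j = (\<Sum>k<\<mu> j. Polynomial.monom 1 (m j k))"

definition D_mat ::
  "('g, 'b) monoid_scheme \<Rightarrow> nat \<Rightarrow> (nat \<Rightarrow> 'g \<Rightarrow> complex mat) \<Rightarrow> (nat \<Rightarrow> nat) \<Rightarrow>
   (nat \<Rightarrow> nat \<Rightarrow> nat) \<Rightarrow> complex poly mat" where
  "D_mat G n Rs \<mu> m =
     mat (n + 1) (n + 1)
       (\<lambda>(i, j). \<Sum>k\<le>n. [:char_inner G (tensor_rep (Rs i) (Rs k)) (Rs j):] * D_row \<mu> m k)"

definition mat_deriv :: "nat \<Rightarrow> complex poly mat \<Rightarrow> complex poly mat" where
  "mat_deriv i N = map_mat (pderiv ^^ i) N"

definition at_one :: "complex poly mat \<Rightarrow> complex mat" where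
  "at_one N = map_mat (\<lambda>p. poly p 1) N"

text \<open>The last identity of the theorem is a correction. The source prints
  \<open>D[R]\<^bsup>d+1\<^esup> M[R\<^sub>A(-q)]\<^bsup>d+1\<^esup> = \<mu>\<^sub>0 |G| M[det R] M[R\<^sub>A(-1)]\<^bsup>d\<^esup>\<close> at \<open>q = 1\<close>, which is false: since
  \<open>D[R] M[R\<^sub>A(-q)] = (\<Prod>k. 1 - q\<^bsup>n\<^sub>k\<^esup>) \<cdot> 1\<close>, the left-hand side is zero for \<open>d > 0\<close>, whereas for the
  sign representation of the group of order two the right-hand side has rows \<open>(-2, 2)\<close> and
  \<open>(2, -2)\<close>. Differentiating the product \<open>d\<close> times, multiplying by \<open>D[R]\<^bsup>d\<^esup>\<close> and setting \<open>q = 1\<close>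
  gives instead \<open>D[R]\<^bsup>d+1\<^esup> M[R\<^sub>A(-q)]\<^bsup>(d)\<^esup> = (-1)\<^bsup>d\<^esup> d! \<mu>\<^sub>0 |G| D[R]\<^bsup>d\<^esup>\<close>, the counterpart of the
  preceding identity; as \<open>M[R\<^sub>A(-q)]\<^bsup>(d)\<^esup> = (-1)\<^bsup>d\<^esup> d! M[det R]\<close>, this is the same as
  \<open>D[R]\<^bsup>d+1\<^esup> M[det R] = \<mu>\<^sub>0 |G| D[R]\<^bsup>d\<^esup>\<close>. The theorem states both forms.\<close>

end

theory Submission
  imports Defs "Jordan_Normal_Form.Schur_Decomposition" "HOL-Algebra.Multiplicative_Group"
    "HOL-Computational_Algebra.Polynomial_FPS"
begin

text \<open>
  Let \<open>\<Lambda>\<^sub>g = det(1 - q R(g))\<close>, the alternating generating function of the characters of the exterior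
  powers, and let \<open>D\<^sub>g = \<Sum>\<^sub>j D[R]\<^sup>0\<^sub>j \<chi>\<^sub>j(g)\<close>. Every product \<open>\<chi>\<^sub>Q \<chi>\<^sub>i\<close> is a combination of irreducible characters
  with the Clebsch--Gordan coefficients, so the column \<open>(\<chi>\<^sub>0(g), \<dots>, \<chi>\<^sub>n(g))\<close> of the character table is an
  eigenvector of \<open>M[R\<^sub>A(-q)]\<close> with eigenvalue \<open>\<Lambda>\<^sub>g\<close> and of \<open>D[R]\<close> with eigenvalue \<open>D\<^sub>g\<close>
  (\<open>CG_ext_acts\<close>, \<open>D_mat_acts\<close>). The same holds for the derivatives at \<open>q = 1\<close>, with the derivatives of
  the eigenvalues. The rows of the table being independent (\<open>acts_unique\<close>), all identities reduce to
  identities between the numbers \<open>D\<^sub>g\<^sup>(\<^sup>i\<^sup>)(1)\<close> and \<open>\<Lambda>\<^sub>g\<^sup>(\<^sup>i\<^sup>)(1)\<close> for each single \<open>g\<close>.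

  These follow from one relation, \<open>D\<^sub>g \<Lambda>\<^sub>g = \<Prod>\<^sub>k (1 - q\<^bsup>n\<^sub>k\<^esup>)\<close> (\<open>graded_char_mult_rev_charpoly\<close>): the product has
  a zero of order \<open>d\<close> at \<open>q = 1\<close>, so if one factor does not vanish there, the other one has a zero of
  order \<open>d\<close> whose leading coefficient is determined (\<open>factor_derivatives_at_one\<close>); if it does vanish, both
  sides are zero. For the last identity, \<open>\<Lambda>\<^sub>g\<close> has degree at most \<open>d\<close>, and its \<open>d\<close>-th derivative is
  \<open>(-1)\<^sup>d d!\<close> times the character of \<open>det R\<close> (\<open>top_pderiv\<close>). The constant \<open>n\<^sub>1 \<cdots> n\<^sub>d\<close> equals \<open>\<mu>\<^sub>0 |G|\<close> because, by faithfulness, \<open>D\<^sub>g(1) = 0\<close> for \<open>g \<noteq> 1\<close>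
  (\<open>graded_char_at_one\<close>, \<open>theta_quotient_at_one\<close>).

  The relation itself computes the trace of \<open>g\<close> on the homogeneous components of \<open>Sym(V)\<close> in two bases.
  In the monomials, after triangularising \<open>R(g)\<close>, the generating function is \<open>1 / \<Lambda>\<^sub>g\<close>
  (\<open>sym_trace_generating_function\<close>). On the other hand the isotypic decomposition and the freeness of the
  modules of covariants show that the \<open>\<theta>\<close>-monomials times the values \<open>b\<^sub>j\<^sub>k(v\<^sub>c)\<close> of the basic covariants
  form a basis (\<open>covariant_values_span\<close>, \<open>covariant_values_independent\<close>), in which the generating
  function is \<open>D\<^sub>g / \<Prod>\<^sub>k (1 - q\<^bsup>n\<^sub>k\<^esup>)\<close>.

  The representation theory behind this is Schur's lemma, the orthogonality of matrix coefficients,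
  and the fact that the irreducible characters span the class functions.
\<close>

section \<open>Matrices and traces\<close>

definition trace :: "'a::comm_ring_1 mat \<Rightarrow> 'a" where
  "trace A = (\<Sum>i<dim_row A. A $$ (i, i))"

lemma character_eq_trace: "character \<rho> g = trace (\<rho> g)"
  by (simp add: character_def trace_def)

lemma index_mult_mat_sum:
  assumes "A \<in> carrier_mat n k" "B \<in> carrier_mat k m" "i < n" "j < m"
  shows "(A * B) $$ (i, j) = (\<Sum>l<k. A $$ (i, l) * B $$ (l, j))"
  using assms by (simp add: scalar_prod_def lessThan_atLeast0)

lemma index_mult_mat_vec_sum:
  assumes "A \<in> carrier_mat n k" "v \<in> carrier_vec k" "i < n"
  shows "(A *\<^sub>v v) $ i = (\<Sum>l<k. A $$ (i, l) * v $ l)"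
  using assms by (simp add: scalar_prod_def lessThan_atLeast0)

lemma trace_mult_comm:
  assumes A: "A \<in> carrier_mat n k" and B: "B \<in> carrier_mat k n"
  shows "trace (A * B) = trace (B * A)"
proof -
  have "trace (A * B) = (\<Sum>i<n. \<Sum>l<k. A $$ (i, l) * B $$ (l, i))"
    using A B by (simp add: trace_def index_mult_mat_sum[OF A B] del: index_mult_mat(1))
  also have "\<dots> = (\<Sum>l<k. \<Sum>i<n. B $$ (l, i) * A $$ (i, l))"
    by (subst sum.swap) (simp add: mult.commute)
  also have "\<dots> = trace (B * A)"
    using A B by (simp add: trace_def index_mult_mat_sum[OF B A] del: index_mult_mat(1))
  finally show ?thesis .
qed

lemma trace_one [simp]: "trace (1\<^sub>m n) = of_nat n"
  by (simp add: trace_def)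

lemma trace_smult: "trace (c \<cdot>\<^sub>m A) = c * trace A"
  if "A \<in> carrier_mat n n"
  using that by (simp add: trace_def sum_distrib_left)

text \<open>Matrices of a fixed size do not form a type, so a sum of matrices over the group, as it
  occurs in averaging arguments, is formed entrywise.\<close>

definition sum_mat :: "nat \<Rightarrow> nat \<Rightarrow> 'g set \<Rightarrow> ('g \<Rightarrow> 'a::comm_ring_1 mat) \<Rightarrow> 'a mat" where
  "sum_mat p r S F = mat p r (\<lambda>(i, j). \<Sum>g\<in>S. F g $$ (i, j))"

lemma sum_mat_carrier [simp]: "sum_mat p r S F \<in> carrier_mat p r"
  by (simp add: sum_mat_def)

lemma sum_mat_index [simp]:
  "i < p \<Longrightarrow> j < r \<Longrightarrow> sum_mat p r S F $$ (i, j) = (\<Sum>g\<in>S. F g $$ (i, j))"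
  by (simp add: sum_mat_def)

lemma sum_mat_dim [simp]: "dim_row (sum_mat p r S F) = p" "dim_col (sum_mat p r S F) = r"
  by (simp_all add: sum_mat_def)

lemma sum_mat_cong: "(\<And>g. g \<in> S \<Longrightarrow> F g = F' g) \<Longrightarrow> sum_mat p r S F = sum_mat p r S F'"
  by (intro eq_matI) auto

lemma mult_sum_mat:
  assumes A: "A \<in> carrier_mat q p" and F: "\<And>g. g \<in> S \<Longrightarrow> F g \<in> carrier_mat p r"
  shows "A * sum_mat p r S F = sum_mat q r S (\<lambda>g. A * F g)"
proof (rule eq_matI)
  fix i j assume "i < dim_row (sum_mat q r S (\<lambda>g. A * F g))" "j < dim_col (sum_mat q r S (\<lambda>g. A * F g))"
  then have ij: "i < q" "j < r" by auto
  have "(A * sum_mat p r S F) $$ (i, j) = (\<Sum>l<p. A $$ (i, l) * (\<Sum>g\<in>S. F g $$ (l, j)))"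
    using ij by (subst index_mult_mat_sum[OF A sum_mat_carrier]) auto
  also have "\<dots> = (\<Sum>g\<in>S. \<Sum>l<p. A $$ (i, l) * F g $$ (l, j))"
    by (subst sum.swap) (simp add: sum_distrib_left)
  also have "\<dots> = (\<Sum>g\<in>S. (A * F g) $$ (i, j))"
    using ij by (intro sum.cong refl index_mult_mat_sum[OF A F, symmetric])
  finally show "(A * sum_mat p r S F) $$ (i, j) = sum_mat q r S (\<lambda>g. A * F g) $$ (i, j)"
    using ij by simp
qed (use A in auto)

lemma sum_mat_mult:
  assumes A: "A \<in> carrier_mat r q" and F: "\<And>g. g \<in> S \<Longrightarrow> F g \<in> carrier_mat p r"
  shows "sum_mat p r S F * A = sum_mat p q S (\<lambda>g. F g * A)"
proof (rule eq_matI)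
  fix i j assume "i < dim_row (sum_mat p q S (\<lambda>g. F g * A))" "j < dim_col (sum_mat p q S (\<lambda>g. F g * A))"
  then have ij: "i < p" "j < q" by auto
  have "(sum_mat p r S F * A) $$ (i, j) = (\<Sum>l<r. (\<Sum>g\<in>S. F g $$ (i, l)) * A $$ (l, j))"
    using ij by (subst index_mult_mat_sum[OF sum_mat_carrier A]) auto
  also have "\<dots> = (\<Sum>g\<in>S. \<Sum>l<r. F g $$ (i, l) * A $$ (l, j))"
    by (subst sum.swap) (simp add: sum_distrib_right)
  also have "\<dots> = (\<Sum>g\<in>S. (F g * A) $$ (i, j))"
    using ij by (intro sum.cong refl index_mult_mat_sum[OF F A, symmetric])
  finally show "(sum_mat p r S F * A) $$ (i, j) = sum_mat p q S (\<lambda>g. F g * A) $$ (i, j)"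
    using ij by simp
qed (use A in auto)

lemma trace_sum_mat:
  assumes F: "\<And>g. g \<in> S \<Longrightarrow> F g \<in> carrier_mat p p"
  shows "trace (sum_mat p p S F) = (\<Sum>g\<in>S. trace (F g))"
proof -
  have "trace (sum_mat p p S F) = (\<Sum>i<p. \<Sum>g\<in>S. F g $$ (i, i))" by (simp add: trace_def)
  also have "\<dots> = (\<Sum>g\<in>S. \<Sum>i<p. F g $$ (i, i))" by (rule sum.swap)
  also have "\<dots> = (\<Sum>g\<in>S. trace (F g))"
    by (intro sum.cong refl) (use F in \<open>force simp: trace_def\<close>)
  finally show ?thesis .
qed

lemma mult_mat_vec_zero: "A \<in> carrier_mat n k \<Longrightarrow> A *\<^sub>v 0\<^sub>v k = 0\<^sub>v n"
  by (intro eq_vecI) (auto simp: scalar_prod_def)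

lemma smult_vec_zero: "c \<cdot>\<^sub>v 0\<^sub>v n = (0\<^sub>v n :: 'a::comm_ring_1 vec)"
  by (intro eq_vecI) auto

lemma mult_unit_vec_eq_col:
  fixes A :: "'a::comm_ring_1 mat"
  assumes A: "A \<in> carrier_mat n k" and j: "j < k"
  shows "A *\<^sub>v unit_vec k j = col A j"
proof (rule eq_vecI)
  fix i assume "i < dim_vec (col A j)"
  then have i: "i < n" using A by simp
  have "(A *\<^sub>v unit_vec k j) $ i = (\<Sum>l<k. A $$ (i, l) * unit_vec k j $ l)"
    by (rule index_mult_mat_vec_sum[OF A unit_vec_carrier i])
  also have "\<dots> = A $$ (i, j)" using j by (subst sum.remove[of _ j]) auto
  finally show "(A *\<^sub>v unit_vec k j) $ i = col A j $ i" using i j A by simp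
qed (use A in auto)

lemma mat_eq_zeroI:
  fixes T :: "'a::comm_ring_1 mat"
  assumes T: "T \<in> carrier_mat p r" and "\<And>v. v \<in> carrier_vec r \<Longrightarrow> T *\<^sub>v v = 0\<^sub>v p"
  shows "T = 0\<^sub>m p r"
proof (rule eq_matI)
  fix i j assume "i < dim_row (0\<^sub>m p r :: 'a mat)" "j < dim_col (0\<^sub>m p r :: 'a mat)"
  then have ij: "i < p" "j < r" by simp_all
  have "col T j = 0\<^sub>v p"
    using assms(2)[of "unit_vec r j"] mult_unit_vec_eq_col[OF T ij(2)] by simp
  then have "col T j $ i = 0" using ij by simp
  then show "T $$ (i, j) = 0\<^sub>m p r $$ (i, j)" using ij T by simp
qed (use T in auto)

section \<open>Schur's lemma and orthogonality\<close>

lemma subspace_vecI: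
  assumes "W \<subseteq> carrier_vec d" "0\<^sub>v d \<in> W"
    "\<And>v w. v \<in> W \<Longrightarrow> w \<in> W \<Longrightarrow> v + w \<in> W" "\<And>c v. v \<in> W \<Longrightarrow> c \<cdot>\<^sub>v v \<in> W"
  shows "VectorSpace.subspace class_ring W (module_vec TYPE(complex) d)"
  unfolding VectorSpace.subspace_def submodule_def
  using assms vec_vs[where n = d] vec_module[where n = d] by (auto simp: module_vec_simps)

lemma subspace_vecD:
  assumes "VectorSpace.subspace class_ring W (module_vec TYPE(complex) d)"
  shows "W \<subseteq> carrier_vec d" "0\<^sub>v d \<in> W"
    "\<And>v w. v \<in> W \<Longrightarrow> w \<in> W \<Longrightarrow> v + w \<in> W" "\<And>c v. v \<in> W \<Longrightarrow> c \<cdot>\<^sub>v v \<in> W"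
  using assms unfolding VectorSpace.subspace_def submodule_def by (auto simp: module_vec_simps class_ring_simps)

lemma irreducible_repD:
  assumes "irreducible_rep G d \<rho>" "W \<subseteq> carrier_vec d" "0\<^sub>v d \<in> W"
    "\<And>v w. v \<in> W \<Longrightarrow> w \<in> W \<Longrightarrow> v + w \<in> W" "\<And>c v. v \<in> W \<Longrightarrow> c \<cdot>\<^sub>v v \<in> W"
    "\<And>g w. g \<in> carrier G \<Longrightarrow> w \<in> W \<Longrightarrow> \<rho> g *\<^sub>v w \<in> W"
  shows "W = {0\<^sub>v d} \<or> W = carrier_vec d"
proof -
  have "VectorSpace.subspace class_ring W (module_vec TYPE(complex) d)"
    by (rule subspace_vecI[OF assms(2-5)])
  then show ?thesis using assms(1,6) unfolding irreducible_rep_def by simp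
qed

text \<open>The kernel of an intertwiner is invariant.\<close>

lemma intertwiner_kernel:
  assumes irr: "irreducible_rep G r \<sigma>" and T: "T \<in> carrier_mat p r"
    and \<rho>: "\<And>g. g \<in> carrier G \<Longrightarrow> \<rho> g \<in> carrier_mat p p"
    and int: "\<And>g. g \<in> carrier G \<Longrightarrow> \<rho> g * T = T * \<sigma> g"
  shows "(\<forall>v\<in>carrier_vec r. T *\<^sub>v v = 0\<^sub>v p \<longrightarrow> v = 0\<^sub>v r) \<or> T = 0\<^sub>m p r"
proof -
  have \<sigma>: "\<And>g. g \<in> carrier G \<Longrightarrow> \<sigma> g \<in> carrier_mat r r"
    using irr by (auto simp: irreducible_rep_def representation_def)
  define W where "W = {v \<in> carrier_vec r. T *\<^sub>v v = 0\<^sub>v p}"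
  have "W = {0\<^sub>v r} \<or> W = carrier_vec r"
  proof (rule irreducible_repD[OF irr])
    fix g w assume g: "g \<in> carrier G" and w: "w \<in> W"
    then have wc: "w \<in> carrier_vec r" and w0: "T *\<^sub>v w = 0\<^sub>v p" by (auto simp: W_def)
    have "T *\<^sub>v (\<sigma> g *\<^sub>v w) = (T * \<sigma> g) *\<^sub>v w"
      by (rule assoc_mult_mat_vec[OF T \<sigma>[OF g] wc, symmetric])
    also have "\<dots> = \<rho> g *\<^sub>v (T *\<^sub>v w)"
      unfolding int[OF g, symmetric] by (rule assoc_mult_mat_vec[OF \<rho>[OF g] T wc])
    also have "\<dots> = 0\<^sub>v p" unfolding w0 by (rule mult_mat_vec_zero[OF \<rho>[OF g]])
    finally show "\<sigma> g *\<^sub>v w \<in> W" using wc \<sigma>[OF g] by (simp add: W_def)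
  next
    show "v + w \<in> W" if "v \<in> W" "w \<in> W" for v w
      using that by (simp add: W_def mult_add_distrib_mat_vec[OF T])
    show "c \<cdot>\<^sub>v v \<in> W" if "v \<in> W" for c v
      using that by (simp add: W_def mult_mat_vec[OF T] smult_vec_zero)
    show "0\<^sub>v r \<in> W" using mult_mat_vec_zero[OF T] by (simp add: W_def)
    show "W \<subseteq> carrier_vec r" by (simp add: W_def)
  qed
  then show ?thesis
  proof
    assume W: "W = carrier_vec r"
    have "T = 0\<^sub>m p r"
    proof (rule mat_eq_zeroI[OF T])
      fix v :: "complex vec" assume "v \<in> carrier_vec r"
      then have "v \<in> W" unfolding W .
      then show "T *\<^sub>v v = 0\<^sub>v p" unfolding W_def by simp
    qed
    then show ?thesis ..
  next
    assume W: "W = {0\<^sub>v r}"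
    show ?thesis
    proof (intro disjI1 ballI impI)
      fix v :: "complex vec" assume "v \<in> carrier_vec r" "T *\<^sub>v v = 0\<^sub>v p"
      then have "v \<in> W" unfolding W_def by simp
      then show "v = 0\<^sub>v r" unfolding W by simp
    qed
  qed
qed

text \<open>The kernel and the image of \<open>T\<close> are invariant, so \<open>T\<close> is injective and surjective and has
  a two-sided inverse \<open>U\<close>. That \<open>T\<close> is a square matrix follows by comparing the traces of
  \<open>T U = 1\<close> and \<open>U T = 1\<close>.\<close>

lemma schur_isomorphic:
  assumes \<rho>: "irreducible_rep G p \<rho>" and \<sigma>: "irreducible_rep G r \<sigma>" and T: "T \<in> carrier_mat p r"
    and int: "\<And>g. g \<in> carrier G \<Longrightarrow> \<rho> g * T = T * \<sigma> g" and nz: "T \<noteq> 0\<^sub>m p r"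
  shows "isomorphic_reps G p \<rho> r \<sigma>"
proof -
  have cs: "\<And>g. g \<in> carrier G \<Longrightarrow> \<rho> g \<in> carrier_mat p p" "\<And>g. g \<in> carrier G \<Longrightarrow> \<sigma> g \<in> carrier_mat r r"
    using \<rho> \<sigma> by (auto simp: irreducible_rep_def representation_def)
  have inj: "\<And>v. v \<in> carrier_vec r \<Longrightarrow> T *\<^sub>v v = 0\<^sub>v p \<Longrightarrow> v = 0\<^sub>v r"
    using intertwiner_kernel[OF \<sigma> T cs(1) int] nz by blast
  define W where "W = (\<lambda>v. T *\<^sub>v v) ` carrier_vec r"
  have "W = {0\<^sub>v p} \<or> W = carrier_vec p"
  proof (rule irreducible_repD[OF \<rho>])
    show "0\<^sub>v p \<in> W" unfolding W_def
      by (rule image_eqI[of _ _ "0\<^sub>v r"]) (simp_all add: mult_mat_vec_zero[OF T])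
    show "v + w \<in> W" if "v \<in> W" "w \<in> W" for v w
    proof -
      from that obtain a b where "v = T *\<^sub>v a" "w = T *\<^sub>v b" "a \<in> carrier_vec r" "b \<in> carrier_vec r"
        by (auto simp: W_def)
      then show ?thesis using T
        unfolding W_def by (intro image_eqI[of _ _ "a + b"]) (simp_all add: mult_add_distrib_mat_vec)
    qed
    show "c \<cdot>\<^sub>v v \<in> W" if "v \<in> W" for c v
    proof -
      from that obtain a where "v = T *\<^sub>v a" "a \<in> carrier_vec r" by (auto simp: W_def)
      then show ?thesis using T
        unfolding W_def by (intro image_eqI[of _ _ "c \<cdot>\<^sub>v a"]) (simp_all add: mult_mat_vec)
    qed
    show "\<rho> g *\<^sub>v w \<in> W" if g: "g \<in> carrier G" and w: "w \<in> W" for g w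
    proof -
      from w obtain a where a: "w = T *\<^sub>v a" "a \<in> carrier_vec r" by (auto simp: W_def)
      then have "\<rho> g *\<^sub>v w = (\<rho> g * T) *\<^sub>v a" using T cs[OF g] by simp
      also have "\<dots> = T *\<^sub>v (\<sigma> g *\<^sub>v a)" unfolding int[OF g] using T cs[OF g] a by simp
      finally have "\<rho> g *\<^sub>v w = T *\<^sub>v (\<sigma> g *\<^sub>v a)" .
      then show ?thesis using a cs[OF g] by (auto simp: W_def)
    qed
  qed (use T in \<open>auto simp: W_def\<close>)
  moreover have "W \<noteq> {0\<^sub>v p}"
  proof
    assume W0: "W = {0\<^sub>v p}"
    have "T = 0\<^sub>m p r"
    proof (rule mat_eq_zeroI[OF T])
      fix v :: "complex vec" assume "v \<in> carrier_vec r"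
      then have "T *\<^sub>v v \<in> W" unfolding W_def by (rule imageI)
      then show "T *\<^sub>v v = 0\<^sub>v p" unfolding W0 by simp
    qed
    then show False using nz by simp
  qed
  ultimately have surj: "W = carrier_vec p" by blast
  have "\<forall>i. i < p \<longrightarrow> (\<exists>u. u \<in> carrier_vec r \<and> T *\<^sub>v u = unit_vec p i)"
  proof (intro allI impI)
    fix i assume "i < p"
    have "unit_vec p i \<in> W" using surj by simp
    then show "\<exists>u. u \<in> carrier_vec r \<and> T *\<^sub>v u = unit_vec p i" by (auto simp: W_def)
  qed
  then obtain u where u: "\<And>i. i < p \<Longrightarrow> u i \<in> carrier_vec r" "\<And>i. i < p \<Longrightarrow> T *\<^sub>v u i = unit_vec p i"
    by metis
  define U where "U = mat r p (\<lambda>(i, j). u j $ i)"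
  have U: "U \<in> carrier_mat r p" by (simp add: U_def)
  have colU: "col U j = u j" if "j < p" for j
    using that u(1)[OF that] by (intro eq_vecI) (auto simp: U_def)
  have TU: "T * U = 1\<^sub>m p"
  proof (rule eq_matI)
    fix i j assume ij: "i < dim_row (1\<^sub>m p)" "j < dim_col (1\<^sub>m p)"
    have "(T * U) $$ (i, j) = (T *\<^sub>v u j) $ i" using ij T U colU by simp
    then show "(T * U) $$ (i, j) = 1\<^sub>m p $$ (i, j)" using ij u(2)[of j] by auto
  qed (use T U in auto)
  have UT: "U * T = 1\<^sub>m r"
  proof (rule mat_col_eqI)
    fix j assume "j < dim_col (1\<^sub>m r :: complex mat)"
    then have j: "j < r" by simp
    define w where "w = (U * T) *\<^sub>v unit_vec r j"
    have w: "w \<in> carrier_vec r" using U T by (simp add: w_def)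
    have col_UT: "col (U * T) j = w"
      unfolding w_def by (rule mult_unit_vec_eq_col[symmetric]) (use U T j in auto)
    have "T *\<^sub>v w = (T * U) *\<^sub>v (T *\<^sub>v unit_vec r j)"
      unfolding w_def using T U by simp
    also have "\<dots> = T *\<^sub>v unit_vec r j" using TU T by simp
    finally have "T *\<^sub>v (w - unit_vec r j) = 0\<^sub>v p"
      using T w by (simp add: mult_minus_distrib_mat_vec[of _ p r])
    then have "w - unit_vec r j = 0\<^sub>v r" using inj w by simp
    then have "w $ i = unit_vec r j $ i" if "i < r" for i
    proof -
      have "(w - unit_vec r j) $ i = 0" using \<open>w - unit_vec r j = 0\<^sub>v r\<close> that by simp
      then show ?thesis using that w by simp
    qed
    then have "w = unit_vec r j" using w by (intro eq_vecI) auto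
    then show "col (U * T) j = col (1\<^sub>m r) j"
      unfolding col_UT using j w_def by simp
  qed (use U T in auto)
  have "(of_nat p :: complex) = trace (T * U)" by (simp add: TU)
  also have "\<dots> = of_nat r" by (simp add: trace_mult_comm[OF T U] UT)
  finally have pr: "p = r" by simp
  have "invertible_mat U"
    unfolding invertible_mat_def inverts_mat_def using U T TU UT pr by auto
  moreover have "U * \<rho> g = \<sigma> g * U" if g: "g \<in> carrier G" for g
  proof -
    note c = cs[OF g] U T
    have "U * \<rho> g = (U * \<rho> g) * (T * U)" using c TU by simp
    also have "\<dots> = ((U * \<rho> g) * T) * U" by (rule assoc_mult_mat[symmetric]) (use c in auto)
    also have "(U * \<rho> g) * T = U * (T * \<sigma> g)" using c int[OF g] by (simp add: assoc_mult_mat[of _ r p _ p _ r])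
    also have "\<dots> = (U * T) * \<sigma> g" by (rule assoc_mult_mat[symmetric]) (use c in auto)
    also have "\<dots> = \<sigma> g" using c UT by simp
    finally show ?thesis .
  qed
  ultimately show ?thesis unfolding isomorphic_reps_def using pr U by blast
qed

text \<open>For an eigenvalue \<open>k\<close> of \<open>T\<close> the intertwiner \<open>T - k\<close> has a nonzero kernel, hence vanishes.\<close>

lemma schur_scalar:
  assumes \<rho>: "irreducible_rep G p \<rho>" and T: "T \<in> carrier_mat p p"
    and int: "\<And>g. g \<in> carrier G \<Longrightarrow> \<rho> g * T = T * \<rho> g"
  shows "T = (trace T / of_nat p) \<cdot>\<^sub>m 1\<^sub>m p"
proof -
  have cs: "\<And>g. g \<in> carrier G \<Longrightarrow> \<rho> g \<in> carrier_mat p p" and p: "p > 0"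
    using \<rho> by (auto simp: irreducible_rep_def representation_def)
  have "\<exists>k. eigenvalue T k"
  proof -
    have "degree (char_poly T) = p" using degree_monic_char_poly[OF T] by simp
    then have "\<not> constant (poly (char_poly T))" using p by (simp add: constant_degree)
    then obtain k where "poly (char_poly T) k = 0" using fundamental_theorem_of_algebra by blast
    then show ?thesis using eigenvalue_root_char_poly[OF T] by blast
  qed
  then obtain k v where v: "v \<in> carrier_vec p" "v \<noteq> 0\<^sub>v p" "T *\<^sub>v v = k \<cdot>\<^sub>v v"
    using T by (auto simp: eigenvalue_def eigenvector_def)
  define N where "N = T - k \<cdot>\<^sub>m 1\<^sub>m p"
  have N: "N \<in> carrier_mat p p" using T by (auto simp: N_def intro!: minus_carrier_mat)
  have comm: "\<rho> g * N = N * \<rho> g" if g: "g \<in> carrier G" for g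
  proof -
    have "\<rho> g * N = \<rho> g * T - k \<cdot>\<^sub>m \<rho> g" "N * \<rho> g = T * \<rho> g - k \<cdot>\<^sub>m \<rho> g"
      unfolding N_def using cs[OF g] T
      by (simp_all add: mult_minus_distrib_mat[of _ p p _ p] minus_mult_distrib_mat[of _ p p _ _ p]
          mult_smult_distrib[of _ p p _ p] mult_smult_assoc_mat[of _ p p _ p])
    then show ?thesis using int[OF g] by simp
  qed
  have "(\<forall>v\<in>carrier_vec p. N *\<^sub>v v = 0\<^sub>v p \<longrightarrow> v = 0\<^sub>v p) \<or> N = 0\<^sub>m p p"
    by (rule intertwiner_kernel[OF \<rho> N cs comm])
  moreover have "N *\<^sub>v v = 0\<^sub>v p"
  proof (rule eq_vecI)
    fix i assume "i < dim_vec (0\<^sub>v p :: complex vec)"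
    then have i: "i < p" by simp
    have "(N *\<^sub>v v) $ i = (\<Sum>l<p. N $$ (i, l) * v $ l)" by (rule index_mult_mat_vec_sum[OF N v(1) i])
    also have "\<dots> = (\<Sum>l<p. T $$ (i, l) * v $ l) - (\<Sum>l<p. (k * (if i = l then 1 else 0)) * v $ l)"
      using i T by (simp add: N_def left_diff_distrib sum_subtractf)
    also have "(\<Sum>l<p. T $$ (i, l) * v $ l) = (T *\<^sub>v v) $ i"
      by (rule index_mult_mat_vec_sum[OF T v(1) i, symmetric])
    also have "(\<Sum>l<p. (k * (if i = l then 1 else 0)) * v $ l) = k * v $ i"
      using i by (subst sum.remove[of _ i]) auto
    finally show "(N *\<^sub>v v) $ i = 0\<^sub>v p $ i" using v i by simp
  qed (use N in auto)
  ultimately have N0: "N = 0\<^sub>m p p" using v by blast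
  have Tk: "T = k \<cdot>\<^sub>m 1\<^sub>m p"
  proof (rule eq_matI)
    fix i j assume ij: "i < dim_row (k \<cdot>\<^sub>m 1\<^sub>m p :: complex mat)" "j < dim_col (k \<cdot>\<^sub>m 1\<^sub>m p :: complex mat)"
    then have "N $$ (i, j) = 0" using N0 by simp
    then show "T $$ (i, j) = (k \<cdot>\<^sub>m 1\<^sub>m p) $$ (i, j)" using ij T by (simp add: N_def)
  qed (use T in auto)
  have "trace T = k * of_nat p" unfolding Tk by (subst trace_smult[of _ p]) auto
  then have "trace T / of_nat p = k" using p by simp
  then show ?thesis using Tk by simp
qed

section \<open>Representations of a finite group\<close>

locale irreps = group G for G :: "('g, 'b) monoid_scheme" (structure) +
  fixes n :: nat and e :: "nat \<Rightarrow> nat" and Rs :: "nat \<Rightarrow> 'g \<Rightarrow> complex mat"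
  assumes fin: "finite (carrier G)" and irr: "irreducibles G n e Rs"
begin

abbreviation N :: nat where "N \<equiv> card (carrier G)"

lemma N_pos: "N > 0"
  using fin by (auto simp: card_gt_0_iff)

lemma repD:
  assumes "representation G d \<rho>"
  shows "g \<in> carrier G \<Longrightarrow> \<rho> g \<in> carrier_mat d d" "\<rho> \<one> = 1\<^sub>m d"
    "g \<in> carrier G \<Longrightarrow> h \<in> carrier G \<Longrightarrow> \<rho> (g \<otimes> h) = \<rho> g * \<rho> h"
  using assms by (auto simp: representation_def)

lemma rep_inv:
  assumes "representation G d \<rho>" "g \<in> carrier G"
  shows "\<rho> g * \<rho> (inv g) = 1\<^sub>m d" "\<rho> (inv g) * \<rho> g = 1\<^sub>m d"
  using repD[OF assms(1)] assms(2) by (metis inv_closed r_inv, metis inv_closed l_inv)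

lemma sum_left_translate:
  fixes f :: "'g \<Rightarrow> 'c::comm_monoid_add"
  assumes h: "h \<in> carrier G"
  shows "(\<Sum>g\<in>carrier G. f (h \<otimes> g)) = (\<Sum>g\<in>carrier G. f g)"
  by (rule sum.reindex_bij_witness[where i = "\<lambda>g. inv h \<otimes> g" and j = "\<lambda>g. h \<otimes> g"])
    (use h in \<open>auto simp: m_assoc[symmetric]\<close>)

lemma sum_right_translate:
  fixes f :: "'g \<Rightarrow> 'c::comm_monoid_add"
  assumes h: "h \<in> carrier G"
  shows "(\<Sum>g\<in>carrier G. f (g \<otimes> h)) = (\<Sum>g\<in>carrier G. f g)"
  by (rule sum.reindex_bij_witness[where i = "\<lambda>g. g \<otimes> inv h" and j = "\<lambda>g. g \<otimes> h"])
    (use h in \<open>auto simp: m_assoc\<close>)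

lemma character_rep:
  assumes "representation G d \<rho>" "g \<in> carrier G"
  shows "character \<rho> g = (\<Sum>i<d. \<rho> g $$ (i, i))"
  using repD(1)[OF assms] by (simp add: character_def)

lemma character_one: "representation G d \<rho> \<Longrightarrow> character \<rho> \<one> = of_nat d"
  by (simp add: character_eq_trace repD)

lemma character_conj:
  assumes \<rho>: "representation G d \<rho>" and gh: "g \<in> carrier G" "h \<in> carrier G"
  shows "character \<rho> (h \<otimes> g \<otimes> inv h) = character \<rho> g"
proof -
  have c: "\<rho> g \<in> carrier_mat d d" "\<rho> h \<in> carrier_mat d d" "\<rho> (inv h) \<in> carrier_mat d d"
    using repD(1)[OF \<rho>] gh by auto
  have "trace (\<rho> (h \<otimes> g \<otimes> inv h)) = trace (\<rho> h * \<rho> g * \<rho> (inv h))"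
    using gh by (simp add: repD(3)[OF \<rho>])
  also have "\<dots> = trace (\<rho> (inv h) * (\<rho> h * \<rho> g))"
    by (rule trace_mult_comm) (use c in auto)
  also have "\<rho> (inv h) * (\<rho> h * \<rho> g) = (\<rho> (inv h) * \<rho> h) * \<rho> g"
    by (rule assoc_mult_mat[symmetric]) (use c in auto)
  also have "\<dots> = \<rho> g" using rep_inv[OF \<rho> gh(2)] c by simp
  finally show ?thesis by (simp add: character_eq_trace)
qed

lemma Rs_irr: "j \<le> n \<Longrightarrow> irreducible_rep G (e j) (Rs j)"
  and Rs_rep: "j \<le> n \<Longrightarrow> representation G (e j) (Rs j)"
  and e_pos: "j \<le> n \<Longrightarrow> e j > 0"
  and Rs_distinct: "i \<le> n \<Longrightarrow> j \<le> n \<Longrightarrow> isomorphic_reps G (e i) (Rs i) (e j) (Rs j) \<Longrightarrow> i = j"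
  and Rs_complete: "irreducible_rep G d \<rho> \<Longrightarrow> \<exists>i\<le>n. isomorphic_reps G d \<rho> (e i) (Rs i)"
  using irr by (auto simp: irreducibles_def irreducible_rep_def)

lemmas Rs_carrier = repD(1)[OF Rs_rep] and Rs_mult = repD(3)[OF Rs_rep]

abbreviation \<chi> :: "nat \<Rightarrow> 'g \<Rightarrow> complex" where "\<chi> j \<equiv> character (Rs j)"

lemma average_intertwines:
  assumes \<rho>: "representation G p \<rho>" and \<sigma>: "representation G r \<sigma>" and Z: "Z \<in> carrier_mat p r"
    and h: "h \<in> carrier G"
  defines "T \<equiv> sum_mat p r (carrier G) (\<lambda>g. \<rho> g * Z * \<sigma> (inv g))"
  shows "\<rho> h * T = T * \<sigma> h"
proof -
  note c = repD(1)[OF \<rho>] repD(1)[OF \<sigma>]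
  have F: "\<rho> g * Z * \<sigma> (inv g) \<in> carrier_mat p r" if "g \<in> carrier G" for g
    using c that Z by (meson inv_closed mult_carrier_mat)
  have step: "\<rho> h * (\<rho> g * Z * \<sigma> (inv g)) = \<rho> (h \<otimes> g) * Z * \<sigma> (inv (h \<otimes> g)) * \<sigma> h"
    if g: "g \<in> carrier G" for g
  proof -
    note cc = c(1)[OF g] c(1)[OF h] c(2)[OF g] c(2)[OF h] c(2)[OF inv_closed[OF g]] c(2)[OF inv_closed[OF h]] Z
    have 1: "\<rho> (h \<otimes> g) * Z * \<sigma> (inv (h \<otimes> g)) * \<sigma> h = \<rho> (h \<otimes> g) * Z * (\<sigma> (inv (h \<otimes> g)) * \<sigma> h)"
      by (rule assoc_mult_mat[of _ p r _ r _ r]) (use c g h Z in \<open>auto intro!: mult_carrier_mat[of _ p p _ r]\<close>)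
    have 2: "\<sigma> (inv (h \<otimes> g)) * \<sigma> h = \<sigma> (inv g)"
      using g h by (simp add: repD(3)[OF \<sigma>, symmetric] inv_mult_group m_assoc)
    have 3: "\<rho> (h \<otimes> g) * Z = \<rho> h * (\<rho> g * Z)"
      using assoc_mult_mat[OF cc(2,1) Z] g h by (simp add: repD(3)[OF \<rho>])
    have 4: "\<rho> h * (\<rho> g * Z) * \<sigma> (inv g) = \<rho> h * (\<rho> g * Z * \<sigma> (inv g))"
      by (rule assoc_mult_mat[of _ p p _ r _ r]) (use cc in auto)
    show ?thesis unfolding 1 2 unfolding 3 4 ..
  qed
  have "\<rho> h * T = sum_mat p r (carrier G) (\<lambda>g. \<rho> h * (\<rho> g * Z * \<sigma> (inv g)))"
    unfolding T_def by (rule mult_sum_mat) (use c h F in auto)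
  also have "\<dots> = sum_mat p r (carrier G) (\<lambda>g. \<rho> (h \<otimes> g) * Z * \<sigma> (inv (h \<otimes> g)) * \<sigma> h)"
    by (rule sum_mat_cong) (rule step)
  also have "\<dots> = sum_mat p r (carrier G) (\<lambda>g. \<rho> g * Z * \<sigma> (inv g) * \<sigma> h)"
    unfolding sum_mat_def
    by (subst sum_left_translate[OF h, of "\<lambda>g. (\<rho> g * Z * \<sigma> (inv g) * \<sigma> h) $$ _"]) simp
  also have "\<dots> = T * \<sigma> h"
    unfolding T_def by (rule sum_mat_mult[symmetric]) (use c h F in auto)
  finally show ?thesis .
qed

text \<open>Schur's lemma for the average of the matrix unit \<open>Z\<close> with its entry in position \<open>(a, b)\<close>.\<close>

lemma matrix_coefficient_orthogonality:
  assumes i: "i \<le> n" and j: "j \<le> n" and a: "a < e i" and c: "c < e i" and b: "b < e j" and d: "d < e j"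
  shows "(\<Sum>g\<in>carrier G. Rs i g $$ (c, a) * Rs j (inv g) $$ (b, d)) =
    (if i = j \<and> a = b \<and> c = d then of_nat N / of_nat (e j) else 0)"
proof -
  define Z where "Z = mat (e i) (e j) (\<lambda>(x, y). if x = a \<and> y = b then 1 else (0::complex))"
  define F where "F g = Rs i g * Z * Rs j (inv g)" for g
  define T where "T = sum_mat (e i) (e j) (carrier G) F"
  have Z: "Z \<in> carrier_mat (e i) (e j)" by (simp add: Z_def)
  have cs: "Rs i g \<in> carrier_mat (e i) (e i)" "Rs j (inv g) \<in> carrier_mat (e j) (e j)"
    if "g \<in> carrier G" for g
    using that Rs_carrier i j by auto
  have F: "F g \<in> carrier_mat (e i) (e j)" if "g \<in> carrier G" for g
    using cs[OF that] Z by (auto simp: F_def)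
  have T: "T \<in> carrier_mat (e i) (e j)" by (simp add: T_def)
  have int: "Rs i h * T = T * Rs j h" if "h \<in> carrier G" for h
    unfolding T_def F_def by (rule average_intertwines[OF Rs_rep[OF i] Rs_rep[OF j] Z that])
  have entry: "F g $$ (c, d) = Rs i g $$ (c, a) * Rs j (inv g) $$ (b, d)" if g: "g \<in> carrier G" for g
  proof -
    have RZ: "(Rs i g * Z) $$ (c, y) = (if y = b then Rs i g $$ (c, a) else 0)" if y: "y < e j" for y
    proof -
      have "(Rs i g * Z) $$ (c, y) = (\<Sum>l<e i. Rs i g $$ (c, l) * Z $$ (l, y))"
        by (rule index_mult_mat_sum[OF cs(1)[OF g] Z c y])
      also have "\<dots> = (\<Sum>l<e i. if l = a then (if y = b then Rs i g $$ (c, a) else 0) else 0)"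
        using y by (intro sum.cong) (auto simp: Z_def)
      also have "\<dots> = (if y = b then Rs i g $$ (c, a) else 0)" using a by simp
      finally show ?thesis .
    qed
    have "F g $$ (c, d) = (\<Sum>l<e j. (Rs i g * Z) $$ (c, l) * Rs j (inv g) $$ (l, d))"
      unfolding F_def by (rule index_mult_mat_sum) (use cs[OF g] Z c d in auto)
    also have "\<dots> = (\<Sum>l<e j. if l = b then Rs i g $$ (c, a) * Rs j (inv g) $$ (b, d) else 0)"
      by (intro sum.cong) (auto simp: RZ)
    also have "\<dots> = Rs i g $$ (c, a) * Rs j (inv g) $$ (b, d)" using b by simp
    finally show ?thesis .
  qed
  have lhs: "(\<Sum>g\<in>carrier G. Rs i g $$ (c, a) * Rs j (inv g) $$ (b, d)) = T $$ (c, d)"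
    using c d by (simp add: T_def entry)
  show ?thesis
  proof (cases "i = j")
    case False
    then have "T = 0\<^sub>m (e i) (e j)"
      using schur_isomorphic[OF Rs_irr[OF i] Rs_irr[OF j] T int] Rs_distinct[OF i j] by blast
    then show ?thesis using False lhs c d by simp
  next
    case True
    have TT: "T = (trace T / of_nat (e j)) \<cdot>\<^sub>m 1\<^sub>m (e j)"
      using schur_scalar[OF Rs_irr[OF j], of T] T int True by simp
    have "trace (F g) = trace Z" if g: "g \<in> carrier G" for g
    proof -
      have "trace (F g) = trace (Rs j (inv g) * (Rs j g * Z))"
        unfolding F_def True by (rule trace_mult_comm) (use cs[OF g] Z True in auto)
      also have "Rs j (inv g) * (Rs j g * Z) = (Rs j (inv g) * Rs j g) * Z"
        by (rule assoc_mult_mat[symmetric]) (use cs[OF g] Z True in auto)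
      also have "\<dots> = Z" using rep_inv[OF Rs_rep[OF j] g] Z True by simp
      finally show ?thesis .
    qed
    then have "trace T = of_nat N * trace Z"
      unfolding T_def using True F trace_sum_mat[of "carrier G" F "e j"] by simp
    also have "trace Z = (if a = b then 1 else 0)"
    proof -
      have "trace Z = (\<Sum>x<e i. if x = a then (if a = b then 1 else 0) else 0)"
        unfolding trace_def using True by (intro sum.cong) (auto simp: Z_def)
      then show ?thesis using a by simp
    qed
    finally have tr: "trace T = (if a = b then of_nat N else 0)" by simp
    have "T $$ (c, d) = (trace T / of_nat (e j)) * (if c = d then 1 else 0)"
      using arg_cong[OF TT, of "\<lambda>A. A $$ (c, d)"] c d True by simp
    then show ?thesis using lhs tr True by auto
  qed
qed

lemma character_orthogonality_inv:
  assumes i: "i \<le> n" and j: "j \<le> n"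
  shows "(\<Sum>g\<in>carrier G. \<chi> i g * \<chi> j (inv g)) = (if i = j then of_nat N else 0)"
proof -
  have "(\<Sum>g\<in>carrier G. \<chi> i g * \<chi> j (inv g)) =
      (\<Sum>g\<in>carrier G. \<Sum>a<e i. \<Sum>b<e j. Rs i g $$ (a, a) * Rs j (inv g) $$ (b, b))"
    using i j by (intro sum.cong) (auto simp: character_rep[OF Rs_rep] sum_product)
  also have "\<dots> = (\<Sum>a<e i. \<Sum>b<e j. \<Sum>g\<in>carrier G. Rs i g $$ (a, a) * Rs j (inv g) $$ (b, b))"
    by (subst sum.swap, rule sum.cong[OF refl], rule sum.swap)
  also have "\<dots> = (\<Sum>a<e i. \<Sum>b<e j. if b = a \<and> i = j then of_nat N / of_nat (e j) else 0)"
    using i j by (intro sum.cong refl) (subst matrix_coefficient_orthogonality; auto)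
  also have "\<dots> = (if i = j then of_nat N else 0)"
  proof (cases "i = j")
    case True
    have "(\<Sum>a<e i. \<Sum>b<e j. if b = a \<and> i = j then of_nat N / of_nat (e j) else 0) =
        (\<Sum>a<e j. of_nat N / of_nat (e j) :: complex)"
      using True by (intro sum.cong) auto
    then show ?thesis using True e_pos[OF j] by simp
  qed simp
  finally show ?thesis .
qed

end

text \<open>That \<open>\<chi>(g\<^sup>-\<^sup>1)\<close> is the conjugate of \<open>\<chi>(g)\<close> is seen in a triangular form of \<open>\<rho>(g)\<close>: the
  diagonal entries are roots of unity, and the diagonal of a product of triangular matrices is the
  product of the diagonals.\<close>

lemma upper_triangular_mult:
  fixes A B :: "'a::comm_ring_1 mat"
  assumes A: "A \<in> carrier_mat d d" "upper_triangular A" and B: "B \<in> carrier_mat d d" "upper_triangular B"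
  shows "upper_triangular (A * B)" "i < d \<Longrightarrow> (A * B) $$ (i, i) = A $$ (i, i) * B $$ (i, i)"
proof -
  have entry: "(A * B) $$ (i, j) = (\<Sum>l\<in>{i..j}. A $$ (i, l) * B $$ (l, j))" if "i < d" "j < d" for i j
  proof -
    have "(A * B) $$ (i, j) = (\<Sum>l<d. A $$ (i, l) * B $$ (l, j))"
      by (rule index_mult_mat_sum[OF A(1) B(1) that])
    also have "\<dots> = (\<Sum>l\<in>{i..j}. A $$ (i, l) * B $$ (l, j))"
    proof (rule sum.mono_neutral_right)
      show "\<forall>l\<in>{..<d} - {i..j}. A $$ (i, l) * B $$ (l, j) = 0"
      proof
        fix l assume "l \<in> {..<d} - {i..j}"
        then have "l < i \<or> j < l" "l < d" by auto
        then show "A $$ (i, l) * B $$ (l, j) = 0"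
          using upper_triangularD[OF A(2), of l i] upper_triangularD[OF B(2), of j l] A B that by auto
      qed
    qed (use that in auto)
    finally show ?thesis .
  qed
  show "upper_triangular (A * B)"
    using A B entry by (intro upper_triangularI) auto
  show "i < d \<Longrightarrow> (A * B) $$ (i, i) = A $$ (i, i) * B $$ (i, i)" using entry by simp
qed

lemma upper_triangular_pow:
  fixes B :: "'a::comm_ring_1 mat"
  assumes B: "B \<in> carrier_mat d d" "upper_triangular B"
  shows "upper_triangular (B ^\<^sub>m k) \<and> (\<forall>i<d. (B ^\<^sub>m k) $$ (i, i) = B $$ (i, i) ^ k)"
proof (induction k)
  case 0
  show ?case using B by (auto intro!: upper_triangularI)
next
  case (Suc k)
  have "B ^\<^sub>m k \<in> carrier_mat d d" using B by simp
  note m = upper_triangular_mult[OF this conjunct1[OF Suc] B]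
  have "(B ^\<^sub>m Suc k) $$ (i, i) = B $$ (i, i) ^ Suc k" if "i < d" for i
    using m(2)[OF that] Suc that by (simp only: pow_mat.simps power_Suc2)
  then show ?case using m(1) by simp
qed

lemma triangularize:
  fixes A :: "complex mat"
  assumes A: "A \<in> carrier_mat d d"
  obtains B P Q where "similar_mat_wit A B P Q" "B \<in> carrier_mat d d" "upper_triangular B"
proof -
  obtain as where "char_poly A = (\<Prod>a\<leftarrow>as. [:- a, 1:])" using char_poly_factorized[OF A] by blast
  from schur_decomposition_exists[OF A this] obtain B P Q where
    "B \<in> carrier_mat d d" "upper_triangular B" "similar_mat_wit A B P Q"
    unfolding similar_mat_def by auto
  then show ?thesis by (intro that)
qed

lemma trace_similar:
  assumes A: "A \<in> carrier_mat d d" and sim: "similar_mat_wit A B P Q"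
  shows "trace A = trace B"
proof -
  note w = similar_mat_witD2[OF A sim]
  have "trace (P * B * Q) = trace (Q * (P * B))"
    by (rule trace_mult_comm[of _ d d]) (use w in auto)
  also have "Q * (P * B) = (Q * P) * B" by (rule assoc_mult_mat[symmetric]) (use w in auto)
  also have "\<dots> = B" unfolding w(2) by (rule left_mult_one_mat) (rule w(5))
  finally show ?thesis unfolding w(3) .
qed

context irreps begin

lemma pow_card_eq_one: "g \<in> carrier G \<Longrightarrow> g [^] N = \<one>"
  using pow_order_eq_1[of g] by (simp add: Coset.order_def)

lemma rep_pow:
  assumes \<rho>: "representation G d \<rho>" and g: "g \<in> carrier G"
  shows "\<rho> (g [^] k) = \<rho> g ^\<^sub>m k"
proof (induction k)
  case 0
  show ?case using repD[OF \<rho>] g by auto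
next
  case (Suc k)
  then show ?case using repD(3)[OF \<rho>] g by simp
qed

text \<open>The same change of basis triangularises all powers of \<open>\<rho>(g)\<close>, in particular
  \<open>\<rho>(g\<^sup>N) = 1\<close>.\<close>

lemma triangular_form:
  assumes \<rho>: "representation G d \<rho>" and g: "g \<in> carrier G"
  obtains B P Q where "similar_mat_wit (\<rho> g) B P Q" "B \<in> carrier_mat d d" "upper_triangular B"
    "B ^\<^sub>m N = 1\<^sub>m d" "\<forall>k. similar_mat_wit (\<rho> (g [^] k)) (B ^\<^sub>m k) P Q"
proof -
  note c = repD(1)[OF \<rho> g]
  obtain B P Q where B: "similar_mat_wit (\<rho> g) B P Q" "B \<in> carrier_mat d d" "upper_triangular B"
    by (rule triangularize[OF c])
  have pow: "similar_mat_wit (\<rho> (g [^] k)) (B ^\<^sub>m k) P Q" for k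
    unfolding rep_pow[OF \<rho> g] by (rule similar_mat_wit_pow[OF B(1)])
  have "\<rho> (g [^] N) = 1\<^sub>m d"
    using repD(2)[OF \<rho>] by (simp add: pow_card_eq_one[OF g])
  then have "similar_mat_wit (1\<^sub>m d) (B ^\<^sub>m N) P Q" using pow[of N] by simp
  note w = similar_mat_witD2[OF pow_carrier_mat[OF B(2)] similar_mat_wit_sym[OF this]]
  have "B ^\<^sub>m N = 1\<^sub>m d" unfolding w(3) right_mult_one_mat[OF w(6)] by (rule w(1))
  with B pow show ?thesis by (intro that) auto
qed

lemma cnj_character:
  assumes \<rho>: "representation G d \<rho>" and g: "g \<in> carrier G"
  shows "cnj (character \<rho> g) = character \<rho> (inv g)"
proof -
  obtain B P Q where B: "similar_mat_wit (\<rho> g) B P Q" "B \<in> carrier_mat d d" "upper_triangular B"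
    "B ^\<^sub>m N = 1\<^sub>m d" and pow: "\<forall>k. similar_mat_wit (\<rho> (g [^] k)) (B ^\<^sub>m k) P Q"
    by (rule triangular_form[OF \<rho> g])
  have N: "N = Suc (N - 1)" using N_pos by simp
  have "g [^] (N - 1) \<otimes> g = g [^] Suc (N - 1)" by simp
  also have "\<dots> = \<one>" unfolding N[symmetric] by (rule pow_card_eq_one[OF g])
  finally have "g [^] (N - 1) \<otimes> g = \<one>" .
  then have inv: "inv g = g [^] (N - 1)" using g by (metis inv_equality nat_pow_closed)
  have root: "cnj (B $$ (i, i)) = B $$ (i, i) ^ (N - 1)" if i: "i < d" for i
  proof -
    define z where "z = B $$ (i, i)"
    have zN: "z ^ N = 1"
      using upper_triangular_pow[OF B(2,3), of N] B(4) i by (simp add: z_def)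
    then have "cmod z ^ N = 1" by (metis norm_one norm_power)
    then have "cmod z = 1" using power_eq_imp_eq_base[of "cmod z" N 1] N_pos by simp
    then have "z * cnj z = 1" by (simp add: complex_norm_square[symmetric])
    moreover have "z * z ^ (N - 1) = 1" using zN N by (metis power_Suc)
    ultimately show ?thesis unfolding z_def[symmetric] by (metis mult_cancel_left mult_zero_left zero_neq_one)
  qed
  have "cnj (character \<rho> g) = (\<Sum>i<d. cnj (B $$ (i, i)))"
    using B(2) unfolding character_eq_trace trace_similar[OF repD(1)[OF \<rho> g] B(1)] by (simp add: trace_def)
  also have "\<dots> = (\<Sum>i<d. (B ^\<^sub>m (N - 1)) $$ (i, i))"
    using upper_triangular_pow[OF B(2,3), of "N - 1"] by (intro sum.cong) (auto simp: root)
  also have "\<dots> = character \<rho> (inv g)"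
    using B(2) unfolding inv character_eq_trace
      trace_similar[OF repD(1)[OF \<rho> nat_pow_closed[OF g]] pow[rule_format]] by (simp add: trace_def)
  finally show ?thesis .
qed

end

section \<open>The characters span the class functions\<close>

text \<open>Multiplication by \<open>E\<close> from the right replaces the \<open>k\<close>-th column of a matrix by the
  combination \<open>c\<close> of its columns, which is reversible if that column occurs in it.\<close>

lemma matrix_column_replacement:
  fixes c :: "complex vec"
  assumes c: "c \<in> carrier_vec d" and k: "k < d" and ck: "c $ k \<noteq> 0"
  obtains E F where "E \<in> carrier_mat d d" "F \<in> carrier_mat d d" "E * F = 1\<^sub>m d" "F * E = 1\<^sub>m d"
    "col E k = c" "\<forall>j<d. j \<noteq> k \<longrightarrow> col E j = unit_vec d j"
proof -
  define E where "E = mat d d (\<lambda>(a, j). if j = k then c $ a else if a = j then 1 else 0)"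
  define F where "F = mat d d (\<lambda>(a, j). if j = k then (if a = k then 1 / c $ k else - c $ a / c $ k)
    else if a = j then 1 else 0)"
  have E: "E \<in> carrier_mat d d" and F: "F \<in> carrier_mat d d" by (simp_all add: E_def F_def)
  have "E * F = 1\<^sub>m d"
  proof (rule eq_matI)
    fix a j assume "a < dim_row (1\<^sub>m d :: complex mat)" "j < dim_col (1\<^sub>m d :: complex mat)"
    then have aj: "a < d" "j < d" by simp_all
    have eq: "(E * F) $$ (a, j) = (\<Sum>l<d. E $$ (a, l) * F $$ (l, j))"
      by (rule index_mult_mat_sum[OF E F aj])
    show "(E * F) $$ (a, j) = 1\<^sub>m d $$ (a, j)"
    proof (cases "j = k")
      case False
      have "(\<Sum>l<d. E $$ (a, l) * F $$ (l, j)) = (\<Sum>l<d. if l = j then E $$ (a, j) else 0)"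
        using False aj by (intro sum.cong) (auto simp: F_def)
      also have "\<dots> = 1\<^sub>m d $$ (a, j)" using aj False by (simp add: E_def)
      finally show ?thesis using eq by simp
    next
      case True
      have "(\<Sum>l<d. E $$ (a, l) * F $$ (l, j)) =
          E $$ (a, k) * F $$ (k, k) + (\<Sum>l\<in>{..<d} - {k}. E $$ (a, l) * F $$ (l, k))"
        unfolding True using k by (subst sum.remove[of _ k]) auto
      also have "(\<Sum>l\<in>{..<d} - {k}. E $$ (a, l) * F $$ (l, k)) =
          (\<Sum>l\<in>{..<d} - {k}. if l = a then - c $ a / c $ k else 0)"
        using aj k by (intro sum.cong) (auto simp: E_def F_def)
      also have "\<dots> = (if a = k then 0 else - c $ a / c $ k)" using aj by simp
      finally show ?thesis using eq True aj k ck by (auto simp: E_def F_def)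
    qed
  qed (use E F in auto)
  moreover from mat_mult_left_right_inverse[OF E F this] have "F * E = 1\<^sub>m d" .
  moreover have "col E k = c" using k c by (intro eq_vecI) (auto simp: E_def)
  moreover have "\<forall>j<d. j \<noteq> k \<longrightarrow> col E j = unit_vec d j"
    by (intro allI impI eq_vecI) (auto simp: E_def)
  ultimately show ?thesis by (intro that[OF E F])
qed

text \<open>A basis of \<open>W\<close> extended to the whole space. Among the invertible matrices \<open>P\<close> one takes one
  with a maximal set \<open>J\<close> of columns in \<open>W\<close>: if some \<open>w \<in> W\<close> had a nonzero coordinate outside \<open>J\<close>,
  the corresponding column could be exchanged for \<open>w\<close>.\<close>

lemma adapted_basis:
  fixes W :: "complex vec set"
  assumes W: "W \<subseteq> carrier_vec d"
  obtains P Q J where "P \<in> carrier_mat d d" "Q \<in> carrier_mat d d" "P * Q = 1\<^sub>m d" "Q * P = 1\<^sub>m d"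
    "J \<subseteq> {..<d}" "\<forall>j\<in>J. col P j \<in> W" "\<forall>w\<in>W. \<forall>k<d. k \<notin> J \<longrightarrow> (Q *\<^sub>v w) $ k = 0"
proof -
  define ok where "ok J P Q \<longleftrightarrow> P \<in> carrier_mat d d \<and> Q \<in> carrier_mat d d \<and> P * Q = 1\<^sub>m d \<and>
    Q * P = 1\<^sub>m d \<and> (\<forall>j\<in>J. col P j \<in> W)" for J P Q
  define S where "S = {J. J \<subseteq> {..<d} \<and> (\<exists>P Q. ok J P Q)}"
  have "ok {} (1\<^sub>m d) (1\<^sub>m d)" by (simp add: ok_def)
  then have "S \<noteq> {}" unfolding S_def by blast
  moreover have "finite S" by (rule finite_subset[of _ "Pow {..<d}"]) (auto simp: S_def)
  ultimately obtain J where JS: "J \<in> S" and max: "\<And>J'. J' \<in> S \<Longrightarrow> J \<subseteq> J' \<Longrightarrow> J = J'"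
    using finite_has_maximal[of S] by blast
  then obtain P Q where PQ: "ok J P Q" and J: "J \<subseteq> {..<d}" unfolding S_def by blast
  then have P: "P \<in> carrier_mat d d" and Q: "Q \<in> carrier_mat d d" and inv: "P * Q = 1\<^sub>m d" "Q * P = 1\<^sub>m d"
    and cols: "\<forall>j\<in>J. col P j \<in> W"
    by (auto simp: ok_def)
  have "(Q *\<^sub>v w) $ k = 0" if w: "w \<in> W" and k: "k < d" "k \<notin> J" for w k
  proof (rule ccontr)
    assume nz: "(Q *\<^sub>v w) $ k \<noteq> 0"
    have wc: "w \<in> carrier_vec d" using w W by blast
    then have Qw: "Q *\<^sub>v w \<in> carrier_vec d" using Q by simp
    obtain E F where E: "E \<in> carrier_mat d d" and F: "F \<in> carrier_mat d d" and EF: "E * F = 1\<^sub>m d" "F * E = 1\<^sub>m d"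
      and colk: "col E k = Q *\<^sub>v w" and colj: "\<forall>j<d. j \<noteq> k \<longrightarrow> col E j = unit_vec d j"
      by (rule matrix_column_replacement[OF Qw k(1) nz])
    have PE: "P * E \<in> carrier_mat d d" and FQ: "F * Q \<in> carrier_mat d d" using P Q E F by auto
    have "(P * E) * (F * Q) = P * (E * (F * Q))" by (rule assoc_mult_mat) (use P Q E F in auto)
    also have "E * (F * Q) = (E * F) * Q" by (rule assoc_mult_mat[symmetric]) (use Q E F in auto)
    also have "\<dots> = Q" unfolding EF by (rule left_mult_one_mat[OF Q])
    finally have i1: "(P * E) * (F * Q) = 1\<^sub>m d" unfolding inv .
    have i2: "(F * Q) * (P * E) = 1\<^sub>m d" by (rule mat_mult_left_right_inverse[OF PE FQ i1])
    have cols': "col (P * E) j \<in> W" if j: "j \<in> insert k J" for j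
    proof (cases "j = k")
      case True
      have "col (P * E) j = P *\<^sub>v (Q *\<^sub>v w)" unfolding True colk[symmetric] by (rule col_mult2[OF P E k(1)])
      also have "\<dots> = (P * Q) *\<^sub>v w" by (rule assoc_mult_mat_vec[OF P Q wc, symmetric])
      also have "\<dots> = w" unfolding inv using wc by simp
      finally show ?thesis using w by simp
    next
      case False
      then have jJ: "j \<in> J" "j < d" using j J by auto
      have "col (P * E) j = P *\<^sub>v unit_vec d j"
        unfolding colj[rule_format, OF jJ(2) False, symmetric] by (rule col_mult2[OF P E jJ(2)])
      also have "\<dots> = col P j" by (rule mult_unit_vec_eq_col[OF P jJ(2)])
      finally show ?thesis using cols jJ by simp
    qed
    have "ok (insert k J) (P * E) (F * Q)" unfolding ok_def using PE FQ i1 i2 cols' by blast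
    then have "insert k J \<in> S" unfolding S_def using J k by blast
    then have "J = insert k J" by (rule max) blast
    then show False using k by blast
  qed
  then show ?thesis by (intro that[OF P Q inv J cols]) blast
qed

context irreps begin

lemma conjugate_rep:
  assumes \<rho>: "representation G d \<rho>" and P: "P \<in> carrier_mat d d" and Q: "Q \<in> carrier_mat d d"
    and inv: "P * Q = 1\<^sub>m d" "Q * P = 1\<^sub>m d"
  shows "representation G d (\<lambda>g. Q * \<rho> g * P)"
    "g \<in> carrier G \<Longrightarrow> character (\<lambda>g. Q * \<rho> g * P) g = character \<rho> g"
proof -
  note c = repD(1)[OF \<rho>]
  show "representation G d (\<lambda>g. Q * \<rho> g * P)"
    unfolding representation_def
  proof (intro conjI ballI)
    fix g h assume gh: "g \<in> carrier G" "h \<in> carrier G"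
    note cc = c[OF gh(1)] c[OF gh(2)] P Q
    have "(Q * \<rho> g * P) * (Q * \<rho> h * P) = (Q * \<rho> g) * (P * (Q * \<rho> h * P))"
      by (rule assoc_mult_mat) (use cc in auto)
    also have "P * (Q * \<rho> h * P) = (P * (Q * \<rho> h)) * P"
      by (rule assoc_mult_mat[symmetric]) (use cc in auto)
    also have "P * (Q * \<rho> h) = (P * Q) * \<rho> h"
      by (rule assoc_mult_mat[symmetric]) (use cc in auto)
    also have "\<dots> = \<rho> h" unfolding inv by (rule left_mult_one_mat[OF cc(2)])
    also have "(Q * \<rho> g) * (\<rho> h * P) = ((Q * \<rho> g) * \<rho> h) * P"
      by (rule assoc_mult_mat[symmetric]) (use cc in auto)
    also have "(Q * \<rho> g) * \<rho> h = Q * (\<rho> g * \<rho> h)" by (rule assoc_mult_mat) (use cc in auto)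
    finally show "Q * \<rho> (g \<otimes> h) * P = (Q * \<rho> g * P) * (Q * \<rho> h * P)"
      unfolding repD(3)[OF \<rho> gh] by (rule sym)
  next
    show "Q * \<rho> \<one> * P = 1\<^sub>m d" unfolding repD(2)[OF \<rho>] using P Q inv by simp
  qed (use c P Q in auto)
  assume g: "g \<in> carrier G"
  have "similar_mat_wit (\<rho> g) (Q * \<rho> g * P) P Q"
  proof (rule similar_mat_witI[OF inv _ c[OF g] _ P Q])
    have "P * (Q * \<rho> g * P) * Q = (P * (Q * \<rho> g)) * P * Q"
      by (subst assoc_mult_mat[symmetric, of P d d "Q * \<rho> g" d P d]) (use c[OF g] P Q in auto)
    also have "\<dots> = (P * (Q * \<rho> g)) * (P * Q)" by (rule assoc_mult_mat) (use c[OF g] P Q in auto)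
    also have "P * (Q * \<rho> g) = (P * Q) * \<rho> g" by (rule assoc_mult_mat[symmetric]) (use c[OF g] P Q in auto)
    finally show "\<rho> g = P * (Q * \<rho> g * P) * Q" unfolding inv using c[OF g] by simp
  qed (use c[OF g] P Q in auto)
  from trace_similar[OF c[OF g] this]
  show "character (\<lambda>g. Q * \<rho> g * P) g = character \<rho> g" by (simp add: character_eq_trace)
qed

lemma isomorphic_character:
  assumes \<rho>: "representation G d \<rho>" and \<sigma>: "representation G d' \<sigma>" and iso: "isomorphic_reps G d \<rho> d' \<sigma>"
    and g: "g \<in> carrier G"
  shows "character \<rho> g = character \<sigma> g"
proof -
  from iso obtain P where d: "d = d'" and P: "P \<in> carrier_mat d d" "invertible_mat P"
    and int: "P * \<rho> g = \<sigma> g * P" using g unfolding isomorphic_reps_def by blast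
  obtain Q where Q0: "P * Q = 1\<^sub>m d" "Q * P = 1\<^sub>m (dim_row Q)"
    using P unfolding invertible_mat_def inverts_mat_def by auto
  have "dim_col Q = d" using arg_cong[OF Q0(1), of dim_col] by simp
  moreover have "dim_row Q = d" using arg_cong[OF Q0(2), of dim_col] P(1) by simp
  ultimately have Q: "Q \<in> carrier_mat d d" by auto
  have QP: "Q * P = 1\<^sub>m d" using Q0(2) Q by simp
  note c = repD(1)[OF \<rho> g] repD(1)[OF \<sigma> g, folded d]
  have "Q * \<sigma> g * P = Q * (\<sigma> g * P)" by (rule assoc_mult_mat) (use c P Q in auto)
  also have "\<dots> = (Q * P) * \<rho> g" unfolding int[symmetric]
    by (rule assoc_mult_mat[symmetric]) (use c P Q in auto)
  also have "\<dots> = \<rho> g" unfolding QP using c by simp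
  finally show ?thesis using conjugate_rep(2)[OF \<sigma>[folded d] P(1) Q Q0(1) QP g]
    by (simp add: character_eq_trace)
qed

text \<open>The condition \<open>closed\<close> says that the \<open>J\<close>-block of a product is the product of the
  \<open>J\<close>-blocks. For a block triangular representation it holds for both diagonal blocks, the
  restriction to a subspace and the quotient.\<close>

lemma block_rep:
  assumes \<sigma>: "representation G d \<sigma>" and J: "J \<subseteq> {..<d}" and h: "bij_betw h {..<r} J"
    and closed: "\<And>g x i j k. g \<in> carrier G \<Longrightarrow> x \<in> carrier G \<Longrightarrow> i \<in> J \<Longrightarrow> j \<in> J \<Longrightarrow> k \<in> {..<d} - J \<Longrightarrow>
      \<sigma> g $$ (i, k) * \<sigma> x $$ (k, j) = 0"
  defines "\<sigma>' \<equiv> \<lambda>g. mat r r (\<lambda>(a, b). \<sigma> g $$ (h a, h b))"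
  shows "representation G r \<sigma>'" "g \<in> carrier G \<Longrightarrow> character \<sigma>' g = (\<Sum>i\<in>J. \<sigma> g $$ (i, i))"
proof -
  have hJ: "h a \<in> J" "h a < d" if "a < r" for a
    using h that J by (auto simp: bij_betw_def)
  have sum: "(\<Sum>a<r. F (h a)) = (\<Sum>k\<in>J. F k)" for F :: "nat \<Rightarrow> complex"
    by (rule sum.reindex_bij_betw[OF h])
  show "representation G r \<sigma>'"
    unfolding representation_def
  proof (intro conjI ballI)
    fix g x assume gx: "g \<in> carrier G" "x \<in> carrier G"
    show "\<sigma>' (g \<otimes> x) = \<sigma>' g * \<sigma>' x"
    proof (rule eq_matI)
      fix a b assume "a < dim_row (\<sigma>' g * \<sigma>' x)" "b < dim_col (\<sigma>' g * \<sigma>' x)"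
      then have ab: "a < r" "b < r" by (simp_all add: \<sigma>'_def)
      have "\<sigma>' (g \<otimes> x) $$ (a, b) = (\<sigma> g * \<sigma> x) $$ (h a, h b)"
        using ab gx by (simp add: \<sigma>'_def repD(3)[OF \<sigma>])
      also have "\<dots> = (\<Sum>k<d. \<sigma> g $$ (h a, k) * \<sigma> x $$ (k, h b))"
        by (rule index_mult_mat_sum[OF repD(1)[OF \<sigma> gx(1)] repD(1)[OF \<sigma> gx(2)] hJ(2)[OF ab(1)] hJ(2)[OF ab(2)]])
      also have "\<dots> = (\<Sum>k\<in>J. \<sigma> g $$ (h a, k) * \<sigma> x $$ (k, h b))"
        by (rule sum.mono_neutral_right) (use J closed gx hJ ab in auto)
      also have "\<dots> = (\<Sum>l<r. \<sigma> g $$ (h a, h l) * \<sigma> x $$ (h l, h b))" by (rule sum[symmetric])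
      also have "\<dots> = (\<Sum>l<r. \<sigma>' g $$ (a, l) * \<sigma>' x $$ (l, b))" using ab by (simp add: \<sigma>'_def)
      also have "\<dots> = (\<sigma>' g * \<sigma>' x) $$ (a, b)"
        by (rule index_mult_mat_sum[symmetric]) (use ab in \<open>auto simp: \<sigma>'_def\<close>)
      finally show "\<sigma>' (g \<otimes> x) $$ (a, b) = (\<sigma>' g * \<sigma>' x) $$ (a, b)" .
    qed (simp_all add: \<sigma>'_def)
  next
    have "h a = h b \<longleftrightarrow> a = b" if "a < r" "b < r" for a b
      using h that by (auto simp: bij_betw_def inj_on_def)
    then show "\<sigma>' \<one> = 1\<^sub>m r"
      using hJ by (intro eq_matI) (auto simp: \<sigma>'_def repD(2)[OF \<sigma>])
  qed (simp add: \<sigma>'_def)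
  show "character \<sigma>' g = (\<Sum>i\<in>J. \<sigma> g $$ (i, i))" if "g \<in> carrier G"
    using sum[of "\<lambda>i. \<sigma> g $$ (i, i)"] by (simp add: character_def \<sigma>'_def)
qed

text \<open>By induction on the dimension: in a basis adapted to an invariant subspace the
  representation is block triangular, and its character is the sum of the characters of the two
  diagonal blocks.\<close>

lemma character_decomposition:
  "representation G d \<rho> \<Longrightarrow> \<exists>k. \<forall>g\<in>carrier G. character \<rho> g = (\<Sum>j\<le>n. k j * \<chi> j g)"
proof (induction d arbitrary: \<rho> rule: less_induct)
  case (less d)
  note \<rho> = less.prems
  consider "d = 0" | "irreducible_rep G d \<rho>" | "d > 0" "\<not> irreducible_rep G d \<rho>" by blast
  then show ?case
  proof cases
    case 1
    then show ?thesis by (intro exI[of _ "\<lambda>_. 0"]) (simp add: character_rep[OF \<rho>])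
  next
    case 2
    then obtain i where i: "i \<le> n" "isomorphic_reps G d \<rho> (e i) (Rs i)" using Rs_complete by blast
    have "character \<rho> g = (\<Sum>j\<le>n. (if j = i then 1 else 0) * \<chi> j g)" if "g \<in> carrier G" for g
    proof -
      have "(\<Sum>j\<le>n. (if j = i then 1 else 0) * \<chi> j g) = (\<Sum>j\<le>n. if j = i then \<chi> i g else 0)"
        by (intro sum.cong) auto
      then show ?thesis using i isomorphic_character[OF \<rho> Rs_rep[OF i(1)] i(2) that] by simp
    qed
    then show ?thesis by (intro exI[of _ "\<lambda>j. if j = i then 1 else 0"] ballI)
  next
    case 3
    have "\<exists>W. VectorSpace.subspace class_ring W (module_vec TYPE(complex) d) \<and>
        (\<forall>g\<in>carrier G. \<forall>w\<in>W. \<rho> g *\<^sub>v w \<in> W) \<and> W \<noteq> {0\<^sub>v d} \<and> W \<noteq> carrier_vec d"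
    proof (rule ccontr)
      assume "\<not> ?thesis"
      then have "\<forall>W. VectorSpace.subspace class_ring W (module_vec TYPE(complex) d) \<and>
        (\<forall>g\<in>carrier G. \<forall>w\<in>W. \<rho> g *\<^sub>v w \<in> W) \<longrightarrow> W = {0\<^sub>v d} \<or> W = carrier_vec d"
        by (simp only: not_ex de_Morgan_conj not_not) metis
      then show False using 3 \<rho> unfolding irreducible_rep_def by simp
    qed
    then obtain W where sub: "VectorSpace.subspace class_ring W (module_vec TYPE(complex) d)"
      and Winv': "\<forall>g\<in>carrier G. \<forall>w\<in>W. \<rho> g *\<^sub>v w \<in> W"
      and W0: "W \<noteq> {0\<^sub>v d}" and W1: "W \<noteq> carrier_vec d"
      by (elim exE conjE)
    have Winv: "\<And>g w. g \<in> carrier G \<Longrightarrow> w \<in> W \<Longrightarrow> \<rho> g *\<^sub>v w \<in> W" using Winv' by simp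
    note Ws = subspace_vecD[OF sub]
    obtain P Q J where P: "P \<in> carrier_mat d d" and Q: "Q \<in> carrier_mat d d"
      and inv: "P * Q = 1\<^sub>m d" "Q * P = 1\<^sub>m d" and J: "J \<subseteq> {..<d}"
      and cols: "\<forall>j\<in>J. col P j \<in> W" and coord: "\<forall>w\<in>W. \<forall>k<d. k \<notin> J \<longrightarrow> (Q *\<^sub>v w) $ k = 0"
      by (rule adapted_basis[OF Ws(1)])
    have PQv: "P *\<^sub>v (Q *\<^sub>v v) = v" if "v \<in> carrier_vec d" for v
      using assoc_mult_mat_vec[OF P Q that] inv that by simp
    have "J \<noteq> {}"
    proof
      assume "J = {}"
      have "w = 0\<^sub>v d" if w: "w \<in> W" for w
      proof -
        have "w \<in> carrier_vec d" using w Ws(1) by blast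
        moreover have "Q *\<^sub>v w = 0\<^sub>v d" using coord w \<open>J = {}\<close> Q by (intro eq_vecI) auto
        ultimately show ?thesis using PQv[of w] mult_mat_vec_zero[OF P] by simp
      qed
      then show False using W0 Ws(2) by blast
    qed
    have "J \<noteq> {..<d}"
    proof
      assume J': "J = {..<d}"
      have "v \<in> W" if v: "v \<in> carrier_vec d" for v
      proof -
        define c where "c = Q *\<^sub>v v"
        have c: "c \<in> carrier_vec d" using Q v by (simp add: c_def)
        have "vec d (\<lambda>i. \<Sum>j<k. P $$ (i, j) * c $ j) \<in> W" if "k \<le> d" for k
          using that
        proof (induction k)
          case 0
          have "vec d (\<lambda>i. \<Sum>j<0. P $$ (i, j) * c $ j) = 0\<^sub>v d" by (intro eq_vecI) auto
          then show ?case using Ws(2) by simp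
        next
          case (Suc k)
          have "vec d (\<lambda>i. \<Sum>j<Suc k. P $$ (i, j) * c $ j) =
              vec d (\<lambda>i. \<Sum>j<k. P $$ (i, j) * c $ j) + c $ k \<cdot>\<^sub>v col P k"
            using P Suc.prems by (intro eq_vecI) (auto simp: mult.commute)
          moreover have "col P k \<in> W" using cols J' Suc.prems by auto
          ultimately show ?case using Suc Ws(3,4) by simp
        qed
        from this[of d] have "vec d (\<lambda>i. \<Sum>j<d. P $$ (i, j) * c $ j) \<in> W" by simp
        also have "vec d (\<lambda>i. \<Sum>j<d. P $$ (i, j) * c $ j) = P *\<^sub>v c"
          using P by (intro eq_vecI) (auto simp: index_mult_mat_vec_sum[OF P c] simp del: index_mult_mat_vec)
        finally show ?thesis using PQv[OF v] by (simp add: c_def)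
      qed
      then show False using W1 Ws(1) by blast
    qed
    define \<sigma> where "\<sigma> = (\<lambda>g. Q * \<rho> g * P)"
    have \<sigma>: "representation G d \<sigma>" and ch: "\<And>g. g \<in> carrier G \<Longrightarrow> character \<sigma> g = character \<rho> g"
      unfolding \<sigma>_def by (rule conjugate_rep[OF \<rho> P Q inv], assumption?)+
    have block: "\<sigma> g $$ (k, j) = 0" if g: "g \<in> carrier G" and j: "j \<in> J" and k: "k \<in> {..<d} - J" for g j k
    proof -
      note c = repD(1)[OF \<rho> g]
      have jd: "j < d" "k < d" using j k J by auto
      have "col (\<sigma> g) j = Q * \<rho> g *\<^sub>v col P j"
        unfolding \<sigma>_def by (rule col_mult2) (use c P Q jd in auto)
      also have "\<dots> = Q *\<^sub>v (\<rho> g *\<^sub>v col P j)" by (rule assoc_mult_mat_vec[OF Q c]) (use P jd in auto)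
      finally have "col (\<sigma> g) j $ k = 0" using coord Winv[OF g] cols j k by auto
      then show ?thesis using repD(1)[OF \<sigma> g] jd by simp
    qed
    define r where "r = card J"
    have fJ: "finite J" using J finite_subset by blast
    have r: "r < d" using psubset_card_mono[of "{..<d}" J] J \<open>J \<noteq> {..<d}\<close> unfolding r_def by auto
    have r0: "r > 0" using \<open>J \<noteq> {}\<close> fJ by (simp add: r_def card_gt_0_iff)
    have cJ: "card ({..<d} - J) = d - r" using J fJ by (simp add: r_def card_Diff_subset)
    obtain h1 where h1: "bij_betw h1 {..<r} J"
      using ex_bij_betw_nat_finite[OF fJ] unfolding r_def atLeast0LessThan by blast
    obtain h2 where h2: "bij_betw h2 {..<d - r} ({..<d} - J)"
      using ex_bij_betw_nat_finite[of "{..<d} - J"] unfolding cJ atLeast0LessThan by auto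
    have closed1: "\<sigma> g $$ (i, k) * \<sigma> x $$ (k, j) = 0"
      if "g \<in> carrier G" "x \<in> carrier G" "i \<in> J" "j \<in> J" "k \<in> {..<d} - J" for g x i j k
      using block[OF that(2,4,5)] by simp
    have closed2: "\<sigma> g $$ (i, k) * \<sigma> x $$ (k, j) = 0"
      if "g \<in> carrier G" "x \<in> carrier G" "i \<in> {..<d} - J" "j \<in> {..<d} - J" "k \<in> {..<d} - ({..<d} - J)" for g x i j k
    proof -
      have "k \<in> J" using that(5) by blast
      from block[OF that(1) this that(3)] show ?thesis by simp
    qed
    note b1 = block_rep[OF \<sigma> J h1 closed1] and b2 = block_rep[OF \<sigma> Diff_subset h2 closed2]
    obtain k1 where k1: "\<And>g. g \<in> carrier G \<Longrightarrow> (\<Sum>i\<in>J. \<sigma> g $$ (i, i)) = (\<Sum>j\<le>n. k1 j * \<chi> j g)"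
      using less.IH[OF r b1(1)] b1(2) by auto
    have r2: "d - r < d" using r r0 by simp
    obtain k2 where k2: "\<And>g. g \<in> carrier G \<Longrightarrow> (\<Sum>i\<in>{..<d} - J. \<sigma> g $$ (i, i)) = (\<Sum>j\<le>n. k2 j * \<chi> j g)"
      using less.IH[OF r2 b2(1)] b2(2) by auto
    have "character \<rho> g = (\<Sum>j\<le>n. (k1 j + k2 j) * \<chi> j g)" if g: "g \<in> carrier G" for g
    proof -
      have "character \<rho> g = (\<Sum>i<d. \<sigma> g $$ (i, i))"
        using ch[OF g] character_rep[OF \<sigma> g] by simp
      also have "\<dots> = (\<Sum>i\<in>{..<d} - J. \<sigma> g $$ (i, i)) + (\<Sum>i\<in>J. \<sigma> g $$ (i, i))"
        by (rule sum.subset_diff[OF J]) simp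
      finally show ?thesis using k1[OF g] k2[OF g] by (simp add: distrib_right sum.distrib)
    qed
    then show ?thesis by (intro exI[of _ "\<lambda>j. k1 j + k2 j"] ballI)
  qed
qed

lemma regular_rep:
  obtains \<rho> where "representation G N \<rho>"
    "\<forall>g\<in>carrier G. character \<rho> g = (if g = \<one> then of_nat N else 0)"
proof -
  obtain x where x: "bij_betw x {..<N} (carrier G)"
    using ex_bij_betw_nat_finite[OF fin] unfolding atLeast0LessThan by blast
  have xG: "x i \<in> carrier G" if "i < N" for i using x that by (auto simp: bij_betw_def)
  have sum: "(\<Sum>i<N. F (x i)) = (\<Sum>k\<in>carrier G. F k)" for F :: "'g \<Rightarrow> complex"
    by (rule sum.reindex_bij_betw[OF x])
  define \<rho> where "\<rho> g = mat N N (\<lambda>(i, j). if x i = g \<otimes> x j then 1 else (0::complex))" for g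
  have c: "\<rho> g \<in> carrier_mat N N" for g by (simp add: \<rho>_def)
  have "\<rho> (g \<otimes> h) = \<rho> g * \<rho> h" if gh: "g \<in> carrier G" "h \<in> carrier G" for g h
  proof (rule eq_matI)
    fix i j assume "i < dim_row (\<rho> g * \<rho> h)" "j < dim_col (\<rho> g * \<rho> h)"
    then have ij: "i < N" "j < N" using c by (simp_all add: \<rho>_def)
    have "(\<rho> g * \<rho> h) $$ (i, j) = (\<Sum>l<N. \<rho> g $$ (i, l) * \<rho> h $$ (l, j))"
      by (rule index_mult_mat_sum[OF c c ij])
    also have "\<dots> = (\<Sum>l<N. if x l = h \<otimes> x j then (if x i = g \<otimes> x l then 1 else 0) else 0)"
      using ij by (intro sum.cong) (auto simp: \<rho>_def)
    also have "\<dots> = (\<Sum>y\<in>carrier G. if y = h \<otimes> x j then (if x i = g \<otimes> y then 1 else 0) else 0)"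
      by (rule sum)
    also have "\<dots> = \<rho> (g \<otimes> h) $$ (i, j)"
      using gh ij xG fin by (simp add: \<rho>_def m_assoc)
    finally show "\<rho> (g \<otimes> h) $$ (i, j) = (\<rho> g * \<rho> h) $$ (i, j)" by simp
  qed (simp_all add: \<rho>_def)
  moreover have "\<rho> \<one> = 1\<^sub>m N"
  proof -
    have "x i = x j \<longleftrightarrow> i = j" if "i < N" "j < N" for i j
      using x that by (auto simp: bij_betw_def inj_on_def)
    then show ?thesis using xG by (intro eq_matI) (auto simp: \<rho>_def)
  qed
  ultimately have rep: "representation G N \<rho>" by (simp add: representation_def c)
  moreover have "character \<rho> g = (if g = \<one> then of_nat N else 0)" if g: "g \<in> carrier G" for g
  proof -
    have "character \<rho> g = (\<Sum>i<N. if x i = g \<otimes> x i then 1 else 0)"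
      by (simp add: character_rep[OF rep g] \<rho>_def)
    also have "\<dots> = (\<Sum>y\<in>carrier G. if y = g \<otimes> y then 1 else 0)" by (rule sum)
    also have "\<dots> = (\<Sum>y\<in>carrier G. if g = \<one> then 1 else 0)"
      using g by (intro sum.cong refl if_cong) simp_all
    finally show ?thesis by simp
  qed
  ultimately show ?thesis using that by blast
qed

text \<open>The multiplicity of \<open>R\<^sub>j\<close> in the regular representation is \<open>\<chi>\<^sub>j(1) = e\<^sub>j\<close>, by orthogonality.\<close>

lemma regular_character:
  assumes g: "g \<in> carrier G"
  shows "(\<Sum>j\<le>n. of_nat (e j) * \<chi> j g) = (if g = \<one> then of_nat N else 0)"
proof -
  obtain \<rho> where \<rho>: "representation G N \<rho>"
    and ch: "\<forall>g\<in>carrier G. character \<rho> g = (if g = \<one> then of_nat N else 0)"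
    by (rule regular_rep)
  obtain k where k: "\<forall>g\<in>carrier G. character \<rho> g = (\<Sum>j\<le>n. k j * \<chi> j g)"
    using character_decomposition[OF \<rho>] by blast
  have "k i = of_nat (e i)" if i: "i \<le> n" for i
  proof -
    have "(\<Sum>g\<in>carrier G. character \<rho> g * \<chi> i (inv g)) = (\<Sum>g\<in>carrier G. if g = \<one> then of_nat N * \<chi> i (inv g) else 0)"
      using ch by (intro sum.cong) auto
    also have "\<dots> = of_nat N * of_nat (e i)"
      using fin character_one[OF Rs_rep[OF i]] by simp
    finally have 1: "(\<Sum>g\<in>carrier G. character \<rho> g * \<chi> i (inv g)) = of_nat N * of_nat (e i)" .
    have "(\<Sum>g\<in>carrier G. character \<rho> g * \<chi> i (inv g)) = (\<Sum>g\<in>carrier G. \<Sum>j\<le>n. k j * (\<chi> j g * \<chi> i (inv g)))"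
      using k by (intro sum.cong) (auto simp: sum_distrib_right mult.assoc)
    also have "\<dots> = (\<Sum>j\<le>n. k j * (\<Sum>g\<in>carrier G. \<chi> j g * \<chi> i (inv g)))"
      by (subst sum.swap) (simp add: sum_distrib_left)
    also have "\<dots> = (\<Sum>j\<le>n. if j = i then k i * of_nat N else 0)"
      using i by (intro sum.cong) (auto simp: character_orthogonality_inv)
    also have "\<dots> = k i * of_nat N" using i by simp
    finally show ?thesis using 1 N_pos by simp
  qed
  then have "(\<Sum>j\<le>n. of_nat (e j) * \<chi> j g) = (\<Sum>j\<le>n. k j * \<chi> j g)"
    by (intro sum.cong) auto
  also have "\<dots> = character \<rho> g" using k g by simp
  finally show ?thesis using ch g by simp
qed

text \<open>By the previous lemma \<open>f\<close> is its own convolution with \<open>\<Sum>\<^sub>j e\<^sub>j \<chi>\<^sub>j / |G|\<close>. For a class function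
  the matrix \<open>\<Sum>\<^sub>h f(h) R\<^sub>j(h\<^sup>-\<^sup>1)\<close> is an intertwiner, hence a scalar, so that the convolution of \<open>f\<close>
  with \<open>\<chi>\<^sub>j\<close> is a multiple of \<open>\<chi>\<^sub>j\<close>.\<close>

lemma class_function_expansion:
  fixes f :: "'g \<Rightarrow> complex"
  assumes cl: "\<And>g h. g \<in> carrier G \<Longrightarrow> h \<in> carrier G \<Longrightarrow> f (h \<otimes> g \<otimes> inv h) = f g"
    and g: "g \<in> carrier G"
  shows "f g = (\<Sum>j\<le>n. (1 / of_nat N) * (\<Sum>h\<in>carrier G. f h * \<chi> j (inv h)) * \<chi> j g)"
proof -
  let ?S = "\<lambda>j. sum_mat (e j) (e j) (carrier G)"
  define T where "T j = ?S j (\<lambda>h. f h \<cdot>\<^sub>m Rs j (inv h))" for j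
  have c: "Rs j h \<in> carrier_mat (e j) (e j)" if "j \<le> n" "h \<in> carrier G" for j h
    using Rs_carrier that by blast
  have tr: "trace (T j) = (\<Sum>h\<in>carrier G. f h * \<chi> j (inv h))" if j: "j \<le> n" for j
  proof -
    have "trace (T j) = (\<Sum>h\<in>carrier G. trace (f h \<cdot>\<^sub>m Rs j (inv h)))"
      unfolding T_def by (rule trace_sum_mat) (use c[OF j] in auto)
    also have "\<dots> = (\<Sum>h\<in>carrier G. f h * \<chi> j (inv h))"
      using c[OF j] by (intro sum.cong refl) (simp add: character_eq_trace trace_smult[OF c[OF j]])
    finally show ?thesis .
  qed
  have scal: "T j = (trace (T j) / of_nat (e j)) \<cdot>\<^sub>m 1\<^sub>m (e j)" if j: "j \<le> n" for j
  proof (rule schur_scalar[OF Rs_irr[OF j]])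
    show "T j \<in> carrier_mat (e j) (e j)" by (simp add: T_def)
    fix x assume x: "x \<in> carrier G"
    have "Rs j x * T j = ?S j (\<lambda>h. Rs j x * (f h \<cdot>\<^sub>m Rs j (inv h)))"
      unfolding T_def by (rule mult_sum_mat) (use c[OF j] x in auto)
    also have "\<dots> = ?S j (\<lambda>h. f h \<cdot>\<^sub>m Rs j (x \<otimes> inv h))"
      using c[OF j] x j by (intro sum_mat_cong) (simp add: Rs_mult mult_smult_distrib[of _ "e j" "e j" _ "e j"])
    also have "\<dots> = ?S j (\<lambda>h. f (x \<otimes> h \<otimes> inv x) \<cdot>\<^sub>m Rs j (inv (x \<otimes> h \<otimes> inv x) \<otimes> x))"
    proof (rule sum_mat_cong)
      fix h assume h: "h \<in> carrier G"
      have "inv (x \<otimes> h \<otimes> inv x) \<otimes> x = x \<otimes> inv h" using x h by (simp add: inv_mult_group m_assoc)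
      then show "f h \<cdot>\<^sub>m Rs j (x \<otimes> inv h) =
          f (x \<otimes> h \<otimes> inv x) \<cdot>\<^sub>m Rs j (inv (x \<otimes> h \<otimes> inv x) \<otimes> x)"
        using cl[OF h x] by simp
    qed
    also have "\<dots> = ?S j (\<lambda>h. f h \<cdot>\<^sub>m Rs j (inv h \<otimes> x))"
    proof -
      have "(\<Sum>h\<in>carrier G. F (x \<otimes> h \<otimes> inv x)) = (\<Sum>h\<in>carrier G. F h)" for F :: "'g \<Rightarrow> complex"
        using sum_left_translate[OF x, of "\<lambda>y. F (y \<otimes> inv x)"] sum_right_translate[of "inv x" F] x by simp
      from this[of "\<lambda>y. (f y \<cdot>\<^sub>m Rs j (inv y \<otimes> x)) $$ _"] show ?thesis
        unfolding sum_mat_def by simp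
    qed
    also have "\<dots> = ?S j (\<lambda>h. (f h \<cdot>\<^sub>m Rs j (inv h)) * Rs j x)"
      using c[OF j] x j by (intro sum_mat_cong) (simp add: Rs_mult mult_smult_assoc_mat[of _ "e j" "e j" _ "e j"])
    also have "\<dots> = T j * Rs j x"
      unfolding T_def by (rule sum_mat_mult[symmetric]) (use c[OF j] x in auto)
    finally show "Rs j x * T j = T j * Rs j x" .
  qed
  have conv: "(\<Sum>h\<in>carrier G. f h * \<chi> j (inv h \<otimes> g)) = trace (T j) / of_nat (e j) * \<chi> j g" if j: "j \<le> n" for j
  proof -
    have "T j * Rs j g = ?S j (\<lambda>h. (f h \<cdot>\<^sub>m Rs j (inv h)) * Rs j g)"
      unfolding T_def by (rule sum_mat_mult) (use c[OF j] g in auto)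
    also have "\<dots> = ?S j (\<lambda>h. f h \<cdot>\<^sub>m Rs j (inv h \<otimes> g))"
      using c[OF j] g j by (intro sum_mat_cong) (simp add: Rs_mult mult_smult_assoc_mat[of _ "e j" "e j" _ "e j"])
    also have "trace \<dots> = (\<Sum>h\<in>carrier G. trace (f h \<cdot>\<^sub>m Rs j (inv h \<otimes> g)))"
      by (rule trace_sum_mat) (use c[OF j] g in auto)
    also have "\<dots> = (\<Sum>h\<in>carrier G. f h * \<chi> j (inv h \<otimes> g))"
      using c[OF j] g by (intro sum.cong refl) (simp add: character_eq_trace trace_smult[OF c[OF j]])
    finally have "(\<Sum>h\<in>carrier G. f h * \<chi> j (inv h \<otimes> g)) = trace (T j * Rs j g)" by simp
    also have "T j * Rs j g = (trace (T j) / of_nat (e j)) \<cdot>\<^sub>m Rs j g"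
      by (subst scal[OF j]) (use c[OF j g] in \<open>simp add: mult_smult_assoc_mat[of _ "e j" "e j" _ "e j"]\<close>)
    also have "trace \<dots> = trace (T j) / of_nat (e j) * \<chi> j g"
      by (simp add: trace_smult[OF c[OF j g]] character_eq_trace)
    finally show ?thesis .
  qed
  have "of_nat N * f g = (\<Sum>h\<in>carrier G. if h = g then f h * of_nat N else 0)"
    using g fin by simp
  also have "\<dots> = (\<Sum>h\<in>carrier G. f h * (\<Sum>j\<le>n. of_nat (e j) * \<chi> j (inv h \<otimes> g)))"
  proof (intro sum.cong refl)
    fix h assume h: "h \<in> carrier G"
    have "inv h \<otimes> g = \<one> \<longleftrightarrow> h = g" 
    proof
      assume "inv h \<otimes> g = \<one>"
      then have "h \<otimes> (inv h \<otimes> g) = h" using h by simp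
      then show "h = g" using g h by (simp add: m_assoc[symmetric])
    qed (use g in simp)
    then show "(if h = g then f h * of_nat N else 0) = f h * (\<Sum>j\<le>n. of_nat (e j) * \<chi> j (inv h \<otimes> g))"
      using regular_character[of "inv h \<otimes> g"] g h by auto
  qed
  also have "\<dots> = (\<Sum>j\<le>n. of_nat (e j) * (\<Sum>h\<in>carrier G. f h * \<chi> j (inv h \<otimes> g)))"
    by (simp add: sum_distrib_left mult.left_commute) (rule sum.swap)
  also have "\<dots> = (\<Sum>j\<le>n. trace (T j) * \<chi> j g)"
    using e_pos by (intro sum.cong refl) (simp add: conv)
  also have "\<dots> = (\<Sum>j\<le>n. (\<Sum>h\<in>carrier G. f h * \<chi> j (inv h)) * \<chi> j g)"
    by (intro sum.cong refl) (simp add: tr)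
  finally have "of_nat N * f g = (\<Sum>j\<le>n. (\<Sum>h\<in>carrier G. f h * \<chi> j (inv h)) * \<chi> j g)" .
  then have "f g = (1 / of_nat N) * (\<Sum>j\<le>n. (\<Sum>h\<in>carrier G. f h * \<chi> j (inv h)) * \<chi> j g)"
    using N_pos by (simp add: field_simps)
  also have "\<dots> = (\<Sum>j\<le>n. (1 / of_nat N) * (\<Sum>h\<in>carrier G. f h * \<chi> j (inv h)) * \<chi> j g)"
    by (subst sum_distrib_left, intro sum.cong refl) (rule mult.assoc[symmetric])
  finally show ?thesis .
qed

end

section \<open>Clebsch--Gordan matrices are diagonalised by the character table\<close>

lemma sum_div_mod:
  fixes f :: "nat \<Rightarrow> nat \<Rightarrow> 'a::comm_monoid_add"
  shows "(\<Sum>x<p * r. f (x div r) (x mod r)) = (\<Sum>a<p. \<Sum>b<r. f a b)"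
proof (cases "r = 0")
  case False
  have "(\<Sum>x<p * r. f (x div r) (x mod r)) = (\<Sum>(a, b)\<in>{..<p} \<times> {..<r}. f a b)"
  proof (rule sum.reindex_bij_witness[where i = "\<lambda>(a, b). a * r + b" and j = "\<lambda>x. (x div r, x mod r)"])
    fix x assume x: "x \<in> {..<p * r}"
    then show "(x div r, x mod r) \<in> {..<p} \<times> {..<r}"
      using False by (auto simp: less_mult_imp_div_less)
  next
    fix y assume "y \<in> {..<p} \<times> {..<r}"
    then obtain a b where y: "y = (a, b)" "a < p" "b < r" by auto
    have "a * r + b < Suc a * r" using y by simp
    also have "\<dots> \<le> p * r" using y by (intro mult_right_mono) auto
    finally show "(case y of (a, b) \<Rightarrow> a * r + b) \<in> {..<p * r}" using y by simp
  qed auto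
  then show ?thesis by (simp add: sum.cartesian_product)
qed simp

lemma character_tensor_rep:
  assumes "\<rho> g \<in> carrier_mat p p" "\<sigma> g \<in> carrier_mat r r"
  shows "character (tensor_rep \<rho> \<sigma>) g = character \<rho> g * character \<sigma> g"
proof -
  have "character (tensor_rep \<rho> \<sigma>) g = (\<Sum>x<p * r. \<rho> g $$ (x div r, x div r) * \<sigma> g $$ (x mod r, x mod r))"
    using assms by (simp add: character_def tensor_rep_def)
  also have "\<dots> = (\<Sum>a<p. \<Sum>b<r. \<rho> g $$ (a, a) * \<sigma> g $$ (b, b))"
    by (rule sum_div_mod)
  also have "\<dots> = character \<rho> g * character \<sigma> g"
    using assms by (simp add: character_def sum_product)
  finally show ?thesis .
qed

context irreps begin

text \<open>The columns \<open>(\<chi>\<^sub>0(g), \<dots>, \<chi>\<^sub>n(g))\<close> of the character table are simultaneous eigenvectors of all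
  matrices in the theorem. The predicate records the eigenvalue \<open>a g\<close> of \<open>M\<close> on the column of \<open>g\<close>.\<close>

definition acts :: "complex mat \<Rightarrow> ('g \<Rightarrow> complex) \<Rightarrow> bool" where
  "acts M a \<longleftrightarrow> M \<in> carrier_mat (n + 1) (n + 1) \<and>
     (\<forall>i\<le>n. \<forall>g\<in>carrier G. (\<Sum>j\<le>n. M $$ (i, j) * \<chi> j g) = a g * \<chi> i g)"

lemma actsI:
  assumes "M \<in> carrier_mat (n + 1) (n + 1)"
    "\<And>i g. i \<le> n \<Longrightarrow> g \<in> carrier G \<Longrightarrow> (\<Sum>j\<le>n. M $$ (i, j) * \<chi> j g) = a g * \<chi> i g"
  shows "acts M a"
  using assms by (simp add: acts_def)

lemma actsD:
  assumes "acts M a"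
  shows "M \<in> carrier_mat (n + 1) (n + 1)"
    "i \<le> n \<Longrightarrow> g \<in> carrier G \<Longrightarrow> (\<Sum>j\<le>n. M $$ (i, j) * \<chi> j g) = a g * \<chi> i g"
  using assms by (simp_all add: acts_def)

lemma acts_zero: "acts (0\<^sub>m (n + 1) (n + 1)) (\<lambda>_. 0)"
  by (rule actsI) simp_all

lemma acts_one: "acts (1\<^sub>m (n + 1)) (\<lambda>_. 1)"
proof (rule actsI)
  fix i g assume i: "i \<le> n"
  have "(\<Sum>j\<le>n. 1\<^sub>m (n + 1) $$ (i, j) * \<chi> j g) = (\<Sum>j\<le>n. if j = i then \<chi> i g else 0)"
    using i by (intro sum.cong) auto
  then show "(\<Sum>j\<le>n. 1\<^sub>m (n + 1) $$ (i, j) * \<chi> j g) = 1 * \<chi> i g" using i by simp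
qed simp

lemma acts_mult:
  assumes M: "acts M a" and M': "acts M' a'"
  shows "acts (M * M') (\<lambda>g. a g * a' g)"
proof (rule actsI)
  note c = actsD(1)[OF M] actsD(1)[OF M']
  show "M * M' \<in> carrier_mat (n + 1) (n + 1)" using c by simp
  fix i g assume i: "i \<le> n" and g: "g \<in> carrier G"
  have "(M * M') $$ (i, j) = (\<Sum>l\<le>n. M $$ (i, l) * M' $$ (l, j))" if "j \<le> n" for j
    using index_mult_mat_sum[OF c, of i j] i that by (simp add: lessThan_Suc_atMost)
  then have "(\<Sum>j\<le>n. (M * M') $$ (i, j) * \<chi> j g) = (\<Sum>j\<le>n. \<Sum>l\<le>n. M $$ (i, l) * (M' $$ (l, j) * \<chi> j g))"
    by (intro sum.cong) (auto simp: sum_distrib_right mult.assoc)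
  also have "\<dots> = (\<Sum>l\<le>n. M $$ (i, l) * (\<Sum>j\<le>n. M' $$ (l, j) * \<chi> j g))"
    by (subst sum.swap) (simp add: sum_distrib_left)
  also have "\<dots> = (\<Sum>l\<le>n. a' g * (M $$ (i, l) * \<chi> l g))"
    using g by (intro sum.cong) (auto simp: actsD(2)[OF M'])
  also have "\<dots> = a g * a' g * \<chi> i g"
    by (subst sum_distrib_left[symmetric]) (simp add: actsD(2)[OF M i g])
  finally show "(\<Sum>j\<le>n. (M * M') $$ (i, j) * \<chi> j g) = a g * a' g * \<chi> i g" .
qed

lemma acts_pow: "acts M a \<Longrightarrow> acts (M ^\<^sub>m k) (\<lambda>g. a g ^ k)"
proof (induction k)
  case 0
  have "dim_row M = n + 1" using actsD(1)[OF 0] by simp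
  then show ?case using acts_one by simp
next
  case (Suc k)
  then show ?case using acts_mult[OF Suc.IH[OF Suc.prems] Suc.prems] by (simp add: mult.commute)
qed

lemma acts_smult:
  assumes M: "acts M a"
  shows "acts (c \<cdot>\<^sub>m M) (\<lambda>g. c * a g)"
proof (rule actsI)
  note C = actsD(1)[OF M]
  show "c \<cdot>\<^sub>m M \<in> carrier_mat (n + 1) (n + 1)" using C by simp
  fix i g assume i: "i \<le> n" and g: "g \<in> carrier G"
  have "(\<Sum>j\<le>n. (c \<cdot>\<^sub>m M) $$ (i, j) * \<chi> j g) = c * (\<Sum>j\<le>n. M $$ (i, j) * \<chi> j g)"
    using C i by (simp add: sum_distrib_left mult.assoc)
  then show "(\<Sum>j\<le>n. (c \<cdot>\<^sub>m M) $$ (i, j) * \<chi> j g) = c * a g * \<chi> i g"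
    by (simp add: actsD(2)[OF M i g])
qed

text \<open>The rows of the character table are linearly independent, so the eigenvalues determine the
  matrix.\<close>

lemma acts_unique:
  assumes M: "acts M a" and M': "acts M' a'" and eq: "\<And>g. g \<in> carrier G \<Longrightarrow> a g = a' g"
  shows "M = M'"
proof (rule eq_matI)
  note c = actsD(1)[OF M] actsD(1)[OF M']
  fix i k assume "i < dim_row M'" "k < dim_col M'"
  then have ik: "i \<le> n" "k \<le> n" using c by auto
  have "A $$ (i, k) * of_nat N = (\<Sum>g\<in>carrier G. \<alpha> g * \<chi> i g * \<chi> k (inv g))" if A: "acts A \<alpha>" for A \<alpha>
  proof -
    have "(\<Sum>g\<in>carrier G. \<alpha> g * \<chi> i g * \<chi> k (inv g)) = (\<Sum>g\<in>carrier G. \<Sum>j\<le>n. A $$ (i, j) * (\<chi> j g * \<chi> k (inv g)))"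
      by (intro sum.cong refl)
        (simp add: actsD(2)[OF A ik(1), symmetric] sum_distrib_right mult.assoc)
    also have "\<dots> = (\<Sum>j\<le>n. A $$ (i, j) * (\<Sum>g\<in>carrier G. \<chi> j g * \<chi> k (inv g)))"
      by (subst sum.swap) (simp add: sum_distrib_left)
    also have "\<dots> = (\<Sum>j\<le>n. if j = k then A $$ (i, k) * of_nat N else 0)"
      using ik by (intro sum.cong) (auto simp: character_orthogonality_inv)
    finally show ?thesis using ik by simp
  qed
  from this[OF M] this[OF M'] have "M $$ (i, k) * of_nat N = M' $$ (i, k) * of_nat N"
    using eq by simp
  then show "M $$ (i, k) = M' $$ (i, k)" using N_pos by simp
qed (use actsD(1)[OF M] actsD(1)[OF M'] in auto)

text \<open>The expansion of the class function \<open>\<chi>\<^sub>Q \<chi>\<^sub>i\<close> in irreducible characters. It suffices that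
  the character of \<open>Q\<close> is a class function; for exterior powers this is simpler to see than that they
  are representations.\<close>

lemma char_inner_expansion:
  assumes Q: "\<And>g. g \<in> carrier G \<Longrightarrow> Q g \<in> carrier_mat p p"
    and cl: "\<And>g h. g \<in> carrier G \<Longrightarrow> h \<in> carrier G \<Longrightarrow> character Q (h \<otimes> g \<otimes> inv h) = character Q g"
    and i: "i \<le> n" and g: "g \<in> carrier G"
  shows "(\<Sum>j\<le>n. char_inner G (tensor_rep Q (Rs i)) (Rs j) * \<chi> j g) = character Q g * \<chi> i g"
proof -
  have 1: "char_inner G (tensor_rep Q (Rs i)) (Rs j) =
      (1 / of_nat N) * (\<Sum>h\<in>carrier G. (character Q h * \<chi> i h) * \<chi> j (inv h))" if "j \<le> n" for j
    unfolding char_inner_def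
    by (intro arg_cong2[where f = "(*)"] refl sum.cong
        character_tensor_rep[where p = p and r = "e i"] cnj_character[OF Rs_rep[OF that]] Q Rs_carrier[OF i])
  have cl': "character Q (h \<otimes> x \<otimes> inv h) * \<chi> i (h \<otimes> x \<otimes> inv h) = character Q x * \<chi> i x"
    if "x \<in> carrier G" "h \<in> carrier G" for x h
    using cl[OF that] character_conj[OF Rs_rep[OF i] that] by simp
  show ?thesis
    using class_function_expansion[of "\<lambda>x. character Q x * \<chi> i x", OF cl' g] by (simp add: 1)
qed

lemma CG_acts:
  assumes Q: "\<And>g. g \<in> carrier G \<Longrightarrow> Q g \<in> carrier_mat p p"
    and cl: "\<And>g h. g \<in> carrier G \<Longrightarrow> h \<in> carrier G \<Longrightarrow> character Q (h \<otimes> g \<otimes> inv h) = character Q g"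
  shows "acts (CG G n Rs Q) (character Q)"
proof (rule actsI)
  fix i g assume ig: "i \<le> n" "g \<in> carrier G"
  then show "(\<Sum>j\<le>n. CG G n Rs Q $$ (i, j) * \<chi> j g) = character Q g * \<chi> i g"
    using char_inner_expansion[OF Q cl ig] by (simp add: CG_def)
qed (simp add: CG_def)

end

section \<open>Exterior powers and the characteristic polynomial\<close>

text \<open>Leibniz' formula over the permutations of the index set itself. In contrast to a determinant
  of a submatrix this is independent of an enumeration of \<open>I\<close>.\<close>

definition principal_minor :: "'a::comm_ring_1 mat \<Rightarrow> nat set \<Rightarrow> 'a" where
  "principal_minor A I = (\<Sum>p | p permutes I. of_int (sign p) * (\<Prod>i\<in>I. A $$ (i, p i)))"

lemma principal_minor_list:
  assumes dist: "distinct I" and len: "length I = m"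
  shows "det (mat m m (\<lambda>(r, c). A $$ (I ! r, I ! c))) = principal_minor A (set I)"
proof -
  let ?f = "\<lambda>r. I ! r" and ?S = "{0..<m}"
  have bij: "bij_betw ?f ?S (set I)" using bij_betw_nth[OF dist] len by (simp add: atLeast0LessThan)
  then have inj: "inj_on ?f ?S" by (simp add: bij_betw_def)
  have perm: "map_permutation ?S ?f p permutes set I" if "p permutes ?S" for p
    by (rule map_permutation_permutes[OF bij that])
  have perm_inv: "map_permutation (set I) (inv_into ?S ?f) q permutes ?S" if "q permutes set I" for q
    by (rule map_permutation_permutes[OF bij_betw_inv_into[OF bij] that])
  have summand: "of_int (sign p) * (\<Prod>r = 0..<m. mat m m (\<lambda>(r, c). A $$ (I ! r, I ! c)) $$ (r, p r)) =
      of_int (sign (map_permutation ?S ?f p)) * (\<Prod>i\<in>set I. A $$ (i, map_permutation ?S ?f p i))"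
    if p: "p permutes ?S" for p
  proof -
    have "(\<Prod>i\<in>set I. A $$ (i, map_permutation ?S ?f p i)) = (\<Prod>r\<in>?S. A $$ (I ! r, map_permutation ?S ?f p (I ! r)))"
      by (rule prod.reindex_bij_betw[OF bij, symmetric])
    also have "\<dots> = (\<Prod>r = 0..<m. mat m m (\<lambda>(r, c). A $$ (I ! r, I ! c)) $$ (r, p r))"
    proof (rule prod.cong[OF refl])
      fix r assume r: "r \<in> ?S"
      have "p r \<in> ?S" using permutes_in_image[OF p] r by blast
      moreover have "map_permutation ?S ?f p (I ! r) = I ! (p r)"
        by (rule map_permutation_apply[OF inj r])
      ultimately show "A $$ (I ! r, map_permutation ?S ?f p (I ! r)) =
          mat m m (\<lambda>(r, c). A $$ (I ! r, I ! c)) $$ (r, p r)" using r by simp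
    qed
    finally show ?thesis using sign_map_permutation[OF inj p] by simp
  qed
  have "det (mat m m (\<lambda>(r, c). A $$ (I ! r, I ! c))) =
      (\<Sum>p | p permutes ?S. of_int (sign p) * (\<Prod>r = 0..<m. mat m m (\<lambda>(r, c). A $$ (I ! r, I ! c)) $$ (r, p r)))"
    by (subst det_def'[of _ m]) auto
  also have "\<dots> = principal_minor A (set I)"
    unfolding principal_minor_def
  proof (rule sum.reindex_bij_witness[where i = "map_permutation (set I) (inv_into ?S ?f)" and j = "map_permutation ?S ?f"])
    fix p assume "p \<in> {p. p permutes ?S}"
    then have p: "p permutes ?S" by simp
    show "map_permutation (set I) (inv_into ?S ?f) (map_permutation ?S ?f p) = p"
      by (rule map_permutation_compose_inv[OF bij p]) (use inj in auto)
    show "map_permutation ?S ?f p \<in> {p. p permutes set I}" using perm[OF p] by simp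
    show "of_int (sign (map_permutation ?S ?f p)) * (\<Prod>i\<in>set I. A $$ (i, map_permutation ?S ?f p i)) =
      of_int (sign p) * (\<Prod>r = 0..<m. mat m m (\<lambda>(r, c). A $$ (I ! r, I ! c)) $$ (r, p r))"
      by (rule summand[OF p, symmetric])
  next
    fix q assume "q \<in> {p. p permutes set I}"
    then have q: "q permutes set I" by simp
    show "map_permutation ?S ?f (map_permutation (set I) (inv_into ?S ?f) q) = q"
      by (rule map_permutation_compose_inv[OF bij_betw_inv_into[OF bij] q])
        (metis bij bij_betw_imp_surj_on f_inv_into_f)
    show "map_permutation (set I) (inv_into ?S ?f) q \<in> {p. p permutes ?S}" using perm_inv[OF q] by simp
  qed
  finally show ?thesis .
qed

lemma character_ext_power:
  "character (ext_power d m \<rho>) g = (\<Sum>I | I \<subseteq> {..<d} \<and> card I = m. principal_minor (\<rho> g) I)"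
proof -
  let ?L = "ext_basis d m"
  have sub: "distinct I" "length I = m" if "I \<in> set ?L" for I
    using that subseqs_distinctD[of I "[0..<d]"] by (auto simp: ext_basis_def)
  have dist: "distinct (map set ?L)"
    unfolding ext_basis_def using distinct_set_subseqs[of "[0..<d]"]
    by (simp add: distinct_map inj_on_def)
  have image: "set (map set ?L) = {I. I \<subseteq> {..<d} \<and> card I = m}"
  proof
    show "set (map set ?L) \<subseteq> {I. I \<subseteq> {..<d} \<and> card I = m}"
    proof
      fix J assume "J \<in> set (map set ?L)"
      then obtain I where I: "I \<in> set ?L" "J = set I" by auto
      then have "J \<in> set ` set (subseqs [0..<d])" by (auto simp: ext_basis_def)
      then have "J \<subseteq> {..<d}" unfolding subseqs_powset by auto
      then show "J \<in> {I. I \<subseteq> {..<d} \<and> card I = m}" using sub[OF I(1)] I(2) by (simp add: distinct_card)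
    qed
    show "{I. I \<subseteq> {..<d} \<and> card I = m} \<subseteq> set (map set ?L)"
    proof
      fix J assume J: "J \<in> {I. I \<subseteq> {..<d} \<and> card I = m}"
      then have "J \<in> set ` set (subseqs [0..<d])" unfolding subseqs_powset by auto
      then obtain I where I: "I \<in> set (subseqs [0..<d])" "J = set I" by blast
      have "distinct I" by (rule subseqs_distinctD[OF I(1)]) simp
      then have "length I = m" using J I(2) by (simp add: distinct_card)
      then show "J \<in> set (map set ?L)" using I by (auto simp: ext_basis_def)
    qed
  qed
  have "character (ext_power d m \<rho>) g = (\<Sum>a<length ?L. principal_minor (\<rho> g) (set (?L ! a)))"
    unfolding character_def ext_power_def
    using sub by (auto intro!: sum.cong principal_minor_list)
  also have "\<dots> = sum_list (map (principal_minor (\<rho> g)) (map set ?L))"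
    by (simp add: sum_list_sum_nth lessThan_atLeast0)
  also have "\<dots> = (\<Sum>I\<in>set (map set ?L). principal_minor (\<rho> g) I)"
    by (rule sum_list_distinct_conv_sum_set[OF dist])
  finally show ?thesis unfolding image .
qed

text \<open>Expand the product in each term of Leibniz' formula. Choosing the entry of \<open>x A\<close> for the
  indices in \<open>I\<close> and that of the identity elsewhere contributes only if the permutation fixes all
  indices outside \<open>I\<close>.\<close>

lemma det_one_plus_smult:
  fixes A :: "'a::idom mat"
  assumes A: "A \<in> carrier_mat d d"
  shows "det (1\<^sub>m d + x \<cdot>\<^sub>m A) = (\<Sum>I\<in>Pow {..<d}. x ^ card I * principal_minor A I)"
proof -
  let ?U = "{..<d}"
  have c: "1\<^sub>m d + x \<cdot>\<^sub>m A \<in> carrier_mat d d" using A by simp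
  have expand: "(\<Prod>i = 0..<d. (1\<^sub>m d + x \<cdot>\<^sub>m A) $$ (i, p i)) =
      (\<Sum>I\<in>Pow ?U. if p permutes I then x ^ card I * (\<Prod>i\<in>I. A $$ (i, p i)) else 0)"
    if p: "p permutes ?U" for p
  proof -
    have lt: "p i < d" if "i < d" for i using permutes_in_image[OF p] that by auto
    have "(\<Prod>i = 0..<d. (1\<^sub>m d + x \<cdot>\<^sub>m A) $$ (i, p i)) = (\<Prod>i\<in>?U. x * A $$ (i, p i) + (if p i = i then 1 else 0))"
      using A lt by (intro prod.cong) (auto simp: add.commute)
    also have "\<dots> = (\<Sum>I\<in>Pow ?U. (\<Prod>i\<in>I. x * A $$ (i, p i)) * (\<Prod>i\<in>?U - I. if p i = i then 1 else 0))"
      by (rule prod_add) simp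
    also have "\<dots> = (\<Sum>I\<in>Pow ?U. if p permutes I then x ^ card I * (\<Prod>i\<in>I. A $$ (i, p i)) else 0)"
    proof (rule sum.cong[OF refl])
      fix I assume I: "I \<in> Pow ?U"
      then have fI: "finite I" by (auto intro: finite_subset)
      have iff: "p permutes I \<longleftrightarrow> (\<forall>i\<in>?U - I. p i = i)"
      proof
        assume "\<forall>i\<in>?U - I. p i = i"
        then show "p permutes I" using permutes_superset[OF p, of I] by (metis DiffE DiffI)
      qed (auto simp: permutes_def)
      have "(\<Prod>i\<in>?U - I. if p i = i then 1 else 0) = (if \<forall>i\<in>?U - I. p i = i then 1 else (0::'a))"
        by (cases "\<forall>i\<in>?U - I. p i = i") (auto simp: prod_zero_iff)
      then show "(\<Prod>i\<in>I. x * A $$ (i, p i)) * (\<Prod>i\<in>?U - I. if p i = i then 1 else 0) =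
        (if p permutes I then x ^ card I * (\<Prod>i\<in>I. A $$ (i, p i)) else 0)"
        unfolding iff using fI by (simp add: prod.distrib)
    qed
    finally show ?thesis .
  qed
  have "det (1\<^sub>m d + x \<cdot>\<^sub>m A) = (\<Sum>p | p permutes ?U. of_int (sign p) *
      (\<Sum>I\<in>Pow ?U. if p permutes I then x ^ card I * (\<Prod>i\<in>I. A $$ (i, p i)) else 0))"
    by (subst det_def'[OF c]) (auto simp: lessThan_atLeast0[symmetric] expand[unfolded lessThan_atLeast0[symmetric]] intro!: sum.cong)
  also have "\<dots> = (\<Sum>p | p permutes ?U. \<Sum>I\<in>Pow ?U.
      if p permutes I then x ^ card I * (of_int (sign p) * (\<Prod>i\<in>I. A $$ (i, p i))) else 0)"
    by (auto simp: sum_distrib_left mult_ac intro!: sum.cong)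
  also have "\<dots> = (\<Sum>I\<in>Pow ?U. \<Sum>p | p permutes ?U.
      if p permutes I then x ^ card I * (of_int (sign p) * (\<Prod>i\<in>I. A $$ (i, p i))) else 0)"
    by (rule sum.swap)
  also have "\<dots> = (\<Sum>I\<in>Pow ?U. x ^ card I * principal_minor A I)"
  proof (rule sum.cong[OF refl])
    fix I assume I: "I \<in> Pow ?U"
    have "(\<Sum>p | p permutes ?U. if p permutes I then x ^ card I * (of_int (sign p) * (\<Prod>i\<in>I. A $$ (i, p i))) else 0)
       = (\<Sum>p\<in>{p. p permutes I}. x ^ card I * (of_int (sign p) * (\<Prod>i\<in>I. A $$ (i, p i))))"
      using I permutes_subset[of _ I ?U]
      by (subst sum.inter_filter[symmetric]) (auto simp: finite_permutations intro!: sum.cong)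
    then show "(\<Sum>p | p permutes ?U. if p permutes I then x ^ card I * (of_int (sign p) * (\<Prod>i\<in>I. A $$ (i, p i))) else 0)
       = x ^ card I * principal_minor A I"
      by (simp add: principal_minor_def sum_distrib_left)
  qed
  finally show ?thesis .
qed

text \<open>This is \<open>\<Sum>\<^sub>m (-q)\<^sup>m tr(\<Lambda>\<^sup>m A)\<close> by \<open>character_ext_power\<close>, and the reversed characteristic
  polynomial \<open>det(1 - qA)\<close> by \<open>poly_rev_charpoly\<close>.\<close>

definition rev_charpoly :: "nat \<Rightarrow> complex mat \<Rightarrow> complex poly" where
  "rev_charpoly d A = (\<Sum>m\<le>d. Polynomial.monom ((-1) ^ m * (\<Sum>I | I \<subseteq> {..<d} \<and> card I = m. principal_minor A I)) m)"

lemma coeff_rev_charpoly: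
  "m \<le> d \<Longrightarrow> Polynomial.coeff (rev_charpoly d (\<rho> g)) m = (-1) ^ m * character (ext_power d m \<rho>) g"
  by (simp add: rev_charpoly_def coeff_sum character_ext_power)

lemma degree_rev_charpoly: "Polynomial.degree (rev_charpoly d A) \<le> d"
  unfolding rev_charpoly_def
  by (intro degree_sum_le) (auto intro: order.trans[OF degree_monom_le])

lemma poly_rev_charpoly:
  assumes A: "A \<in> carrier_mat d d"
  shows "poly (rev_charpoly d A) x = det (1\<^sub>m d + (-x) \<cdot>\<^sub>m A)"
proof -
  let ?F = "\<lambda>I. (-x) ^ card I * principal_minor A I"
  have "poly (rev_charpoly d A) x = (\<Sum>m\<le>d. \<Sum>I | I \<subseteq> {..<d} \<and> card I = m. ?F I)"
    unfolding rev_charpoly_def poly_sum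
    by (intro sum.cong refl) (auto simp: poly_monom sum_distrib_left power_minus[of x] mult_ac intro!: sum.cong)
  also have "\<dots> = (\<Sum>m\<le>d. \<Sum>I | I \<in> Pow {..<d} \<and> card I = m. ?F I)" by simp
  also have "\<dots> = (\<Sum>I\<in>Pow {..<d}. ?F I)"
    by (rule sum.group) (use card_mono[of "{..<d}"] in auto)
  finally show ?thesis using det_one_plus_smult[OF A, of "-x"] by simp
qed

lemma rev_charpoly_similar:
  assumes A: "A \<in> carrier_mat d d" and sim: "similar_mat_wit A B P Q"
  shows "rev_charpoly d A = rev_charpoly d B"
proof -
  note w = similar_mat_witD2[OF A sim]
  have "poly (rev_charpoly d A) x = poly (rev_charpoly d B) x" for x
  proof -
    let ?C = "1\<^sub>m d + (-x) \<cdot>\<^sub>m B"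
    have C: "?C \<in> carrier_mat d d" using w by simp
    have "P * ?C = P + (-x) \<cdot>\<^sub>m (P * B)"
      using w by (simp add: mult_add_distrib_mat[of _ d d _ d] mult_smult_distrib[of _ d d _ d])
    then have "P * ?C * Q = P * Q + (-x) \<cdot>\<^sub>m (P * B) * Q"
      using w by (simp add: add_mult_distrib_mat[of _ d d _ _ d])
    also have "(-x) \<cdot>\<^sub>m (P * B) * Q = (-x) \<cdot>\<^sub>m (P * B * Q)"
      by (rule mult_smult_assoc_mat) (use w in auto)
    finally have "P * ?C * Q = 1\<^sub>m d + (-x) \<cdot>\<^sub>m A" unfolding w(1) w(3)[symmetric] .
    then have "det (1\<^sub>m d + (-x) \<cdot>\<^sub>m A) = det P * det ?C * det Q"
      using w C by (metis det_mult mult_carrier_mat)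
    also have "\<dots> = det ?C * (det P * det Q)" by (simp add: mult_ac)
    also have "det P * det Q = 1" using det_mult[of P d Q] w(1,6,7) by simp
    finally show ?thesis using A w by (simp add: poly_rev_charpoly)
  qed
  then show ?thesis by (simp add: poly_eq_poly_eq_iff[symmetric] fun_eq_iff)
qed

lemma rev_charpoly_upper_triangular:
  assumes B: "B \<in> carrier_mat d d" "upper_triangular B"
  shows "rev_charpoly d B = (\<Prod>i<d. [:1, - B $$ (i, i):])"
proof -
  have "poly (rev_charpoly d B) x = poly (\<Prod>i<d. [:1, - B $$ (i, i):]) x" for x
  proof -
    let ?C = "1\<^sub>m d + (-x) \<cdot>\<^sub>m B"
    have C: "?C \<in> carrier_mat d d" using B by simp
    have ut: "upper_triangular ?C"
      using B upper_triangularD[OF B(2)] by (intro upper_triangularI) auto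
    have "poly (rev_charpoly d B) x = prod_list (diag_mat ?C)"
      unfolding poly_rev_charpoly[OF B(1)] by (rule det_upper_triangular[OF ut C])
    also have "\<dots> = (\<Prod>i<d. ?C $$ (i, i))"
    proof -
      have dim: "dim_row ?C = d" by (rule carrier_matD(1)[OF C])
      show ?thesis
        unfolding diag_mat_def dim
        using prod.distinct_set_conv_list[of "[0..<d]" "\<lambda>i. ?C $$ (i, i)"]
        by (simp only: distinct_upt set_upt atLeast0LessThan simp_thms)
    qed
    also have "\<dots> = (\<Prod>i<d. 1 - x * B $$ (i, i))" using B by (intro prod.cong) auto
    finally show ?thesis by (simp add: poly_prod)
  qed
  then show ?thesis by (simp add: poly_eq_poly_eq_iff[symmetric] fun_eq_iff)
qed

text \<open>The characters of the exterior powers are, up to sign, the coefficients of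
  \<open>det(1 - q R(g))\<close>, which is invariant under conjugation.\<close>

lemma (in irreps) ext_power_class_function:
  assumes R: "representation G d R" and m: "m \<le> d" and gh: "g \<in> carrier G" "h \<in> carrier G"
  shows "character (ext_power d m R) (h \<otimes> g \<otimes> inv h) = character (ext_power d m R) g"
proof -
  have c: "R (h \<otimes> g \<otimes> inv h) \<in> carrier_mat d d" "R g \<in> carrier_mat d d"
    "R h \<in> carrier_mat d d" "R (inv h) \<in> carrier_mat d d" using repD(1)[OF R] gh by auto
  have eq: "R (h \<otimes> g \<otimes> inv h) = R h * R g * R (inv h)"
    using gh by (simp add: repD(3)[OF R])
  have "similar_mat_wit (R (h \<otimes> g \<otimes> inv h)) (R g) (R h) (R (inv h))"
    by (rule similar_mat_witI[OF rep_inv[OF R gh(2)] eq c])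
  from rev_charpoly_similar[OF c(1) this]
  have "Polynomial.coeff (rev_charpoly d (R (h \<otimes> g \<otimes> inv h))) m = Polynomial.coeff (rev_charpoly d (R g)) m" by simp
  then show ?thesis by (simp add: coeff_rev_charpoly[OF m])
qed

section \<open>Polynomials in several variables\<close>

abbreviation lookup where "lookup \<equiv> Poly_Mapping.lookup"
abbreviation keys where "keys \<equiv> Poly_Mapping.keys"

definition mon :: "(nat \<Rightarrow>\<^sub>0 nat) \<Rightarrow> mpoly" where
  "mon a = Poly_Mapping.single a 1"

definition mon_subst :: "(nat \<Rightarrow> mpoly) \<Rightarrow> (nat \<Rightarrow>\<^sub>0 nat) \<Rightarrow> mpoly" where
  "mon_subst f a = (\<Prod>i\<in>keys a. f i ^ lookup a i)"

definition tdeg :: "(nat \<Rightarrow>\<^sub>0 nat) \<Rightarrow> nat" where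
  "tdeg a = (\<Sum>i\<in>keys a. lookup a i)"

lemma lookup_const_mult [simp]: "lookup (poly_const c * p) a = c * lookup p a"
  by (simp add: poly_const_def mult_map_scale_conv_mult[symmetric])
    (simp add: Poly_Mapping.map.rep_eq when_def)

lemma lookup_mon: "lookup (mon a) b = (if a = b then 1 else 0)"
  by (simp add: mon_def lookup_single when_def)

lemma keys_mon [simp]: "keys (mon a) = {a}"
  by (simp add: mon_def)

lemma poly_const_simps:
  "poly_const 0 = 0" "poly_const 1 = 1" "poly_const (c + c') = poly_const c + poly_const c'"
  "poly_const (c * c') = poly_const c * poly_const c'"
  by (simp_all add: poly_const_def single_add mult_single)

lemma poly_const_sum: "poly_const (sum f A) = (\<Sum>x\<in>A. poly_const (f x))"
  by (induction A rule: infinite_finite_induct) (simp_all add: poly_const_simps)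

lemma mon_add: "mon (a + b) = mon a * mon b"
  by (simp add: mon_def mult_single)

lemma mpoly_expand:
  assumes "finite K" "keys p \<subseteq> K"
  shows "p = (\<Sum>a\<in>K. poly_const (lookup p a) * mon a)"
proof (rule poly_mapping_eqI)
  fix b
  have "lookup (\<Sum>a\<in>K. poly_const (lookup p a) * mon a) b = (\<Sum>a\<in>K. if a = b then lookup p b else 0)"
    unfolding lookup_sum by (intro sum.cong) (auto simp: lookup_mon)
  also have "\<dots> = lookup p b" using assms by (auto simp: in_keys_iff)
  finally show "lookup p b = lookup (\<Sum>a\<in>K. poly_const (lookup p a) * mon a) b" by simp
qed

lemma mon_subst_superset:
  assumes "finite K" "keys a \<subseteq> K"
  shows "mon_subst f a = (\<Prod>i\<in>K. f i ^ lookup a i)"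
  unfolding mon_subst_def
  by (rule prod.mono_neutral_left) (use assms in \<open>auto simp: in_keys_iff\<close>)

lemma mon_subst_add: "mon_subst f (a + b) = mon_subst f a * mon_subst f b"
proof -
  let ?K = "keys a \<union> keys b"
  have "mon_subst f (a + b) = (\<Prod>i\<in>?K. f i ^ lookup (a + b) i)"
    by (rule mon_subst_superset) (use Poly_Mapping.keys_add[of a b] in auto)
  then show ?thesis
    by (simp add: lookup_add power_add prod.distrib mon_subst_superset[of ?K])
qed

lemma mon_subst_zero [simp]: "mon_subst f 0 = 1"
  by (simp add: mon_subst_def)

lemma poly_subst_superset:
  assumes "finite K" "keys p \<subseteq> K"
  shows "poly_subst f p = (\<Sum>a\<in>K. poly_const (lookup p a) * mon_subst f a)"
  unfolding poly_subst_def mon_subst_def[symmetric]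
  by (rule sum.mono_neutral_left) (use assms in \<open>auto simp: in_keys_iff poly_const_simps\<close>)

lemma poly_subst_zero [simp]: "poly_subst f 0 = 0"
  by (simp add: poly_subst_def)

lemma poly_subst_mon [simp]: "poly_subst f (mon a) = mon_subst f a"
  by (subst poly_subst_superset[of "{a}"]) (simp_all add: lookup_mon poly_const_simps)

lemma poly_subst_add: "poly_subst f (p + q) = poly_subst f p + poly_subst f q"
proof -
  let ?K = "keys p \<union> keys q"
  have "poly_subst f (p + q) = (\<Sum>a\<in>?K. poly_const (lookup (p + q) a) * mon_subst f a)"
    by (rule poly_subst_superset) (use Poly_Mapping.keys_add[of p q] in auto)
  then show ?thesis
    by (simp add: lookup_add poly_const_simps distrib_right sum.distrib poly_subst_superset[of ?K])
qed

lemma poly_subst_const_mult: "poly_subst f (poly_const c * p) = poly_const c * poly_subst f p"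
proof -
  have "poly_subst f (poly_const c * p) = (\<Sum>a\<in>keys p. poly_const (lookup (poly_const c * p) a) * mon_subst f a)"
    by (rule poly_subst_superset) (auto simp: in_keys_iff)
  then show ?thesis
    by (simp add: poly_const_simps sum_distrib_left mult.assoc poly_subst_superset[of "keys p"])
qed

lemma poly_subst_sum: "poly_subst f (sum F A) = (\<Sum>x\<in>A. poly_subst f (F x))"
  by (induction A rule: infinite_finite_induct) (simp_all add: poly_subst_add)

lemma poly_subst_mult: "poly_subst f (p * q) = poly_subst f p * poly_subst f q"
proof -
  have "p * q = (\<Sum>a\<in>keys p. poly_const (lookup p a) * mon a) * (\<Sum>b\<in>keys q. poly_const (lookup q b) * mon b)"
    using mpoly_expand[of "keys p" p] mpoly_expand[of "keys q" q] by simp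
  also have "\<dots> = (\<Sum>a\<in>keys p. \<Sum>b\<in>keys q. poly_const (lookup p a) * (poly_const (lookup q b) * mon (a + b)))"
    by (simp add: sum_product mon_add mult_ac)
  finally have "poly_subst f (p * q) = (\<Sum>a\<in>keys p. \<Sum>b\<in>keys q.
      (poly_const (lookup p a) * mon_subst f a) * (poly_const (lookup q b) * mon_subst f b))"
    by (simp add: poly_subst_sum poly_subst_const_mult mon_subst_add mult_ac)
  then show ?thesis
    by (simp add: sum_product[symmetric] poly_subst_superset[of "keys p"] poly_subst_superset[of "keys q"])
qed

lemma poly_subst_one [simp]: "poly_subst f 1 = 1"
  using poly_subst_mon[of f 0] by (simp add: mon_def)

lemma poly_subst_const [simp]: "poly_subst f (poly_const c) = poly_const c"
  using poly_subst_const_mult[of f c 1] by simp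

lemma poly_subst_power: "poly_subst f (p ^ k) = poly_subst f p ^ k"
  by (induction k) (simp_all add: poly_subst_mult)

lemma poly_subst_prod: "poly_subst f (prod F A) = (\<Prod>x\<in>A. poly_subst f (F x))"
  by (induction A rule: infinite_finite_induct) (simp_all add: poly_subst_mult)

lemma poly_var_eq_mon: "poly_var i = mon (Poly_Mapping.single i 1)"
  by (simp add: poly_var_def mon_def)

lemma poly_subst_var [simp]: "poly_subst f (poly_var i) = f i"
  by (simp add: poly_var_eq_mon mon_subst_def)

lemma poly_subst_poly_subst: "poly_subst f (poly_subst g p) = poly_subst (\<lambda>i. poly_subst f (g i)) p"
proof -
  have "poly_subst f (mon_subst g a) = mon_subst (\<lambda>i. poly_subst f (g i)) a" for a
    by (simp add: mon_subst_def poly_subst_prod poly_subst_power)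
  then show ?thesis
    by (simp add: poly_subst_superset[of "keys p" p] poly_subst_sum poly_subst_const_mult)
qed

lemma poly_subst_cong:
  assumes p: "p \<in> Sym d" and eq: "\<And>i. i < d \<Longrightarrow> f i = g i"
  shows "poly_subst f p = poly_subst g p"
proof -
  have "mon_subst f a = mon_subst g a" if "a \<in> keys p" for a
    unfolding mon_subst_def
    by (intro prod.cong refl arg_cong2[where f = "(^)"] eq) (use p that in \<open>auto simp: Sym_def\<close>)
  then show ?thesis by (simp add: poly_subst_superset[of "keys p" p])
qed

lemma mon_subst_var: "mon_subst poly_var a = mon a"
proof -
  have pow: "poly_var i ^ k = mon (Poly_Mapping.single i k)" for i k
  proof (induction k)
    case 0
    show ?case by (simp add: mon_def)
  next
    case (Suc k)
    have "mon (Poly_Mapping.single i (Suc k)) = mon (Poly_Mapping.single i 1 + Poly_Mapping.single i k)"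
      by (simp add: single_add[symmetric])
    then show ?case using Suc by (simp add: mon_add poly_var_eq_mon)
  qed
  have "(\<Prod>i\<in>K. mon (F i)) = mon (\<Sum>i\<in>K. F i)" if "finite K" for K and F :: "nat \<Rightarrow> nat \<Rightarrow>\<^sub>0 nat"
    using that by induction (simp_all add: mon_add, simp add: mon_def)
  then have "mon_subst poly_var a = mon (\<Sum>i\<in>keys a. Poly_Mapping.single i (lookup a i))"
    by (simp add: mon_subst_def pow)
  also have "(\<Sum>i\<in>keys a. Poly_Mapping.single i (lookup a i)) = a"
    by (rule poly_mapping_eqI) (auto simp: lookup_sum lookup_single when_def in_keys_iff)
  finally show ?thesis .
qed

lemma poly_subst_poly_var: "poly_subst poly_var p = p"
  using mpoly_expand[of "keys p" p]
  by (simp add: poly_subst_superset[of "keys p" p] mon_subst_var)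

lemma Sym_mon: "mon a \<in> Sym d \<longleftrightarrow> keys a \<subseteq> {..<d}"
  by (simp add: Sym_def)

lemma Sym_zero [simp]: "0 \<in> Sym d"
  by (simp add: Sym_def)

lemma Sym_const [simp]: "poly_const c \<in> Sym d"
  by (simp add: Sym_def poly_const_def)

lemma Sym_one [simp]: "1 \<in> Sym d"
  using Sym_const[of 1 d] by (simp add: poly_const_simps)

lemma Sym_add: "p \<in> Sym d \<Longrightarrow> q \<in> Sym d \<Longrightarrow> p + q \<in> Sym d"
  using Poly_Mapping.keys_add[of p q] by (auto simp: Sym_def)

lemma Sym_mult: "p \<in> Sym d \<Longrightarrow> q \<in> Sym d \<Longrightarrow> p * q \<in> Sym d"
proof -
  assume pq: "p \<in> Sym d" "q \<in> Sym d"
  have "keys c \<subseteq> {..<d}" if c: "c \<in> keys (p * q)" for c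
  proof -
    from c keys_mult[of p q] obtain a b where "c = a + b" "a \<in> keys p" "b \<in> keys q" by blast
    moreover from this pq have "keys a \<subseteq> {..<d}" "keys b \<subseteq> {..<d}" by (auto simp: Sym_def)
    ultimately show ?thesis using Poly_Mapping.keys_add[of a b] by blast
  qed
  then show ?thesis by (simp add: Sym_def)
qed

lemma Sym_sum: "(\<And>x. x \<in> A \<Longrightarrow> F x \<in> Sym d) \<Longrightarrow> sum F A \<in> Sym d"
  by (induction A rule: infinite_finite_induct) (auto intro: Sym_add)

lemma Sym_prod: "(\<And>x. x \<in> A \<Longrightarrow> F x \<in> Sym d) \<Longrightarrow> prod F A \<in> Sym d"
  by (induction A rule: infinite_finite_induct) (auto intro: Sym_mult)

lemma Sym_power: "p \<in> Sym d \<Longrightarrow> p ^ k \<in> Sym d"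
  by (induction k) (auto intro: Sym_mult)

lemma Sym_var: "i < d \<Longrightarrow> poly_var i \<in> Sym d"
  by (simp add: poly_var_eq_mon Sym_mon)

lemma Sym_poly_subst:
  assumes "p \<in> Sym d'" "\<And>i. i < d' \<Longrightarrow> f i \<in> Sym d"
  shows "poly_subst f p \<in> Sym d"
  unfolding poly_subst_def using assms
  by (auto simp: Sym_def[of d'] intro!: Sym_sum Sym_mult Sym_prod Sym_power)

subsection \<open>Degrees\<close>

text \<open>The degree of a monomial when the \<open>i\<close>-th variable has degree \<open>w i\<close>: \<open>w = 1\<close> for the
  variables of \<open>Sym d\<close>, and \<open>w i = n\<^sub>i\<close> for monomials in the \<open>\<theta>\<^sub>i\<close>.\<close>

definition wdeg :: "(nat \<Rightarrow> nat) \<Rightarrow> (nat \<Rightarrow>\<^sub>0 nat) \<Rightarrow> nat" where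
  "wdeg w a = (\<Sum>i\<in>keys a. w i * lookup a i)"

lemma wdeg_superset: "finite K \<Longrightarrow> keys a \<subseteq> K \<Longrightarrow> wdeg w a = (\<Sum>i\<in>K. w i * lookup a i)"
  unfolding wdeg_def by (rule sum.mono_neutral_left) (auto simp: in_keys_iff)

lemma wdeg_add: "wdeg w (a + b) = wdeg w a + wdeg w b"
proof -
  let ?K = "keys a \<union> keys b"
  have "wdeg w (a + b) = (\<Sum>i\<in>?K. w i * lookup (a + b) i)"
    by (rule wdeg_superset) (use Poly_Mapping.keys_add[of a b] in auto)
  then show ?thesis
    by (simp add: lookup_add distrib_left sum.distrib wdeg_superset[of ?K])
qed

lemma tdeg_eq_wdeg: "tdeg a = wdeg (\<lambda>_. 1) a"
  by (simp add: tdeg_def wdeg_def)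

lemma tdeg_add: "tdeg (a + b) = tdeg a + tdeg b"
  by (simp add: tdeg_eq_wdeg wdeg_add)

lemma homogeneous_iff: "homogeneous k p \<longleftrightarrow> (\<forall>a\<in>keys p. tdeg a = k)"
  by (simp add: homogeneous_def tdeg_def)

lemma homogeneous_zero [simp]: "homogeneous k 0"
  by (simp add: homogeneous_iff)

lemma homogeneous_one [simp]: "homogeneous 0 1"
  by (simp add: homogeneous_iff tdeg_def)

lemma homogeneous_const_mult: "homogeneous k p \<Longrightarrow> homogeneous k (poly_const c * p)"
  by (auto simp: homogeneous_iff in_keys_iff)

lemma homogeneous_mon: "homogeneous (tdeg a) (mon a)"
  by (simp add: homogeneous_iff)

lemma homogeneous_var: "homogeneous 1 (poly_var i)"
  by (simp add: poly_var_eq_mon homogeneous_iff tdeg_def)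

lemma homogeneous_add: "homogeneous k p \<Longrightarrow> homogeneous k q \<Longrightarrow> homogeneous k (p + q)"
  using Poly_Mapping.keys_add[of p q] by (auto simp: homogeneous_iff)

lemma homogeneous_sum: "(\<And>x. x \<in> A \<Longrightarrow> homogeneous k (F x)) \<Longrightarrow> homogeneous k (sum F A)"
  by (induction A rule: infinite_finite_induct) (auto intro: homogeneous_add)

lemma homogeneous_mult: "homogeneous k p \<Longrightarrow> homogeneous l q \<Longrightarrow> homogeneous (k + l) (p * q)"
proof -
  assume h: "homogeneous k p" "homogeneous l q"
  have "tdeg c = k + l" if c: "c \<in> keys (p * q)" for c
  proof -
    from c keys_mult[of p q] obtain a b where "c = a + b" "a \<in> keys p" "b \<in> keys q" by blast
    then show ?thesis using h by (simp add: homogeneous_iff tdeg_add)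
  qed
  then show ?thesis by (simp add: homogeneous_iff)
qed

lemma homogeneous_power: "homogeneous k p \<Longrightarrow> homogeneous (k * m) (p ^ m)"
proof (induction m)
  case (Suc m)
  then show ?case using homogeneous_mult[of k p "k * m" "p ^ m"] by simp
qed simp

lemma homogeneous_prod:
  "finite A \<Longrightarrow> (\<And>x. x \<in> A \<Longrightarrow> homogeneous (k x) (F x)) \<Longrightarrow> homogeneous (\<Sum>x\<in>A. k x) (prod F A)"
  by (induction A rule: finite_induct) (auto intro: homogeneous_mult)

lemma homogeneous_mon_subst:
  assumes "\<And>i. i \<in> keys a \<Longrightarrow> homogeneous (w i) (f i)"
  shows "homogeneous (wdeg w a) (mon_subst f a)"
  unfolding mon_subst_def wdeg_def
  by (intro homogeneous_prod homogeneous_power assms) auto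

definition hcomp :: "nat \<Rightarrow> mpoly \<Rightarrow> mpoly" where
  "hcomp k p = (\<Sum>a | a \<in> keys p \<and> tdeg a = k. poly_const (lookup p a) * mon a)"

lemma lookup_hcomp: "lookup (hcomp k p) b = (if tdeg b = k then lookup p b else 0)"
proof -
  have "lookup (hcomp k p) b = (\<Sum>a | a \<in> keys p \<and> tdeg a = k. if a = b then lookup p b else 0)"
    unfolding hcomp_def lookup_sum by (intro sum.cong) (auto simp: lookup_mon)
  also have "\<dots> = (if tdeg b = k then lookup p b else 0)" by (auto simp: in_keys_iff)
  finally show ?thesis .
qed

lemma hcomp_sum: "hcomp k (sum F A) = (\<Sum>x\<in>A. hcomp k (F x))"
  by (rule poly_mapping_eqI) (simp add: lookup_hcomp lookup_sum)

lemma hcomp_homogeneous: "homogeneous l p \<Longrightarrow> hcomp k p = (if k = l then p else 0)"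
  by (rule poly_mapping_eqI) (auto simp: lookup_hcomp homogeneous_iff in_keys_iff)

subsection \<open>The action of matrices on polynomials\<close>

definition linear_form :: "nat \<Rightarrow> complex mat \<Rightarrow> nat \<Rightarrow> mpoly" where
  "linear_form d A j = (\<Sum>i<d. poly_const (A $$ (i, j)) * poly_var i)"

lemma sym_act_eq: "sym_act d A = poly_subst (linear_form d A)"
  by (simp add: sym_act_def linear_form_def[abs_def])

lemma Sym_linear_form: "linear_form d A j \<in> Sym d"
  unfolding linear_form_def by (intro Sym_sum Sym_mult Sym_const Sym_var) auto

lemma homogeneous_linear_form: "homogeneous 1 (linear_form d A j)"
  unfolding linear_form_def by (intro homogeneous_sum homogeneous_const_mult homogeneous_var)

lemma Sym_sym_act: "p \<in> Sym d \<Longrightarrow> sym_act d A p \<in> Sym d"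
  unfolding sym_act_eq by (rule Sym_poly_subst) (auto intro: Sym_linear_form)

lemma homogeneous_sym_act_mon: "homogeneous (tdeg a) (sym_act d A (mon a))"
  unfolding sym_act_eq poly_subst_mon tdeg_eq_wdeg
  by (rule homogeneous_mon_subst) (rule homogeneous_linear_form)

lemma sym_act_sym_act:
  assumes A: "A \<in> carrier_mat d d" and B: "B \<in> carrier_mat d d" and p: "p \<in> Sym d"
  shows "sym_act d A (sym_act d B p) = sym_act d (A * B) p"
proof -
  have "poly_subst (linear_form d A) (linear_form d B j) = linear_form d (A * B) j" if j: "j < d" for j
  proof -
    have "poly_subst (linear_form d A) (linear_form d B j) =
        (\<Sum>i<d. \<Sum>k<d. poly_const (A $$ (k, i) * B $$ (i, j)) * poly_var k)"
      unfolding linear_form_def[of d B]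
      by (simp add: poly_subst_sum poly_subst_const_mult)
        (simp add: linear_form_def sum_distrib_left poly_const_simps mult_ac)
    also have "\<dots> = (\<Sum>k<d. (\<Sum>i<d. poly_const (A $$ (k, i) * B $$ (i, j))) * poly_var k)"
      by (subst sum.swap) (simp add: sum_distrib_right)
    also have "\<dots> = linear_form d (A * B) j"
      unfolding linear_form_def
      by (intro sum.cong refl) (simp add: index_mult_mat_sum[OF A B _ j] poly_const_sum del: index_mult_mat)
    finally show ?thesis .
  qed
  then show ?thesis
    unfolding sym_act_eq poly_subst_poly_subst by (intro poly_subst_cong[OF p])
qed

lemma sym_act_one:
  assumes p: "p \<in> Sym d"
  shows "sym_act d (1\<^sub>m d) p = p"
proof -
  have "linear_form d (1\<^sub>m d) j = poly_var j" if "j < d" for j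
  proof -
    have "linear_form d (1\<^sub>m d) j = (\<Sum>i<d. if i = j then poly_var j else 0)"
      unfolding linear_form_def using that by (intro sum.cong) (auto simp: poly_const_simps)
    then show ?thesis using that by simp
  qed
  then show ?thesis
    unfolding sym_act_eq using poly_subst_cong[OF p, of _ poly_var] poly_subst_poly_var by metis
qed

section \<open>Traces on symmetric powers\<close>

definition exps :: "nat \<Rightarrow> (nat \<Rightarrow> nat) \<Rightarrow> nat \<Rightarrow> (nat \<Rightarrow>\<^sub>0 nat) set" where
  "exps d w m = {a. keys a \<subseteq> {..<d} \<and> wdeg w a = m}"

lemma finite_exps:
  assumes w: "\<And>i. i < d \<Longrightarrow> w i > 0"
  shows "finite (exps d w m)"
proof -
  have le: "lookup a i \<le> m" if "a \<in> exps d w m" "i < d" for a i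
  proof -
    have "lookup a i \<le> w i * lookup a i" using w[OF that(2)] by simp
    also have "\<dots> \<le> (\<Sum>i<d. w i * lookup a i)" using that(2) by (intro member_le_sum) auto
    also have "\<dots> = m" using that(1) wdeg_superset[of "{..<d}" a w] by (simp add: exps_def)
    finally show ?thesis .
  qed
  have "lookup ` exps d w m \<subseteq> {f. \<forall>i. (i \<in> {..<d} \<longrightarrow> f i \<in> {..m}) \<and> (i \<notin> {..<d} \<longrightarrow> f i = 0)}"
    using le by (auto simp: exps_def in_keys_iff subset_iff)
  moreover have "finite \<dots>" by (rule finite_set_of_finite_funs) auto
  ultimately have "finite (lookup ` exps d w m)" by (rule finite_subset)
  moreover have "inj_on lookup (exps d w m)" by (intro inj_onI poly_mapping_eqI) simp
  ultimately show ?thesis by (rule finite_imageD)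
qed

abbreviation monomials :: "nat \<Rightarrow> nat \<Rightarrow> (nat \<Rightarrow>\<^sub>0 nat) set" where
  "monomials d m \<equiv> exps d (\<lambda>_. 1) m"

lemma finite_monomials: "finite (monomials d m)"
  by (rule finite_exps) simp

lemma keys_subset_monomials: "p \<in> Sym d \<Longrightarrow> homogeneous m p \<Longrightarrow> keys p \<subseteq> monomials d m"
  by (auto simp: exps_def Sym_def homogeneous_iff tdeg_eq_wdeg)

definition sym_trace :: "nat \<Rightarrow> complex mat \<Rightarrow> nat \<Rightarrow> complex" where
  "sym_trace d A m = (\<Sum>a\<in>monomials d m. lookup (sym_act d A (mon a)) a)"

lemma keys_sym_act_mon: "a \<in> monomials d m \<Longrightarrow> keys (sym_act d A (mon a)) \<subseteq> monomials d m"
  using homogeneous_sym_act_mon[of a d A]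
  by (intro keys_subset_monomials Sym_sym_act) (auto simp: Sym_mon exps_def tdeg_eq_wdeg)

text \<open>The trace of an endomorphism of the span of the monomials in \<open>K\<close> may be computed in any
  other basis \<open>f\<close>.\<close>

lemma trace_change_of_basis:
  fixes f :: "'t \<Rightarrow> mpoly"
  assumes fT: "finite T" and fK: "finite K"
    and f: "\<And>t. t \<in> T \<Longrightarrow> keys (f t) \<subseteq> K"
    and span: "\<And>a. a \<in> K \<Longrightarrow> mon a = (\<Sum>t\<in>T. poly_const (Q t a) * f t)"
    and indep: "\<And>z t. (\<Sum>t\<in>T. poly_const (z t) * f t) = 0 \<Longrightarrow> t \<in> T \<Longrightarrow> z t = 0"
    and LK: "\<And>a. a \<in> K \<Longrightarrow> keys (poly_subst L (mon a)) \<subseteq> K"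
    and Lf: "\<And>t. t \<in> T \<Longrightarrow> poly_subst L (f t) = (\<Sum>s\<in>T. poly_const (F s t) * f s)"
  shows "(\<Sum>a\<in>K. lookup (poly_subst L (mon a)) a) = (\<Sum>t\<in>T. F t t)"
proof -
  define P where "P a t = lookup (f t) a" for a t
  define A where "A b a = lookup (poly_subst L (mon a)) b" for a b
  have F: "F s t = (\<Sum>a\<in>K. \<Sum>b\<in>K. P a t * A b a * Q s b)" if s: "s \<in> T" and t: "t \<in> T" for s t
  proof -
    have "poly_subst L (f t) = poly_subst L (\<Sum>a\<in>K. poly_const (P a t) * mon a)"
      unfolding P_def using mpoly_expand[OF fK f[OF t]] by simp
    also have "\<dots> = (\<Sum>a\<in>K. poly_const (P a t) * poly_subst L (mon a))"
      by (simp only: poly_subst_sum poly_subst_const_mult)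
    also have "\<dots> = (\<Sum>a\<in>K. poly_const (P a t) * (\<Sum>b\<in>K. poly_const (A b a) * mon b))"
      unfolding A_def by (intro sum.cong refl arg_cong2[where f = "(*)"] mpoly_expand[OF fK LK])
    also have "\<dots> = (\<Sum>a\<in>K. poly_const (P a t) * (\<Sum>b\<in>K. poly_const (A b a) * (\<Sum>s\<in>T. poly_const (Q s b) * f s)))"
      by (intro sum.cong refl arg_cong2[where f = "(*)"] span)
    also have "\<dots> = (\<Sum>a\<in>K. \<Sum>b\<in>K. \<Sum>s\<in>T. poly_const (P a t * A b a * Q s b) * f s)"
      by (simp add: sum_distrib_left poly_const_simps mult.assoc)
    also have "\<dots> = (\<Sum>a\<in>K. \<Sum>s\<in>T. \<Sum>b\<in>K. poly_const (P a t * A b a * Q s b) * f s)"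
      by (intro sum.cong refl sum.swap)
    also have "\<dots> = (\<Sum>s\<in>T. \<Sum>a\<in>K. \<Sum>b\<in>K. poly_const (P a t * A b a * Q s b) * f s)"
      by (rule sum.swap)
    also have "\<dots> = (\<Sum>s\<in>T. poly_const (\<Sum>a\<in>K. \<Sum>b\<in>K. P a t * A b a * Q s b) * f s)"
      by (simp only: poly_const_sum sum_distrib_right)
    finally have "(\<Sum>s\<in>T. poly_const (F s t) * f s) =
        (\<Sum>s\<in>T. poly_const (\<Sum>a\<in>K. \<Sum>b\<in>K. P a t * A b a * Q s b) * f s)"
      using Lf[OF t] by simp
    then have "(\<Sum>s\<in>T. poly_const (F s t + (- 1) * (\<Sum>a\<in>K. \<Sum>b\<in>K. P a t * A b a * Q s b)) * f s) = 0"
    proof -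
      have neg: "poly_const (- 1 :: complex) = - 1" by (simp add: poly_const_def single_uminus)
      assume eq: "(\<Sum>s\<in>T. poly_const (F s t) * f s) =
        (\<Sum>s\<in>T. poly_const (\<Sum>a\<in>K. \<Sum>b\<in>K. P a t * A b a * Q s b) * f s)"
      show ?thesis
        unfolding poly_const_simps neg distrib_right sum.distrib eq
        by (simp add: sum_negf[symmetric] sum.distrib[symmetric])
    qed
    from indep[OF this s] show ?thesis by simp
  qed
  have delta: "(\<Sum>t\<in>T. P a t * Q t b) = (if b = a then 1 else 0)" if b: "b \<in> K" for a b
  proof -
    have "lookup (mon b) a = (\<Sum>t\<in>T. Q t b * P a t)"
      by (subst span[OF b]) (simp add: lookup_sum P_def)
    then show ?thesis by (simp add: lookup_mon mult.commute)
  qed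
  have "(\<Sum>t\<in>T. F t t) = (\<Sum>t\<in>T. \<Sum>a\<in>K. \<Sum>b\<in>K. A b a * (P a t * Q t b))"
    by (intro sum.cong refl) (simp add: F mult_ac)
  also have "\<dots> = (\<Sum>a\<in>K. \<Sum>t\<in>T. \<Sum>b\<in>K. A b a * (P a t * Q t b))" by (rule sum.swap)
  also have "\<dots> = (\<Sum>a\<in>K. \<Sum>b\<in>K. \<Sum>t\<in>T. A b a * (P a t * Q t b))"
    by (intro sum.cong refl sum.swap)
  also have "\<dots> = (\<Sum>a\<in>K. \<Sum>b\<in>K. if b = a then A a a else 0)"
    by (intro sum.cong refl) (simp add: sum_distrib_left[symmetric] delta)
  also have "\<dots> = (\<Sum>a\<in>K. A a a)" using fK by simp
  finally show ?thesis by (simp add: A_def)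
qed

text \<open>The polynomials \<open>P \<cdot> x\<^sup>a\<close> form a basis in which \<open>A\<close> has the matrix that \<open>B\<close> has in the basis of
  the monomials \<open>x\<^sup>a\<close>.\<close>

lemma sym_trace_similar:
  assumes A: "A \<in> carrier_mat d d" and sim: "similar_mat_wit A B P Q"
  shows "sym_trace d A m = sym_trace d B m"
proof -
  note w = similar_mat_witD2[OF A sim]
  let ?K = "monomials d m"
  have Sm: "mon a \<in> Sym d" if "a \<in> ?K" for a using that by (simp add: exps_def Sym_mon)
  have expand: "sym_act d X (mon a) = (\<Sum>b\<in>?K. poly_const (lookup (sym_act d X (mon a)) b) * mon b)"
    if "a \<in> ?K" for X a
    by (rule mpoly_expand[OF finite_monomials keys_sym_act_mon[OF that]])
  have lin: "sym_act d X (\<Sum>b\<in>?K. poly_const (z b) * F b) = (\<Sum>b\<in>?K. poly_const (z b) * sym_act d X (F b))" for X z F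
    by (simp add: sym_act_eq poly_subst_sum poly_subst_const_mult)
  have "(\<Sum>a\<in>?K. lookup (poly_subst (linear_form d A) (mon a)) a) =
      (\<Sum>t\<in>?K. lookup (sym_act d B (mon t)) t)"
  proof (rule trace_change_of_basis[where f = "\<lambda>a. sym_act d P (mon a)"
        and Q = "\<lambda>t a. lookup (sym_act d Q (mon a)) t"
        and F = "\<lambda>s t. lookup (sym_act d B (mon t)) s", OF finite_monomials finite_monomials])
    fix a assume a: "a \<in> ?K"
    show "keys (sym_act d P (mon a)) \<subseteq> ?K" by (rule keys_sym_act_mon[OF a])
    show "keys (poly_subst (linear_form d A) (mon a)) \<subseteq> ?K"
      using keys_sym_act_mon[OF a, of A] by (simp only: sym_act_eq)
    have "mon a = sym_act d P (sym_act d Q (mon a))"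
      using sym_act_sym_act[OF w(6,7) Sm[OF a]] sym_act_one[OF Sm[OF a]] w(1) by simp
    then show "mon a = (\<Sum>t\<in>?K. poly_const (lookup (sym_act d Q (mon a)) t) * sym_act d P (mon t))"
      by (subst (asm) expand[OF a, of Q]) (simp only: lin)
    have AP: "A * P = P * B"
    proof -
      have "P * B * Q * P = P * B * (Q * P)" by (rule assoc_mult_mat) (use w in auto)
      then show ?thesis unfolding w(3)[symmetric] w(2) using w by simp
    qed
    have "sym_act d A (sym_act d P (mon a)) = sym_act d P (sym_act d B (mon a))"
      unfolding sym_act_sym_act[OF w(4,6) Sm[OF a]] sym_act_sym_act[OF w(6,5) Sm[OF a]] AP ..
    also have "\<dots> = (\<Sum>s\<in>?K. poly_const (lookup (sym_act d B (mon a)) s) * sym_act d P (mon s))"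
      by (subst expand[OF a, of B]) (simp only: lin)
    finally show "poly_subst (linear_form d A) (sym_act d P (mon a)) =
        (\<Sum>s\<in>?K. poly_const (lookup (sym_act d B (mon a)) s) * sym_act d P (mon s))"
      by (simp only: sym_act_eq)
  next
    fix z t assume z: "(\<Sum>t\<in>?K. poly_const (z t) * sym_act d P (mon t)) = 0" and t: "t \<in> ?K"
    have "0 = sym_act d Q (\<Sum>t\<in>?K. poly_const (z t) * sym_act d P (mon t))"
      unfolding z by (simp add: sym_act_eq)
    also have "\<dots> = (\<Sum>t\<in>?K. poly_const (z t) * mon t)"
      unfolding lin using w(2)
      by (intro sum.cong refl) (simp add: sym_act_sym_act[OF w(7,6) Sm] sym_act_one[OF Sm])
    finally have "0 = lookup (\<Sum>s\<in>?K. poly_const (z s) * mon s) t" by (metis lookup_zero)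
    also have "\<dots> = (\<Sum>s\<in>?K. if s = t then z t else 0)"
      unfolding lookup_sum by (intro sum.cong) (auto simp: lookup_mon)
    finally show "z t = 0" using t finite_monomials by simp
  qed
  then show ?thesis by (simp add: sym_trace_def sym_act_eq)
qed

text \<open>In the lexicographic order \<open>x\<^sub>j\<close> is smaller than \<open>x\<^sub>i\<close> for \<open>i < j\<close>, so an upper triangular
  substitution only adds larger monomials.\<close>

definition lead :: "mpoly \<Rightarrow> (nat \<Rightarrow>\<^sub>0 nat) \<Rightarrow> complex \<Rightarrow> bool" where
  "lead p a c \<longleftrightarrow> (\<forall>b\<in>keys p. a \<le> b) \<and> lookup p a = c"

lemma lead_mult:
  assumes "lead p a c" "lead q b c'"
  shows "lead (p * q) (a + b) (c * c')"
proof -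
  have le: "\<And>k. k \<in> keys p \<Longrightarrow> a \<le> k" "\<And>l. l \<in> keys q \<Longrightarrow> b \<le> l" and c: "lookup p a = c" "lookup q b = c'"
    using assms by (auto simp: lead_def)
  have keys: "a + b \<le> x" if "x \<in> keys (p * q)" for x
  proof -
    from that keys_mult[of p q] obtain k l where "x = k + l" "k \<in> keys p" "l \<in> keys q" by blast
    then show ?thesis using le by (auto intro: add_mono)
  qed
  have unique: "k + l = a + b \<longleftrightarrow> k = a \<and> l = b" if "k \<in> keys p" "l \<in> keys q" for k l
  proof
    assume eq: "k + l = a + b"
    have "\<not> a < k" using add_less_le_mono[of a k b l] le(2)[OF that(2)] eq by auto
    then have "k = a" using le(1)[OF that(1)] by simp
    then show "k = a \<and> l = b" using eq by simp
  qed simp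
  have "p * q = (\<Sum>k\<in>insert a (keys p). \<Sum>l\<in>insert b (keys q). poly_const (lookup p k) * (poly_const (lookup q l) * mon (k + l)))"
    by (subst mpoly_expand[of "insert a (keys p)" p], simp, blast,
        subst mpoly_expand[of "insert b (keys q)" q], simp, blast)
      (simp add: sum_product mon_add mult_ac)
  then have "lookup (p * q) (a + b) = (\<Sum>k\<in>insert a (keys p). \<Sum>l\<in>insert b (keys q).
      lookup p k * (lookup q l * (if k + l = a + b then 1 else 0)))"
    by (simp only: lookup_sum lookup_const_mult lookup_mon)
  also have "\<dots> = (\<Sum>k\<in>insert a (keys p). \<Sum>l\<in>insert b (keys q). if l = b then (if k = a then c * c' else 0) else 0)"
  proof (intro sum.cong refl)
    fix k l assume kl: "k \<in> insert a (keys p)" "l \<in> insert b (keys q)"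
    show "lookup p k * (lookup q l * (if k + l = a + b then 1 else 0)) =
        (if l = b then (if k = a then c * c' else 0) else 0)"
    proof (cases "k \<in> keys p \<and> l \<in> keys q")
      case True
      then show ?thesis using unique[of k l] c by auto
    next
      case False
      then have "lookup p k = 0 \<or> lookup q l = 0" by (auto simp: in_keys_iff)
      then show ?thesis using c by auto
    qed
  qed
  also have "\<dots> = c * c'" by simp
  finally show ?thesis using keys by (simp add: lead_def)
qed

lemma lead_one: "lead 1 0 1"
  by (simp add: lead_def)

lemma lead_power: "lead p (Poly_Mapping.single j 1) c \<Longrightarrow> lead (p ^ k) (Poly_Mapping.single j k) (c ^ k)"
proof (induction k)
  case (Suc k)
  have "Poly_Mapping.single j (Suc k) = Poly_Mapping.single j 1 + Poly_Mapping.single j k"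
    by (simp add: single_add[symmetric])
  then show ?case using lead_mult[OF Suc.prems Suc.IH[OF Suc.prems]] by simp
qed (simp add: lead_one)

lemma lead_prod:
  "finite K \<Longrightarrow> (\<And>i. i \<in> K \<Longrightarrow> lead (F i) (a i) (c i)) \<Longrightarrow> lead (prod F K) (\<Sum>i\<in>K. a i) (\<Prod>i\<in>K. c i)"
  by (induction K rule: finite_induct) (auto intro: lead_mult lead_one)

lemma single_less: "i < j \<Longrightarrow> Poly_Mapping.single j (1::nat) < Poly_Mapping.single i 1"
  unfolding less_poly_mapping.rep_eq less_fun_def
  by (intro exI[of _ i]) (auto simp: lookup_single when_def)

lemma lead_linear_form:
  assumes B: "B \<in> carrier_mat d d" "upper_triangular B" and j: "j < d"
  shows "lead (linear_form d B j) (Poly_Mapping.single j 1) (B $$ (j, j))"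
proof -
  have lk: "lookup (linear_form d B j) b = (\<Sum>i<d. if b = Poly_Mapping.single i 1 then B $$ (i, j) else 0)" for b
    unfolding linear_form_def lookup_sum
    by (intro sum.cong) (auto simp: poly_var_eq_mon lookup_mon)
  have "Poly_Mapping.single j 1 \<le> b" if b: "b \<in> keys (linear_form d B j)" for b
  proof -
    from b have "(\<Sum>i<d. if b = Poly_Mapping.single i 1 then B $$ (i, j) else 0) \<noteq> 0"
      by (simp only: in_keys_iff lk not_False_eq_True)
    then obtain i where "i \<in> {..<d}" "(if b = Poly_Mapping.single i 1 then B $$ (i, j) else 0) \<noteq> 0"
      by (rule sum.not_neutral_contains_not_neutral)
    then have i: "i < d" "b = Poly_Mapping.single i 1" "B $$ (i, j) \<noteq> 0"
      by (auto split: if_splits)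
    have "i \<le> j"
    proof (rule ccontr)
      assume "\<not> i \<le> j"
      then show False using upper_triangularD[OF B(2), of j i] B(1) i by simp
    qed
    then show ?thesis using single_less[of i j] i(2) by (cases "i = j") auto
  qed
  moreover have "lookup (linear_form d B j) (Poly_Mapping.single j 1) = B $$ (j, j)"
  proof -
    have eq: "Poly_Mapping.single j 1 = Poly_Mapping.single i (1::nat) \<longleftrightarrow> i = j" for i
    proof
      assume "Poly_Mapping.single j 1 = Poly_Mapping.single i (1::nat)"
      then have "keys (Poly_Mapping.single j (1::nat)) = keys (Poly_Mapping.single i (1::nat))" by (rule arg_cong)
      then show "i = j" by simp
    qed simp
    show ?thesis unfolding lk eq using j by simp
  qed
  ultimately show ?thesis by (simp add: lead_def)
qed

lemma sym_trace_upper_triangular: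
  assumes B: "B \<in> carrier_mat d d" "upper_triangular B"
  shows "sym_trace d B m = (\<Sum>a\<in>monomials d m. \<Prod>i<d. B $$ (i, i) ^ lookup a i)"
  unfolding sym_trace_def
proof (intro sum.cong refl)
  fix a assume a: "a \<in> monomials d m"
  then have k: "keys a \<subseteq> {..<d}" by (simp add: exps_def)
  have "lead (\<Prod>i\<in>keys a. linear_form d B i ^ lookup a i) (\<Sum>i\<in>keys a. Poly_Mapping.single i (lookup a i))
      (\<Prod>i\<in>keys a. B $$ (i, i) ^ lookup a i)"
    by (intro lead_prod lead_power lead_linear_form[OF B]) (use k in auto)
  also have "(\<Sum>i\<in>keys a. Poly_Mapping.single i (lookup a i)) = a"
    by (rule poly_mapping_eqI) (auto simp: lookup_sum lookup_single when_def in_keys_iff)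
  also have "(\<Prod>i\<in>keys a. B $$ (i, i) ^ lookup a i) = (\<Prod>i<d. B $$ (i, i) ^ lookup a i)"
    by (rule prod.mono_neutral_left) (use k in \<open>auto simp: in_keys_iff\<close>)
  finally show "lookup (sym_act d B (mon a)) a = (\<Prod>i<d. B $$ (i, i) ^ lookup a i)"
    by (simp add: sym_act_eq mon_subst_def lead_def)
qed

section \<open>Generating functions\<close>

text \<open>Let \<open>H\<^sub>d\<close> be the series on the left. Taking one factor \<open>x\<^sub>d\<close> out of the monomials that contain
  it gives \<open>H\<^sub>d\<^sub>+\<^sub>1 = H\<^sub>d + l\<^sub>d q\<^bsup>w\<^sub>d\<^esup> H\<^sub>d\<^sub>+\<^sub>1\<close>.\<close>

lemma exps_generating_function:
  fixes l :: "nat \<Rightarrow> complex"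
  assumes w: "\<And>i. i < d \<Longrightarrow> w i > 0"
  shows "Abs_fps (\<lambda>m. \<Sum>a\<in>exps d w m. \<Prod>i<d. l i ^ lookup a i) *
    (\<Prod>i<d. 1 - fps_const (l i) * fps_X ^ w i) = 1"
  using w
proof (induction d)
  case 0
  have e: "exps 0 w m = (if m = 0 then {0} else {})" for m
    by (auto simp: exps_def wdeg_def)
  show ?case by (rule fps_ext) (simp add: e)
next
  case (Suc d)
  let ?h = "\<lambda>d m. \<Sum>a\<in>exps d w m. \<Prod>i<d. l i ^ lookup a i"
  have wd: "w d > 0" using Suc.prems by simp
  have fin: "finite (exps (Suc d) w m)" for m by (rule finite_exps) (use Suc.prems in simp)
  have rec: "?h (Suc d) m = ?h d m + (if w d \<le> m then l d * ?h (Suc d) (m - w d) else 0)" for m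
  proof -
    \<comment> \<open>Monomials without, and with, the last variable.\<close>
    let ?A = "{a \<in> exps (Suc d) w m. lookup a d = 0}" and ?B = "{a \<in> exps (Suc d) w m. lookup a d \<noteq> 0}"
    let ?s = "Poly_Mapping.single d (1::nat)"
    have "?h (Suc d) m = (\<Sum>a\<in>?A. \<Prod>i<Suc d. l i ^ lookup a i) + (\<Sum>a\<in>?B. \<Prod>i<Suc d. l i ^ lookup a i)"
      by (subst sum.union_disjoint[symmetric]) (use fin in \<open>auto intro!: sum.cong\<close>)
    also have "?A = exps d w m"
      by (auto simp: exps_def lessThan_Suc in_keys_iff subset_iff less_Suc_eq) (metis less_nat_zero_code)
    also have "(\<Sum>a\<in>exps d w m. \<Prod>i<Suc d. l i ^ lookup a i) = ?h d m"
    proof (intro sum.cong refl)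
      fix a assume "a \<in> exps d w m"
      then have "lookup a d = 0" by (auto simp: exps_def in_keys_iff subset_iff)
      then show "(\<Prod>i<Suc d. l i ^ lookup a i) = (\<Prod>i<d. l i ^ lookup a i)" by simp
    qed
    also have "(\<Sum>a\<in>?B. \<Prod>i<Suc d. l i ^ lookup a i) = (if w d \<le> m then l d * ?h (Suc d) (m - w d) else 0)"
    proof (cases "w d \<le> m")
      case True
      have ws: "wdeg w ?s = w d" by (simp add: wdeg_def)
      have "(\<Sum>a\<in>?B. \<Prod>i<Suc d. l i ^ lookup a i) = (\<Sum>a\<in>exps (Suc d) w (m - w d). l d * (\<Prod>i<Suc d. l i ^ lookup a i))"
      proof (rule sum.reindex_bij_witness[where i = "\<lambda>a. ?s + a" and j = "\<lambda>a. a - ?s"])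
        fix a assume a: "a \<in> ?B"
        have cancel: "?s + (a - ?s) = a"
          using a by (intro poly_mapping_eqI) (auto simp: lookup_add lookup_minus lookup_single when_def)
        show "?s + (a - ?s) = a" by (rule cancel)
        have "wdeg w a = w d + wdeg w (a - ?s)" using wdeg_add[of w ?s "a - ?s"] cancel ws by simp
        moreover have "keys (a - ?s) \<subseteq> keys a" by (auto simp: in_keys_iff lookup_minus)
        ultimately show "a - ?s \<in> exps (Suc d) w (m - w d)" using a by (auto simp: exps_def)
        have "(\<Prod>i<Suc d. l i ^ lookup a i) = (\<Prod>i<Suc d. l i ^ lookup (?s + (a - ?s)) i)" unfolding cancel ..
        also have "\<dots> = l d * (\<Prod>i<Suc d. l i ^ lookup (a - ?s) i)"
          by (simp add: lookup_add power_add prod.distrib lookup_single when_def mult_ac)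
        finally show "l d * (\<Prod>i<Suc d. l i ^ lookup (a - ?s) i) = (\<Prod>i<Suc d. l i ^ lookup a i)" by simp
      next
        fix a assume a: "a \<in> exps (Suc d) w (m - w d)"
        show "?s + a - ?s = a" by simp
        have "keys (?s + a) \<subseteq> {..<Suc d}"
          using a Poly_Mapping.keys_add[of ?s a] by (auto simp: exps_def)
        then show "?s + a \<in> ?B" using a True ws by (simp add: exps_def wdeg_add lookup_add)
      qed
      then show ?thesis using True by (simp add: sum_distrib_left)
    next
      case False
      have "?B = {}"
      proof (rule ccontr)
        assume "?B \<noteq> {}"
        then obtain a where a: "a \<in> exps (Suc d) w m" "lookup a d \<noteq> 0" by blast
        have "w d \<le> w d * lookup a d" using a(2) by simp
        also have "\<dots> \<le> (\<Sum>i<Suc d. w i * lookup a i)" by (intro member_le_sum) auto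
        also have "\<dots> = m" using a(1) by (subst wdeg_superset[of "{..<Suc d}", symmetric]) (auto simp: exps_def)
        finally show False using False by simp
      qed
      then show ?thesis using False by (simp only: sum.empty if_False)
    qed
    finally show ?thesis .
  qed
  have "Abs_fps (?h (Suc d)) * (1 - fps_const (l d) * fps_X ^ w d) = Abs_fps (?h d)"
  proof (rule fps_ext)
    fix m
    have "Abs_fps (?h (Suc d)) * (1 - fps_const (l d) * fps_X ^ w d) =
        Abs_fps (?h (Suc d)) - fps_const (l d) * (fps_X ^ w d * Abs_fps (?h (Suc d)))"
      by (simp add: algebra_simps)
    then have "fps_nth (Abs_fps (?h (Suc d)) * (1 - fps_const (l d) * fps_X ^ w d)) m =
        ?h (Suc d) m - (if w d \<le> m then l d * ?h (Suc d) (m - w d) else 0)"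
      by (simp add: fps_X_power_mult_nth)
    then show "fps_nth (Abs_fps (?h (Suc d)) * (1 - fps_const (l d) * fps_X ^ w d)) m = fps_nth (Abs_fps (?h d)) m"
      using rec[of m] by simp
  qed
  then have "Abs_fps (?h (Suc d)) * (\<Prod>i<Suc d. 1 - fps_const (l i) * fps_X ^ w i) =
      Abs_fps (?h d) * (\<Prod>i<d. 1 - fps_const (l i) * fps_X ^ w i)"
    by (simp add: mult_ac)
  then show ?case using Suc by simp
qed

text \<open>The symmetric powers of \<open>A\<close> have the generating function \<open>1 / det(1 - qA)\<close>.\<close>

lemma sym_trace_generating_function:
  assumes A: "A \<in> carrier_mat d d"
  shows "Abs_fps (sym_trace d A) * fps_of_poly (rev_charpoly d A) = 1"
proof -
  obtain B P Q where sim: "similar_mat_wit A B P Q" and B: "B \<in> carrier_mat d d" "upper_triangular B"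
    by (rule triangularize[OF A])
  have "fps_of_poly (\<Prod>i<d. [:1, - B $$ (i, i):]) = (\<Prod>i<d. 1 - fps_const (B $$ (i, i)) * fps_X ^ 1)"
    by (simp add: fps_of_poly_prod fps_of_poly_pCons mult.commute fps_const_neg[symmetric] del: fps_const_neg)
  moreover have "sym_trace d A = (\<lambda>m. \<Sum>a\<in>monomials d m. \<Prod>i<d. B $$ (i, i) ^ lookup a i)"
    by (rule ext) (simp only: sym_trace_similar[OF A sim] sym_trace_upper_triangular[OF B])
  moreover have "rev_charpoly d A = (\<Prod>i<d. [:1, - B $$ (i, i):])"
    by (simp only: rev_charpoly_similar[OF A sim] rev_charpoly_upper_triangular[OF B])
  ultimately show ?thesis
    using exps_generating_function[of d "\<lambda>_. 1" "\<lambda>i. B $$ (i, i)"] by (simp only: zero_less_one)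
qed

section \<open>The module of covariants\<close>

lemma sym_act_simps:
  "sym_act d A 0 = 0" "sym_act d A (p + q) = sym_act d A p + sym_act d A q"
  "sym_act d A (p * q) = sym_act d A p * sym_act d A q" "sym_act d A (poly_const c) = poly_const c"
  "sym_act d A (sum F S) = (\<Sum>x\<in>S. sym_act d A (F x))"
  by (simp_all add: sym_act_eq poly_subst_add poly_subst_mult poly_subst_sum)

lemma covariantD:
  assumes "covariant G d \<rho> r \<sigma> \<phi>"
  shows "v \<in> carrier_vec r \<Longrightarrow> \<phi> v \<in> Sym d"
    "v \<in> carrier_vec r \<Longrightarrow> w \<in> carrier_vec r \<Longrightarrow> \<phi> (v + w) = \<phi> v + \<phi> w"
    "v \<in> carrier_vec r \<Longrightarrow> \<phi> (c \<cdot>\<^sub>v v) = poly_const c * \<phi> v"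
    "g \<in> carrier G \<Longrightarrow> v \<in> carrier_vec r \<Longrightarrow> \<phi> (\<sigma> g *\<^sub>v v) = sym_act d (\<rho> g) (\<phi> v)"
  using assms by (simp_all add: covariant_def)

lemma covariant_coordinates:
  assumes \<phi>: "covariant G d \<rho> r \<sigma> \<phi>" and v: "v \<in> carrier_vec r"
  shows "\<phi> v = (\<Sum>c<r. poly_const (v $ c) * \<phi> (unit_vec r c))"
proof -
  let ?v = "\<lambda>k. vec r (\<lambda>i. if i < k then v $ i else 0)"
  have "k \<le> r \<Longrightarrow> \<phi> (?v k) = (\<Sum>c<k. poly_const (v $ c) * \<phi> (unit_vec r c))" for k
  proof (induction k)
    case 0
    have "?v 0 = 0 \<cdot>\<^sub>v v" using v by (intro eq_vecI) auto
    then show ?case using covariantD(3)[OF \<phi> v, of 0] by (simp add: poly_const_simps)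
  next
    case (Suc k)
    have "?v (Suc k) = ?v k + v $ k \<cdot>\<^sub>v unit_vec r k"
      using Suc.prems by (intro eq_vecI) (auto simp: less_Suc_eq)
    then show ?case using Suc by (simp add: covariantD(2,3)[OF \<phi>])
  qed
  from this[of r] have "\<phi> (?v r) = (\<Sum>c<r. poly_const (v $ c) * \<phi> (unit_vec r c))" by simp
  moreover have "?v r = v" using v by (intro eq_vecI) auto
  ultimately show ?thesis by simp
qed

locale covariant_bases = irreps G n e Rs
  for G :: "('g, 'b) monoid_scheme" (structure) and n e and Rs :: "nat \<Rightarrow> 'g \<Rightarrow> complex mat" +
  fixes R :: "'g \<Rightarrow> complex mat" and d :: nat and \<theta> :: "nat \<Rightarrow> mpoly"
    and \<mu> :: "nat \<Rightarrow> nat" and m :: "nat \<Rightarrow> nat \<Rightarrow> nat" and b :: "nat \<Rightarrow> nat \<Rightarrow> complex vec \<Rightarrow> mpoly"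
  assumes R: "representation G d R" and hsop: "hsop G d R \<theta>"
    and basis: "\<forall>j\<le>n. homogeneous_covariant_basis G d R \<theta> (e j) (Rs j) (\<mu> j) (m j) (b j)"
begin

definition nk :: "nat \<Rightarrow> nat" where
  "nk k = (SOME l. l > 0 \<and> homogeneous l (\<theta> k))"

lemma nk: "k < d \<Longrightarrow> nk k > 0" "k < d \<Longrightarrow> homogeneous (nk k) (\<theta> k)"
proof -
  assume "k < d"
  then have "\<exists>l. l > 0 \<and> homogeneous l (\<theta> k)" using hsop by (auto simp: hsop_def)
  then have "nk k > 0 \<and> homogeneous (nk k) (\<theta> k)" unfolding nk_def by (rule someI_ex)
  then show "nk k > 0" "homogeneous (nk k) (\<theta> k)" by auto
qed

lemma theta_invariant: "k < d \<Longrightarrow> g \<in> carrier G \<Longrightarrow> sym_act d (R g) (\<theta> k) = \<theta> k"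
  and theta_Sym: "k < d \<Longrightarrow> \<theta> k \<in> Sym d"
  and theta_independent: "q \<in> Sym d \<Longrightarrow> poly_subst \<theta> q = 0 \<Longrightarrow> q = 0"
  using hsop by (auto simp: hsop_def invariants_def)

lemma poly_subst_theta_invariant:
  assumes q: "q \<in> Sym d" and g: "g \<in> carrier G"
  shows "sym_act d (R g) (poly_subst \<theta> q) = poly_subst \<theta> q"
  unfolding sym_act_eq poly_subst_poly_subst
  by (rule poly_subst_cong[OF q]) (use theta_invariant[OF _ g] in \<open>simp add: sym_act_eq\<close>)

lemma b_covariant: "j \<le> n \<Longrightarrow> k < \<mu> j \<Longrightarrow> covariant G d R (e j) (Rs j) (b j k)"
  and b_homogeneous: "j \<le> n \<Longrightarrow> k < \<mu> j \<Longrightarrow> v \<in> carrier_vec (e j) \<Longrightarrow> homogeneous (m j k) (b j k v)"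
  and b_basis: "j \<le> n \<Longrightarrow> covariant G d R (e j) (Rs j) \<phi> \<Longrightarrow>
    \<exists>!c. c \<in> {..<\<mu> j} \<rightarrow>\<^sub>E generated_alg d \<theta> \<and> (\<forall>v\<in>carrier_vec (e j). \<phi> v = (\<Sum>k<\<mu> j. c k * b j k v))"
  using basis by (auto simp: homogeneous_covariant_basis_def)

lemma sym_act_R_mult:
  "g \<in> carrier G \<Longrightarrow> h \<in> carrier G \<Longrightarrow> p \<in> Sym d \<Longrightarrow> sym_act d (R (g \<otimes> h)) p = sym_act d (R g) (sym_act d (R h) p)"
  by (simp add: sym_act_sym_act[OF repD(1)[OF R] repD(1)[OF R]] repD(3)[OF R])

lemma sym_act_b:
  assumes j: "j \<le> n" and k: "k < \<mu> j" and g: "g \<in> carrier G" and c: "c < e j"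
  shows "sym_act d (R g) (b j k (unit_vec (e j) c)) =
    (\<Sum>c'<e j. poly_const (Rs j g $$ (c', c)) * b j k (unit_vec (e j) c'))"
proof -
  note A = Rs_carrier[OF j g]
  have "sym_act d (R g) (b j k (unit_vec (e j) c)) = b j k (Rs j g *\<^sub>v unit_vec (e j) c)"
    using covariantD(4)[OF b_covariant[OF j k] g] by simp
  also have "Rs j g *\<^sub>v unit_vec (e j) c = col (Rs j g) c" by (rule mult_unit_vec_eq_col[OF A c])
  also have "b j k (col (Rs j g) c) = (\<Sum>c'<e j. poly_const (col (Rs j g) c $ c') * b j k (unit_vec (e j) c'))"
    by (rule covariant_coordinates[OF b_covariant[OF j k]]) (use A c in auto)
  finally show ?thesis using A c by simp
qed

text \<open>Averaging \<open>p\<close> against the \<open>a\<close>-th row of \<open>R\<^sub>j(g\<^sup>-\<^sup>1)\<close> gives a covariant. The sum over \<open>a\<close> of its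
  values at the basis vectors \<open>v\<^sub>a\<close> is the component of \<open>p\<close> of type \<open>R\<^sub>j\<close>, which is the reason for the
  factor \<open>e\<^sub>j / |G|\<close>.\<close>

definition isotypic :: "nat \<Rightarrow> nat \<Rightarrow> mpoly \<Rightarrow> complex vec \<Rightarrow> mpoly" where
  "isotypic j a p v = poly_const (of_nat (e j) / of_nat N) *
     (\<Sum>g\<in>carrier G. poly_const ((Rs j (inv g) *\<^sub>v v) $ a) * sym_act d (R g) p)"

lemma isotypic_covariant:
  assumes j: "j \<le> n" and a: "a < e j" and p: "p \<in> Sym d"
  shows "covariant G d R (e j) (Rs j) (isotypic j a p)"
  unfolding covariant_def
proof (intro conjI ballI allI)
  have A: "Rs j (inv g) \<in> carrier_mat (e j) (e j)" if "g \<in> carrier G" for g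
    using Rs_carrier[OF j] that by simp
  fix v :: "complex vec" assume v: "v \<in> carrier_vec (e j)"
  show "isotypic j a p v \<in> Sym d"
    unfolding isotypic_def by (intro Sym_mult Sym_const Sym_sum Sym_sym_act p)
  show "isotypic j a p (c \<cdot>\<^sub>v v) = poly_const c * isotypic j a p v" for c
  proof -
    have "(Rs j (inv g) *\<^sub>v (c \<cdot>\<^sub>v v)) $ a = c * (Rs j (inv g) *\<^sub>v v) $ a" if "g \<in> carrier G" for g
      using mult_mat_vec[OF A[OF that] v] a A[OF that] by simp
    then have "(\<Sum>g\<in>carrier G. poly_const ((Rs j (inv g) *\<^sub>v (c \<cdot>\<^sub>v v)) $ a) * sym_act d (R g) p) =
        poly_const c * (\<Sum>g\<in>carrier G. poly_const ((Rs j (inv g) *\<^sub>v v) $ a) * sym_act d (R g) p)"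
      unfolding sum_distrib_left by (intro sum.cong refl) (simp add: poly_const_simps mult.assoc)
    then show ?thesis unfolding isotypic_def by (simp add: mult.left_commute)
  qed
  show "isotypic j a p (v + w) = isotypic j a p v + isotypic j a p w" if w: "w \<in> carrier_vec (e j)" for w
  proof -
    have "(Rs j (inv g) *\<^sub>v (v + w)) $ a = (Rs j (inv g) *\<^sub>v v) $ a + (Rs j (inv g) *\<^sub>v w) $ a"
      if "g \<in> carrier G" for g
      using mult_add_distrib_mat_vec[OF A[OF that] v w] a A[OF that] by simp
    then show ?thesis
      unfolding isotypic_def distrib_left[symmetric] sum.distrib[symmetric]
      by (intro arg_cong2[where f = "(*)"] refl sum.cong) (simp add: poly_const_simps distrib_right)
  qed
  fix h assume h: "h \<in> carrier G"
  have Rh: "Rs j h \<in> carrier_mat (e j) (e j)" by (rule Rs_carrier[OF j h])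
  have "(\<Sum>g\<in>carrier G. poly_const ((Rs j (inv g) *\<^sub>v (Rs j h *\<^sub>v v)) $ a) * sym_act d (R g) p) =
      (\<Sum>g\<in>carrier G. poly_const ((Rs j (inv (h \<otimes> g)) *\<^sub>v (Rs j h *\<^sub>v v)) $ a) * sym_act d (R (h \<otimes> g)) p)"
    by (rule sum_left_translate[OF h, symmetric])
  also have "\<dots> = (\<Sum>g\<in>carrier G. sym_act d (R h) (poly_const ((Rs j (inv g) *\<^sub>v v) $ a) * sym_act d (R g) p))"
  proof (intro sum.cong refl)
    fix g assume g: "g \<in> carrier G"
    have "Rs j (inv (h \<otimes> g)) * Rs j h = Rs j (inv g)"
      using g h by (simp add: Rs_mult[OF j, symmetric] inv_mult_group m_assoc)
    then have "Rs j (inv (h \<otimes> g)) *\<^sub>v (Rs j h *\<^sub>v v) = Rs j (inv g) *\<^sub>v v"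
      using assoc_mult_mat_vec[OF A[of "h \<otimes> g"] Rh v] g h by simp
    then show "poly_const ((Rs j (inv (h \<otimes> g)) *\<^sub>v (Rs j h *\<^sub>v v)) $ a) * sym_act d (R (h \<otimes> g)) p =
        sym_act d (R h) (poly_const ((Rs j (inv g) *\<^sub>v v) $ a) * sym_act d (R g) p)"
      by (simp add: sym_act_simps sym_act_R_mult[OF h g p])
  qed
  finally show "isotypic j a p (Rs j h *\<^sub>v v) = sym_act d (R h) (isotypic j a p v)"
    unfolding isotypic_def sym_act_simps by simp
qed

lemma isotypic_decomposition:
  assumes p: "p \<in> Sym d"
  shows "p = (\<Sum>j\<le>n. \<Sum>a<e j. isotypic j a p (unit_vec (e j) a))"
proof -
  have inner: "(\<Sum>a<e j. isotypic j a p (unit_vec (e j) a)) =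
      (\<Sum>g\<in>carrier G. poly_const (of_nat (e j) * \<chi> j (inv g) / of_nat N) * sym_act d (R g) p)" if j: "j \<le> n" for j
  proof -
    have entry: "(Rs j (inv g) *\<^sub>v unit_vec (e j) a) $ a = Rs j (inv g) $$ (a, a)"
      if "g \<in> carrier G" "a < e j" for g a
      using mult_unit_vec_eq_col[of "Rs j (inv g)" "e j" "e j" a] Rs_carrier[OF j, of "inv g"] that by simp
    have "(\<Sum>a<e j. isotypic j a p (unit_vec (e j) a)) = (\<Sum>a<e j. \<Sum>g\<in>carrier G.
        poly_const (of_nat (e j) / of_nat N * Rs j (inv g) $$ (a, a)) * sym_act d (R g) p)"
      unfolding isotypic_def sum_distrib_left
      by (intro sum.cong refl) (simp only: lessThan_iff entry poly_const_simps mult.assoc)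
    also have "\<dots> = (\<Sum>g\<in>carrier G. \<Sum>a<e j. poly_const (of_nat (e j) / of_nat N * Rs j (inv g) $$ (a, a)) * sym_act d (R g) p)"
      by (rule sum.swap)
    also have "\<dots> = (\<Sum>g\<in>carrier G. poly_const (of_nat (e j) * \<chi> j (inv g) / of_nat N) * sym_act d (R g) p)"
    proof (intro sum.cong refl)
      fix g assume g: "g \<in> carrier G"
      have "of_nat (e j) * \<chi> j (inv g) / of_nat N = (\<Sum>a<e j. of_nat (e j) / of_nat N * Rs j (inv g) $$ (a, a))"
        using g by (simp add: character_rep[OF Rs_rep[OF j]] sum_distrib_left sum_divide_distrib)
      then show "(\<Sum>a<e j. poly_const (of_nat (e j) / of_nat N * Rs j (inv g) $$ (a, a)) * sym_act d (R g) p) =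
          poly_const (of_nat (e j) * \<chi> j (inv g) / of_nat N) * sym_act d (R g) p"
        by (simp only: poly_const_sum sum_distrib_right)
    qed
    finally show ?thesis .
  qed
  have "(\<Sum>j\<le>n. \<Sum>a<e j. isotypic j a p (unit_vec (e j) a)) =
      (\<Sum>j\<le>n. \<Sum>g\<in>carrier G. poly_const (of_nat (e j) * \<chi> j (inv g) / of_nat N) * sym_act d (R g) p)"
    by (intro sum.cong refl) (simp add: inner)
  also have "\<dots> = (\<Sum>g\<in>carrier G. \<Sum>j\<le>n. poly_const (of_nat (e j) * \<chi> j (inv g) / of_nat N) * sym_act d (R g) p)"
    by (rule sum.swap)
  also have "\<dots> = (\<Sum>g\<in>carrier G. if g = \<one> then p else 0)"
  proof (intro sum.cong refl)
    fix g assume g: "g \<in> carrier G"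
    have "(\<Sum>j\<le>n. poly_const (of_nat (e j) * \<chi> j (inv g) / of_nat N) * sym_act d (R g) p) =
        poly_const ((\<Sum>j\<le>n. of_nat (e j) * \<chi> j (inv g)) / of_nat N) * sym_act d (R g) p"
      by (simp only: poly_const_sum sum_distrib_right sum_divide_distrib)
    also have "\<dots> = poly_const (if g = \<one> then 1 else 0) * sym_act d (R g) p"
      using regular_character[of "inv g"] g N_pos by simp
    finally show "(\<Sum>j\<le>n. poly_const (of_nat (e j) * \<chi> j (inv g) / of_nat N) * sym_act d (R g) p) = (if g = \<one> then p else 0)"
      using p by (simp add: poly_const_simps repD(2)[OF R] sym_act_one)
  qed
  also have "\<dots> = p" using fin by simp
  finally show ?thesis by simp
qed

text \<open>The next two lemmas say that the polynomials \<open>b\<^sub>j\<^sub>k(v\<^sub>c)\<close>, where \<open>v\<^sub>0, v\<^sub>1, \<dots>\<close> is the standard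
  basis of \<open>R\<^sub>j\<close>, form a basis of \<open>Sym d\<close> over the algebra generated by the \<open>\<theta>\<^sub>i\<close>. They span because
  each isotypic component consists of values of covariants.\<close>

lemma covariant_values_span:
  assumes p: "p \<in> Sym d"
  shows "\<exists>q. (\<forall>j k c. q j k c \<in> Sym d) \<and>
    p = (\<Sum>j\<le>n. \<Sum>k<\<mu> j. \<Sum>c<e j. poly_subst \<theta> (q j k c) * b j k (unit_vec (e j) c))"
proof -
  have ex: "\<exists>q. (\<forall>k. q k \<in> Sym d) \<and> isotypic j c p (unit_vec (e j) c) = (\<Sum>k<\<mu> j. poly_subst \<theta> (q k) * b j k (unit_vec (e j) c))"
    if j: "j \<le> n" and c: "c < e j" for j c
  proof -
    obtain C where C: "C \<in> {..<\<mu> j} \<rightarrow>\<^sub>E generated_alg d \<theta>"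
      "\<forall>v\<in>carrier_vec (e j). isotypic j c p v = (\<Sum>k<\<mu> j. C k * b j k v)"
      using ex1_implies_ex[OF b_basis[OF j isotypic_covariant[OF j c p]]] by (elim exE conjE)
    have "\<forall>k. \<exists>q. q \<in> Sym d \<and> (k < \<mu> j \<longrightarrow> C k = poly_subst \<theta> q)"
    proof
      fix k
      show "\<exists>q. q \<in> Sym d \<and> (k < \<mu> j \<longrightarrow> C k = poly_subst \<theta> q)"
      proof (cases "k < \<mu> j")
        case True
        then have "C k \<in> poly_subst \<theta> ` Sym d" using PiE_mem[OF C(1), of k] by (simp add: generated_alg_def)
        then show ?thesis by (elim imageE) auto
      qed (auto intro: Sym_zero)
    qed
    then obtain q where q: "\<forall>k. q k \<in> Sym d \<and> (k < \<mu> j \<longrightarrow> C k = poly_subst \<theta> (q k))"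
      by (rule choice[THEN exE])
    have "isotypic j c p (unit_vec (e j) c) = (\<Sum>k<\<mu> j. C k * b j k (unit_vec (e j) c))" using C(2) by simp
    also have "\<dots> = (\<Sum>k<\<mu> j. poly_subst \<theta> (q k) * b j k (unit_vec (e j) c))"
      using q by (intro sum.cong refl) simp
    finally show ?thesis using q by (intro exI[of _ q]) simp
  qed
  have "\<forall>j c. \<exists>q. (\<forall>k. q k \<in> Sym d) \<and> (j \<le> n \<and> c < e j \<longrightarrow>
      isotypic j c p (unit_vec (e j) c) = (\<Sum>k<\<mu> j. poly_subst \<theta> (q k) * b j k (unit_vec (e j) c)))"
  proof (intro allI)
    fix j c
    show "\<exists>q. (\<forall>k. q k \<in> Sym d) \<and> (j \<le> n \<and> c < e j \<longrightarrow>
      isotypic j c p (unit_vec (e j) c) = (\<Sum>k<\<mu> j. poly_subst \<theta> (q k) * b j k (unit_vec (e j) c)))"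
    proof (cases "j \<le> n \<and> c < e j")
      case True
      then show ?thesis using ex[of j c] by simp
    next
      case False
      then show ?thesis by (intro exI[of _ "\<lambda>_. 0"]) (simp only: Sym_zero simp_thms)
    qed
  qed
  then obtain q where q: "\<forall>j c. (\<forall>k. q j c k \<in> Sym d) \<and> (j \<le> n \<and> c < e j \<longrightarrow>
      isotypic j c p (unit_vec (e j) c) = (\<Sum>k<\<mu> j. poly_subst \<theta> (q j c k) * b j k (unit_vec (e j) c)))"
    unfolding choice_iff by (elim exE)
  have "p = (\<Sum>j\<le>n. \<Sum>c<e j. isotypic j c p (unit_vec (e j) c))" by (rule isotypic_decomposition[OF p])
  also have "\<dots> = (\<Sum>j\<le>n. \<Sum>c<e j. \<Sum>k<\<mu> j. poly_subst \<theta> (q j c k) * b j k (unit_vec (e j) c))"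
    using q by (intro sum.cong refl) simp
  also have "\<dots> = (\<Sum>j\<le>n. \<Sum>k<\<mu> j. \<Sum>c<e j. poly_subst \<theta> (q j c k) * b j k (unit_vec (e j) c))"
    by (intro sum.cong refl sum.swap)
  finally show ?thesis using q by (intro exI[of _ "\<lambda>j k c. q j c k"] conjI allI) simp_all
qed

text \<open>Averaging the relation against the \<open>(a, s)\<close> entry of \<open>R\<^sub>i(g\<^sup>-\<^sup>1)\<close> isolates the terms with \<open>j = i\<close>
  and \<open>c = a\<close> and moves the argument of \<open>b\<^sub>i\<^sub>k\<close> to \<open>v\<^sub>s\<close>. As \<open>s\<close> is arbitrary, this is a relation between
  the covariants \<open>b\<^sub>i\<^sub>k\<close> themselves, whose coefficients vanish by freeness.\<close>

lemma covariant_values_independent: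
  assumes q: "\<And>j k c. q j k c \<in> Sym d"
    and zero: "(\<Sum>j\<le>n. \<Sum>k<\<mu> j. \<Sum>c<e j. poly_subst \<theta> (q j k c) * b j k (unit_vec (e j) c)) = 0"
    and i: "i \<le> n" and l: "l < \<mu> i" and a: "a < e i"
  shows "q i l a = 0"
proof -
  let ?u = "\<lambda>j c. unit_vec (e j) c"
  define C where "C j k c = poly_subst \<theta> (q j k c)" for j k c
  have unit: "(\<Sum>k<\<mu> i. C i k a * b i k (?u i s)) = 0" if s: "s < e i" for s
  proof -
    \<comment> \<open>The weights of the average that isolates \<open>c = a\<close> and \<open>c' = s\<close> by orthogonality.\<close>
    define w where "w g = Rs i (inv g) $$ (a, s)" for g
    let ?X = "\<lambda>g j k c c'. poly_const (Rs j g $$ (c', c) * w g) * (C j k c * b j k (?u j c'))"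
    let ?Y = "\<lambda>k. poly_const (of_nat N / of_nat (e i)) * (C i k a * b i k (?u i s))"
    have "0 = (\<Sum>g\<in>carrier G. poly_const (w g) * sym_act d (R g) (\<Sum>j\<le>n. \<Sum>k<\<mu> j. \<Sum>c<e j. C j k c * b j k (?u j c)))"
      unfolding C_def zero by (simp add: sym_act_simps)
    also have "\<dots> = (\<Sum>g\<in>carrier G. \<Sum>j\<le>n. \<Sum>k<\<mu> j. \<Sum>c<e j. \<Sum>c'<e j.
        ?X g j k c c')"
      unfolding sym_act_simps sum_distrib_left
    proof (intro sum.cong refl)
      fix g j k c assume gjkc: "g \<in> carrier G" "j \<in> {..n}" "k \<in> {..<\<mu> j}" "c \<in> {..<e j}"
      have "sym_act d (R g) (C j k c) = C j k c" unfolding C_def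
        by (rule poly_subst_theta_invariant[OF q gjkc(1)])
      then show "poly_const (w g) * (sym_act d (R g) (C j k c) * sym_act d (R g) (b j k (?u j c))) =
          (\<Sum>c'<e j. ?X g j k c c')"
        using gjkc by (simp add: sym_act_b sum_distrib_left poly_const_simps mult_ac)
    qed
    also have "\<dots> = (\<Sum>j\<le>n. \<Sum>g\<in>carrier G. \<Sum>k<\<mu> j. \<Sum>c<e j. \<Sum>c'<e j.
        ?X g j k c c')"
      by (rule sum.swap)
    also have "\<dots> = (\<Sum>j\<le>n. \<Sum>k<\<mu> j. \<Sum>g\<in>carrier G. \<Sum>c<e j. \<Sum>c'<e j.
        ?X g j k c c')"
      by (intro sum.cong refl sum.swap)
    also have "\<dots> = (\<Sum>j\<le>n. \<Sum>k<\<mu> j. \<Sum>c<e j. \<Sum>g\<in>carrier G. \<Sum>c'<e j.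
        ?X g j k c c')"
      by (intro sum.cong refl sum.swap)
    also have "\<dots> = (\<Sum>j\<le>n. \<Sum>k<\<mu> j. \<Sum>c<e j. \<Sum>c'<e j. \<Sum>g\<in>carrier G.
        ?X g j k c c')"
      by (intro sum.cong refl sum.swap)
    also have "\<dots> = (\<Sum>j\<le>n. \<Sum>k<\<mu> j. \<Sum>c<e j. \<Sum>c'<e j.
        if j = i \<and> c = a \<and> c' = s then ?Y k else 0)"
    proof (intro sum.cong refl)
      fix j k c c' assume jkc: "j \<in> {..n}" "k \<in> {..<\<mu> j}" "c \<in> {..<e j}" "c' \<in> {..<e j}"
      have "(\<Sum>g\<in>carrier G. ?X g j k c c') =
          poly_const (\<Sum>g\<in>carrier G. Rs j g $$ (c', c) * w g) * (C j k c * b j k (?u j c'))"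
        by (simp only: poly_const_sum sum_distrib_right)
      also have "(\<Sum>g\<in>carrier G. Rs j g $$ (c', c) * w g) =
          (if j = i \<and> c = a \<and> c' = s then of_nat N / of_nat (e i) else 0)"
        unfolding w_def by (rule matrix_coefficient_orthogonality) (use jkc i a s in auto)
      finally show "(\<Sum>g\<in>carrier G. ?X g j k c c') =
          (if j = i \<and> c = a \<and> c' = s then ?Y k else 0)"
        by (auto simp: poly_const_simps)
    qed
    also have "\<dots> = (\<Sum>j\<le>n. if j = i then \<Sum>k<\<mu> i. ?Y k else 0)"
    proof (rule sum.cong[OF refl])
      fix j assume "j \<in> {..n}"
      show "(\<Sum>k<\<mu> j. \<Sum>c<e j. \<Sum>c'<e j. if j = i \<and> c = a \<and> c' = s then
          ?Y k else 0) =
        (if j = i then \<Sum>k<\<mu> i. ?Y k else 0)"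
      proof (cases "j = i")
        case True
        have "(\<Sum>c<e i. \<Sum>c'<e i. if c = a \<and> c' = s then X else 0) = X" for X :: mpoly
        proof -
          have "(\<Sum>c<e i. \<Sum>c'<e i. if c = a \<and> c' = s then X else 0) = (\<Sum>c<e i. if c = a then X else 0)"
            using s by (intro sum.cong refl) simp
          then show ?thesis using a by simp
        qed
        then show ?thesis using True by simp
      qed simp
    qed
    also have "\<dots> = poly_const (of_nat N / of_nat (e i)) * (\<Sum>k<\<mu> i. C i k a * b i k (?u i s))"
      using i by (simp add: sum_distrib_left)
    finally have "poly_const (of_nat (e i) / of_nat N) * (poly_const (of_nat N / of_nat (e i)) * (\<Sum>k<\<mu> i. C i k a * b i k (?u i s))) = 0"
      by simp
    moreover have "poly_const (of_nat (e i) / of_nat N) * poly_const (of_nat N / of_nat (e i)) = 1"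
      using e_pos[OF i] N_pos by (simp add: poly_const_simps(4)[symmetric] poly_const_simps(2))
    ultimately show ?thesis by (simp add: mult.assoc[symmetric])
  qed
  have vanish: "(\<Sum>k<\<mu> i. C i k a * b i k v) = 0" if v: "v \<in> carrier_vec (e i)" for v
  proof -
    have "(\<Sum>k<\<mu> i. C i k a * b i k v) = (\<Sum>k<\<mu> i. \<Sum>s<e i. poly_const (v $ s) * (C i k a * b i k (?u i s)))"
      by (intro sum.cong refl)
        (simp add: covariant_coordinates[OF b_covariant[OF i] v] sum_distrib_left mult.left_commute)
    also have "\<dots> = (\<Sum>s<e i. poly_const (v $ s) * (\<Sum>k<\<mu> i. C i k a * b i k (?u i s)))"
      by (subst sum.swap) (simp add: sum_distrib_left)
    finally show ?thesis by (simp add: unit)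
  qed
  have cov0: "covariant G d R (e i) (Rs i) (\<lambda>_. 0)"
    by (simp add: covariant_def sym_act_simps)
  have gen: "C i k a \<in> generated_alg d \<theta>" for k
    unfolding C_def generated_alg_def by (rule imageI[OF q])
  have "poly_subst \<theta> 0 \<in> generated_alg d \<theta>" unfolding generated_alg_def by (rule imageI) simp
  then have "(\<lambda>k\<in>{..<\<mu> i}. 0) \<in> {..<\<mu> i} \<rightarrow>\<^sub>E generated_alg d \<theta>" by simp
  moreover have "(\<lambda>k\<in>{..<\<mu> i}. C i k a) \<in> {..<\<mu> i} \<rightarrow>\<^sub>E generated_alg d \<theta>" using gen by simp
  moreover have "\<forall>v\<in>carrier_vec (e i). 0 = (\<Sum>k<\<mu> i. (\<lambda>k\<in>{..<\<mu> i}. C i k a) k * b i k v)"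
    using vanish by simp
  moreover have "\<forall>v\<in>carrier_vec (e i). 0 = (\<Sum>k<\<mu> i. (\<lambda>k\<in>{..<\<mu> i}. 0) k * b i k v)" by simp
  moreover obtain c0 where "\<forall>c. c \<in> {..<\<mu> i} \<rightarrow>\<^sub>E generated_alg d \<theta> \<and>
      (\<forall>v\<in>carrier_vec (e i). 0 = (\<Sum>k<\<mu> i. c k * b i k v)) \<longrightarrow> c = c0"
    using b_basis[OF i cov0] by (elim ex1E)
  ultimately have "(\<lambda>k\<in>{..<\<mu> i}. C i k a) = c0" "(\<lambda>k\<in>{..<\<mu> i}. 0) = c0" by simp_all
  then have "(\<lambda>k\<in>{..<\<mu> i}. C i k a) = (\<lambda>k\<in>{..<\<mu> i}. 0)" by simp
  from fun_cong[OF this, of l] have "C i l a = 0" using l by simp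
  then show ?thesis unfolding C_def by (rule theta_independent[OF q])
qed

end

lemma sum_Sigma:
  assumes "finite A" "\<And>x. x \<in> A \<Longrightarrow> finite (B x)"
  shows "sum F (Sigma A B) = (\<Sum>x\<in>A. \<Sum>y\<in>B x. F (x, y))"
  using sum.Sigma[of A B "\<lambda>x y. F (x, y)"] assms by (simp add: split_def)

context covariant_bases begin

text \<open>The products of a monomial in the \<open>\<theta>\<^sub>i\<close> with some \<open>b\<^sub>j\<^sub>k(v\<^sub>c)\<close> form a homogeneous basis of
  \<open>Sym d\<close> over the complex numbers. Those of degree \<open>M\<close> are indexed by \<open>basis_index M\<close>, where
  \<open>basis_exps M j k\<close> contains the exponents of the \<open>\<theta>\<close>-monomials that raise \<open>b\<^sub>j\<^sub>k\<close> to degree \<open>M\<close>.\<close>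

definition basis_exps :: "nat \<Rightarrow> nat \<Rightarrow> nat \<Rightarrow> (nat \<Rightarrow>\<^sub>0 nat) set" where
  "basis_exps M j k = (if m j k \<le> M then exps d nk (M - m j k) else {})"

definition basis_index :: "nat \<Rightarrow> (nat \<times> nat \<times> nat \<times> (nat \<Rightarrow>\<^sub>0 nat)) set" where
  "basis_index M = (SIGMA j:{..n}. SIGMA k:{..<\<mu> j}. SIGMA c:{..<e j}. basis_exps M j k)"

definition basis_poly :: "nat \<times> nat \<times> nat \<times> (nat \<Rightarrow>\<^sub>0 nat) \<Rightarrow> mpoly" where
  "basis_poly = (\<lambda>(j, k, c, \<alpha>). mon_subst \<theta> \<alpha> * b j k (unit_vec (e j) c))"

lemma basis_exps_iff: "\<alpha> \<in> basis_exps M j k \<longleftrightarrow> keys \<alpha> \<subseteq> {..<d} \<and> wdeg nk \<alpha> + m j k = M"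
  by (auto simp: basis_exps_def exps_def)

lemma finite_basis_exps: "finite (basis_exps M j k)"
  using nk by (auto simp: basis_exps_def intro!: finite_exps)

lemma finite_basis_index: "finite (basis_index M)"
  unfolding basis_index_def by (intro finite_SigmaI finite_basis_exps) auto

lemma sum_basis_index:
  fixes F :: "nat \<times> nat \<times> nat \<times> (nat \<Rightarrow>\<^sub>0 nat) \<Rightarrow> 'c::comm_monoid_add"
  shows "sum F (basis_index M) = (\<Sum>j\<le>n. \<Sum>k<\<mu> j. \<Sum>c<e j. \<Sum>\<alpha>\<in>basis_exps M j k. F (j, k, c, \<alpha>))"
proof -
  note fin = finite_basis_exps finite_lessThan finite_atMost
  show ?thesis
    unfolding basis_index_def
    by (subst sum_Sigma, (intro finite_SigmaI fin)+, intro sum.cong refl,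
        subst sum_Sigma, (intro finite_SigmaI fin)+, intro sum.cong refl,
        subst sum_Sigma, (intro finite_SigmaI fin)+, rule refl)
qed

lemma basis_poly_properties:
  assumes j: "j \<le> n" and k: "k < \<mu> j" and c: "c < e j" and \<alpha>: "keys \<alpha> \<subseteq> {..<d}"
  shows "basis_poly (j, k, c, \<alpha>) \<in> Sym d" "homogeneous (wdeg nk \<alpha> + m j k) (basis_poly (j, k, c, \<alpha>))"
proof -
  have "mon_subst \<theta> \<alpha> \<in> Sym d"
    unfolding mon_subst_def using \<alpha> by (intro Sym_prod Sym_power theta_Sym) auto
  moreover have "homogeneous (wdeg nk \<alpha>) (mon_subst \<theta> \<alpha>)"
    using \<alpha> by (intro homogeneous_mon_subst nk) auto
  ultimately show "basis_poly (j, k, c, \<alpha>) \<in> Sym d" "homogeneous (wdeg nk \<alpha> + m j k) (basis_poly (j, k, c, \<alpha>))"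
    using covariantD(1)[OF b_covariant[OF j k]] b_homogeneous[OF j k]
    by (simp_all add: basis_poly_def Sym_mult homogeneous_mult)
qed

lemma basis_poly_span:
  assumes a: "a \<in> monomials d M"
  shows "\<exists>Q. mon a = (\<Sum>t\<in>basis_index M. poly_const (Q t) * basis_poly t)"
proof -
  have ak: "keys a \<subseteq> {..<d}" and adeg: "tdeg a = M" using a by (simp_all add: exps_def tdeg_eq_wdeg)
  have aS: "mon a \<in> Sym d" unfolding Sym_mon by (rule ak)
  have ah: "homogeneous M (mon a)" using homogeneous_mon[of a] unfolding adeg .
  obtain q where q: "\<forall>j k c. q j k c \<in> Sym d"
    and eq: "mon a = (\<Sum>j\<le>n. \<Sum>k<\<mu> j. \<Sum>c<e j. poly_subst \<theta> (q j k c) * b j k (unit_vec (e j) c))"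
    using covariant_values_span[OF aS] by (elim exE conjE)
  have "hcomp M (poly_subst \<theta> (q j k c) * b j k (unit_vec (e j) c)) =
      (\<Sum>\<alpha>\<in>basis_exps M j k. poly_const (lookup (q j k c) \<alpha>) * basis_poly (j, k, c, \<alpha>))"
    if jkc: "j \<le> n" "k < \<mu> j" "c < e j" for j k c
  proof -
    have k: "keys \<alpha> \<subseteq> {..<d}" if "\<alpha> \<in> keys (q j k c)" for \<alpha>
      using q that by (auto simp: Sym_def)
    have expand: "poly_subst \<theta> (q j k c) * b j k (unit_vec (e j) c) =
        (\<Sum>\<alpha>\<in>keys (q j k c). poly_const (lookup (q j k c) \<alpha>) * basis_poly (j, k, c, \<alpha>))"
      by (simp add: poly_subst_superset[of "keys (q j k c)"] basis_poly_def sum_distrib_right mult.assoc)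
    have "hcomp M (poly_subst \<theta> (q j k c) * b j k (unit_vec (e j) c)) =
        (\<Sum>\<alpha>\<in>keys (q j k c). hcomp M (poly_const (lookup (q j k c) \<alpha>) * basis_poly (j, k, c, \<alpha>)))"
      unfolding expand by (rule hcomp_sum)
    also have "\<dots> = (\<Sum>\<alpha>\<in>keys (q j k c). if \<alpha> \<in> basis_exps M j k
        then poly_const (lookup (q j k c) \<alpha>) * basis_poly (j, k, c, \<alpha>) else 0)"
    proof (rule sum.cong[OF refl])
      fix \<alpha> assume \<alpha>: "\<alpha> \<in> keys (q j k c)"
      have "homogeneous (wdeg nk \<alpha> + m j k) (poly_const (lookup (q j k c) \<alpha>) * basis_poly (j, k, c, \<alpha>))"
        by (rule homogeneous_const_mult[OF basis_poly_properties(2)[OF jkc k[OF \<alpha>]]])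
      from hcomp_homogeneous[OF this, of M]
      show "hcomp M (poly_const (lookup (q j k c) \<alpha>) * basis_poly (j, k, c, \<alpha>)) =
          (if \<alpha> \<in> basis_exps M j k then poly_const (lookup (q j k c) \<alpha>) * basis_poly (j, k, c, \<alpha>) else 0)"
        using k[OF \<alpha>] by (cases "wdeg nk \<alpha> + m j k = M") (simp_all add: basis_exps_iff)
    qed
    also have "\<dots> = (\<Sum>\<alpha>\<in>keys (q j k c) \<inter> basis_exps M j k. poly_const (lookup (q j k c) \<alpha>) * basis_poly (j, k, c, \<alpha>))"
      by (simp add: sum.inter_restrict[symmetric])
    also have "\<dots> = (\<Sum>\<alpha>\<in>basis_exps M j k. poly_const (lookup (q j k c) \<alpha>) * basis_poly (j, k, c, \<alpha>))"
      by (rule sum.mono_neutral_left) (auto simp: finite_basis_exps in_keys_iff poly_const_simps)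
    finally show ?thesis .
  qed
  then have "hcomp M (mon a) = (\<Sum>j\<le>n. \<Sum>k<\<mu> j. \<Sum>c<e j. \<Sum>\<alpha>\<in>basis_exps M j k.
      poly_const (lookup (q j k c) \<alpha>) * basis_poly (j, k, c, \<alpha>))"
    unfolding eq hcomp_sum by (intro sum.cong refl) simp
  moreover define Q where "Q = (\<lambda>(j, k, c, \<alpha>). lookup (q j k c) \<alpha>)"
  ultimately have "mon a = (\<Sum>t\<in>basis_index M. poly_const (Q t) * basis_poly t)"
    using hcomp_homogeneous[OF ah, of M] by (simp add: sum_basis_index)
  then show ?thesis by (intro exI[of _ Q])
qed

lemma basis_poly_independent:
  assumes zero: "(\<Sum>t\<in>basis_index M. poly_const (z t) * basis_poly t) = 0" and t: "t \<in> basis_index M"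
  shows "z t = 0"
proof -
  define q where "q j k c = (\<Sum>\<alpha>\<in>basis_exps M j k. poly_const (z (j, k, c, \<alpha>)) * mon \<alpha>)" for j k c
  have q: "q j k c \<in> Sym d" for j k c
    unfolding q_def by (intro Sym_sum Sym_mult Sym_const) (simp add: Sym_mon basis_exps_iff)
  have "(\<Sum>j\<le>n. \<Sum>k<\<mu> j. \<Sum>c<e j. poly_subst \<theta> (q j k c) * b j k (unit_vec (e j) c)) =
      (\<Sum>t\<in>basis_index M. poly_const (z t) * basis_poly t)"
    unfolding sum_basis_index
    by (intro sum.cong refl)
      (simp add: q_def poly_subst_sum poly_subst_const_mult basis_poly_def sum_distrib_right mult.assoc)
  then have zero': "(\<Sum>j\<le>n. \<Sum>k<\<mu> j. \<Sum>c<e j. poly_subst \<theta> (q j k c) * b j k (unit_vec (e j) c)) = 0"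
    using zero by simp
  obtain j k c \<alpha> where t': "t = (j, k, c, \<alpha>)" "j \<le> n" "k < \<mu> j" "c < e j" "\<alpha> \<in> basis_exps M j k"
    using t by (auto simp: basis_index_def)
  have "q j k c = 0" by (rule covariant_values_independent[OF q zero' t'(2-4)])
  then have "0 = lookup (q j k c) \<alpha>" by simp
  also have "\<dots> = (\<Sum>\<beta>\<in>basis_exps M j k. if \<beta> = \<alpha> then z (j, k, c, \<alpha>) else 0)"
    unfolding q_def lookup_sum by (intro sum.cong) (auto simp: lookup_mon)
  also have "\<dots> = z t" using t' by (simp add: finite_basis_exps)
  finally show ?thesis by simp
qed

text \<open>In the basis above \<open>g\<close> acts on the factors \<open>b\<^sub>j\<^sub>k(v\<^sub>c)\<close> by the matrix \<open>R\<^sub>j(g)\<close> and fixes the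
  invariant factors.\<close>

lemma sym_trace_R:
  assumes g: "g \<in> carrier G"
  shows "sym_trace d (R g) M = (\<Sum>j\<le>n. \<Sum>k<\<mu> j. \<chi> j g * of_nat (card (basis_exps M j k)))"
proof -
  have "\<forall>a. \<exists>Q. a \<in> monomials d M \<longrightarrow> mon a = (\<Sum>t\<in>basis_index M. poly_const (Q t) * basis_poly t)"
  proof
    fix a
    show "\<exists>Q. a \<in> monomials d M \<longrightarrow> mon a = (\<Sum>t\<in>basis_index M. poly_const (Q t) * basis_poly t)"
    proof (cases "a \<in> monomials d M")
      case True
      from basis_poly_span[OF this] show ?thesis by (simp only: True simp_thms)
    qed simp
  qed
  then obtain Q where Q: "\<forall>a. a \<in> monomials d M \<longrightarrow> mon a = (\<Sum>t\<in>basis_index M. poly_const (Q a t) * basis_poly t)"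
    by (rule choice[THEN exE])
  define F :: "nat \<times> nat \<times> nat \<times> (nat \<Rightarrow>\<^sub>0 nat) \<Rightarrow> nat \<times> nat \<times> nat \<times> (nat \<Rightarrow>\<^sub>0 nat) \<Rightarrow> complex"
    where "F = (\<lambda>(j', k', c', \<alpha>') (j, k, c, \<alpha>).
    if j' = j \<and> k' = k \<and> \<alpha>' = \<alpha> then Rs j g $$ (c', c) else 0)"
  have "sym_trace d (R g) M = (\<Sum>a\<in>monomials d M. lookup (poly_subst (linear_form d (R g)) (mon a)) a)"
    by (simp add: sym_trace_def sym_act_eq)
  also have "\<dots> = (\<Sum>t\<in>basis_index M. F t t)"
  proof (rule trace_change_of_basis[where f = basis_poly and Q = "\<lambda>t a. Q a t" and F = F, OF finite_basis_index finite_monomials])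
    show "mon a = (\<Sum>t\<in>basis_index M. poly_const (Q a t) * basis_poly t)" if "a \<in> monomials d M" for a
      using Q that by blast
    show "keys (poly_subst (linear_form d (R g)) (mon a)) \<subseteq> monomials d M" if "a \<in> monomials d M" for a
      using keys_sym_act_mon[OF that, of "R g"] by (simp only: sym_act_eq)
    fix t assume t: "t \<in> basis_index M"
    obtain j k c \<alpha> where t': "t = (j, k, c, \<alpha>)" and jkc: "j \<le> n" "k < \<mu> j" "c < e j" and \<alpha>: "\<alpha> \<in> basis_exps M j k"
      using t by (auto simp: basis_index_def)
    have \<alpha>': "keys \<alpha> \<subseteq> {..<d}" "wdeg nk \<alpha> + m j k = M" using \<alpha> by (simp_all add: basis_exps_iff)
    show "keys (basis_poly t) \<subseteq> monomials d M"
      using basis_poly_properties[OF jkc \<alpha>'(1)] unfolding t' \<alpha>'(2) by (rule keys_subset_monomials)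
    have inv: "sym_act d (R g) (mon_subst \<theta> \<alpha>) = mon_subst \<theta> \<alpha>"
      using poly_subst_theta_invariant[of "mon \<alpha>" g] g \<alpha>'(1) by (simp add: Sym_mon)
    have "poly_subst (linear_form d (R g)) (basis_poly t) = sym_act d (R g) (mon_subst \<theta> \<alpha> * b j k (unit_vec (e j) c))"
      by (simp add: t' basis_poly_def sym_act_eq)
    also have "\<dots> = (\<Sum>c'<e j. poly_const (Rs j g $$ (c', c)) * basis_poly (j, k, c', \<alpha>))"
      by (simp add: sym_act_simps inv sym_act_b[OF jkc(1,2) g jkc(3)] basis_poly_def sum_distrib_left mult.left_commute)
    also have "\<dots> = (\<Sum>s\<in>(\<lambda>c'. (j, k, c', \<alpha>)) ` {..<e j}. poly_const (F s t) * basis_poly s)"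
      by (subst sum.reindex) (auto simp: inj_on_def F_def t')
    also have "\<dots> = (\<Sum>s\<in>basis_index M. poly_const (F s t) * basis_poly s)"
    proof (rule sum.mono_neutral_left[OF finite_basis_index])
      show "(\<lambda>c'. (j, k, c', \<alpha>)) ` {..<e j} \<subseteq> basis_index M"
        using jkc \<alpha> by (auto simp: basis_index_def)
      show "\<forall>s\<in>basis_index M - (\<lambda>c'. (j, k, c', \<alpha>)) ` {..<e j}. poly_const (F s t) * basis_poly s = 0"
        by (auto simp: basis_index_def F_def t' poly_const_simps)
    qed
    finally show "poly_subst (linear_form d (R g)) (basis_poly t) = (\<Sum>s\<in>basis_index M. poly_const (F s t) * basis_poly s)" .
  next
    fix z t assume "(\<Sum>t\<in>basis_index M. poly_const (z t) * basis_poly t) = 0" "t \<in> basis_index M"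
    then show "z t = 0" by (rule basis_poly_independent)
  qed
  also have "\<dots> = (\<Sum>j\<le>n. \<Sum>k<\<mu> j. \<chi> j g * of_nat (card (basis_exps M j k)))"
    unfolding sum_basis_index F_def
    using g by (intro sum.cong refl) (simp add: character_rep[OF Rs_rep] sum_distrib_right sum_distrib_left mult.commute)
  finally show ?thesis .
qed

text \<open>The graded character of the span of the \<open>b\<^sub>j\<^sub>k(v\<^sub>c)\<close>. It will be the eigenvalue of \<open>D[R]\<close> on the
  column of \<open>g\<close>.\<close>

definition graded_char :: "'g \<Rightarrow> complex poly" where
  "graded_char g = (\<Sum>j\<le>n. Polynomial.smult (\<chi> j g) (D_row \<mu> m j))"

text \<open>The two evaluations of \<open>\<Sum>\<^sub>M tr(g | Sym\<^sup>M) q\<^sup>M\<close>: it is \<open>1 / det(1 - q R(g))\<close>, and by the basis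
  above it is the graded character divided by \<open>\<Prod>\<^sub>i (1 - q\<^bsup>n\<^sub>i\<^esup>)\<close>.\<close>

lemma graded_char_mult_rev_charpoly:
  assumes g: "g \<in> carrier G"
  shows "graded_char g * rev_charpoly d (R g) = (\<Prod>i<d. 1 - [:0, 1:] ^ nk i)"
proof -
  let ?S = "Abs_fps (sym_trace d (R g))"
  let ?C = "Abs_fps (\<lambda>M. \<Sum>a\<in>exps d nk M. \<Prod>i<d. (\<lambda>_. 1::complex) i ^ lookup a i)"
  let ?P = "\<Prod>i<d. 1 - [:0, 1:] ^ nk i :: complex poly"
  have P: "fps_of_poly ?P = (\<Prod>i<d. 1 - fps_const ((\<lambda>_. 1) i) * fps_X ^ nk i)"
    by (simp add: fps_of_poly_prod fps_of_poly_diff fps_of_poly_power fps_of_poly_pCons)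
  have C: "?C * fps_of_poly ?P = 1"
    unfolding P by (rule exps_generating_function) (rule nk)
  have "?S = (\<Sum>j\<le>n. \<Sum>k<\<mu> j. fps_const (\<chi> j g) * (fps_X ^ m j k * ?C))"
  proof (rule fps_ext)
    fix M
    have nth: "fps_nth (fps_const (\<chi> j g) * (fps_X ^ m j k * ?C)) M = \<chi> j g * of_nat (card (basis_exps M j k))" for j k
      by (simp add: fps_X_power_mult_nth basis_exps_def)
    show "fps_nth ?S M = fps_nth (\<Sum>j\<le>n. \<Sum>k<\<mu> j. fps_const (\<chi> j g) * (fps_X ^ m j k * ?C)) M"
      unfolding fps_sum_nth nth by (simp add: sym_trace_R[OF g])
  qed
  also have "\<dots> = fps_of_poly (graded_char g) * ?C"
    by (simp add: graded_char_def D_row_def fps_of_poly_sum fps_of_poly_smult fps_of_poly_monom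
        sum_distrib_right sum_distrib_left mult.assoc)
  finally have "?S * fps_of_poly ?P = fps_of_poly (graded_char g)"
    using C by (simp add: mult.assoc)
  then have "fps_of_poly (graded_char g * rev_charpoly d (R g)) = ?S * fps_of_poly (rev_charpoly d (R g)) * fps_of_poly ?P"
    by (simp add: fps_of_poly_mult mult_ac)
  also have "\<dots> = fps_of_poly ?P"
    using sym_trace_generating_function[OF repD(1)[OF R g]] by simp
  finally show ?thesis by simp
qed

end

section \<open>The behaviour at \<open>q = 1\<close>\<close>

lemma linear_power_dvd_cancel:
  fixes f h :: "complex poly"
  assumes f: "poly f 1 \<noteq> 0" and dvd: "[:1, -1:] ^ k dvd f * h"
  shows "[:1, -1:] ^ k dvd h"
  using dvd
proof (induction k arbitrary: h)
  case (Suc k)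
  have root: "[:1, -1:] dvd p \<longleftrightarrow> poly p 1 = 0" for p :: "complex poly"
  proof -
    have "[:1, -1:] = - [:-1, 1::complex:]" by simp
    then have "[:1, -1:] dvd p \<longleftrightarrow> [:-1, 1:] dvd p" by (simp only: minus_dvd_iff)
    then show ?thesis using poly_eq_0_iff_dvd[of p 1] by simp
  qed
  have "[:1, -1:] dvd [:1, -1::complex:] ^ Suc k" unfolding power_Suc by (rule dvd_triv_left)
  then have "[:1, -1:] dvd f * h" using Suc.prems by (rule dvd_trans)
  then have "poly h 1 = 0" using f unfolding root by simp
  then have "[:1, -1:] dvd h" unfolding root .
  then obtain h' where h': "h = [:1, -1:] * h'" by (rule dvdE)
  have "[:1, -1:] * [:1, -1:] ^ k dvd [:1, -1:] * (f * h')"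
    using Suc.prems unfolding h' by (simp only: power_Suc mult_ac)
  then have "[:1, -1:] ^ k dvd f * h'" by (subst (asm) dvd_mult_cancel_left) simp
  then have "[:1, -1:] ^ k dvd h'" by (rule Suc.IH)
  then show ?case unfolding h' power_Suc by (rule mult_dvd_mono[OF dvd_refl])
qed simp

text \<open>Differentiating \<open>(1-q)\<^bsup>k+1\<^esup> v\<close> gives \<open>(1-q)\<^sup>k v'\<close> with \<open>v'(1) = -(k+1) v(1)\<close>.\<close>

lemma higher_pderiv_linear_power:
  fixes v :: "complex poly"
  shows "(\<forall>i<k. poly ((pderiv ^^ i) ([:1, -1:] ^ k * v)) 1 = 0) \<and>
    poly ((pderiv ^^ k) ([:1, -1:] ^ k * v)) 1 = (-1) ^ k * fact k * poly v 1"
proof (induction k arbitrary: v)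
  case (Suc k)
  define L :: "complex poly" where "L = [:1, -1:]"
  define v' where "v' = L * pderiv v - Polynomial.smult (of_nat (Suc k)) v"
  have pd: "pderiv L = -1" by (simp add: L_def pderiv_pCons one_pCons)
  have "pderiv (L ^ Suc k * v) = L ^ k * v'"
    unfolding pderiv_mult pderiv_power_Suc pd v'_def by (simp add: algebra_simps del: of_nat_Suc)
  then have deriv: "pderiv ([:1, -1:] ^ Suc k * v) = [:1, -1:] ^ k * v'" unfolding L_def .
  have "poly ((pderiv ^^ i) ([:1, -1:] ^ Suc k * v)) 1 = 0" if "i < Suc k" for i
  proof (cases i)
    case (Suc i')
    have "(pderiv ^^ i) ([:1, -1:] ^ Suc k * v) = (pderiv ^^ i') ([:1, -1:] ^ k * v')"
      unfolding Suc funpow_Suc_right comp_def deriv ..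
    then show ?thesis using Suc.IH[of v'] that Suc by simp
  qed simp
  moreover have "poly ((pderiv ^^ Suc k) ([:1, -1:] ^ Suc k * v)) 1 = (-1) ^ Suc k * fact (Suc k) * poly v 1"
    unfolding funpow_Suc_right comp_def deriv
    using Suc.IH[of v'] by (simp add: v'_def L_def algebra_simps)
  ultimately show ?case by blast
qed simp

text \<open>The theorem for \<open>1 \<times> 1\<close> matrices, to be applied to the eigenvalues. If \<open>h(1) = 0\<close> both sides
  vanish; otherwise \<open>f\<close> takes up the whole zero of order \<open>d\<close>, and \<open>f = (1-q)\<^sup>d v\<close> with
  \<open>v(1) h(1) = u(1)\<close>.\<close>

lemma factor_derivatives_at_one:
  fixes f h u :: "complex poly"
  assumes prod: "f * h = [:1, -1:] ^ d * u"
  shows "\<And>i. i < d \<Longrightarrow> poly ((pderiv ^^ i) f) 1 * poly h 1 ^ (i + 1) = 0"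
    "poly ((pderiv ^^ d) f) 1 * poly h 1 ^ (d + 1) = (-1) ^ d * fact d * poly u 1 * poly h 1 ^ d"
proof -
  have "(\<forall>i<d. poly ((pderiv ^^ i) f) 1 * poly h 1 ^ (i + 1) = 0) \<and>
    poly ((pderiv ^^ d) f) 1 * poly h 1 ^ (d + 1) = (-1) ^ d * fact d * poly u 1 * poly h 1 ^ d"
  proof (cases "poly h 1 = 0")
    case True
    show ?thesis
    proof (cases "d = 0")
      case True
      have "poly u 1 = 0" using arg_cong[OF prod, of "\<lambda>p. poly p 1"] True \<open>poly h 1 = 0\<close> by simp
      then show ?thesis using True \<open>poly h 1 = 0\<close> by simp
    qed (use True in \<open>simp add: power_0_left\<close>)
  next
    case False
    have "[:1, -1:] ^ d dvd h * f" unfolding mult.commute[of h] prod by (rule dvd_triv_left)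
    from linear_power_dvd_cancel[OF False this] obtain v where v: "f = [:1, -1:] ^ d * v" by (rule dvdE)
    have "[:1, -1:] ^ d * (v * h) = [:1, -1:] ^ d * u" using prod unfolding v mult.assoc .
    moreover have "[:1, -1::complex:] ^ d \<noteq> 0" by simp
    ultimately have "v * h = u" by (simp only: mult_cancel_left simp_thms)
    then have uv: "poly v 1 * poly h 1 = poly u 1" unfolding poly_mult[symmetric] by (rule arg_cong)
    note hp = higher_pderiv_linear_power[of d v, folded v]
    have "poly ((pderiv ^^ d) f) 1 * poly h 1 ^ (d + 1) = (-1) ^ d * fact d * (poly v 1 * poly h 1) * poly h 1 ^ d"
      using hp by (simp add: mult_ac)
    then show ?thesis using hp unfolding uv by simp
  qed
  then show "\<And>i. i < d \<Longrightarrow> poly ((pderiv ^^ i) f) 1 * poly h 1 ^ (i + 1) = 0"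
    "poly ((pderiv ^^ d) f) 1 * poly h 1 ^ (d + 1) = (-1) ^ d * fact d * poly u 1 * poly h 1 ^ d"
    by simp_all
qed

lemma top_pderiv:
  fixes p :: "complex poly"
  assumes "Polynomial.degree p \<le> d"
  shows "poly ((pderiv ^^ d) p) 1 = fact d * Polynomial.coeff p d"
proof -
  have "Polynomial.degree ((pderiv ^^ d) p) = 0" using assms by (simp add: degree_higher_pderiv)
  then obtain c where c: "(pderiv ^^ d) p = [:c:]" by (rule degree_eq_zeroE)
  have "c = Polynomial.coeff ((pderiv ^^ d) p) 0" unfolding c by simp
  also have "\<dots> = fact d * Polynomial.coeff p d" by (simp add: coeff_higher_pderiv pochhammer_fact)
  finally show ?thesis unfolding c by simp
qed

text \<open>A unipotent matrix of finite order is the identity: if the columns of \<open>B\<close> before the \<open>k\<close>-th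
  are unit vectors, then \<open>B\<^sup>r e\<^sub>k = e\<^sub>k + r u\<close> with \<open>u = B e\<^sub>k - e\<^sub>k\<close>.\<close>

lemma unipotent_finite_order:
  fixes B :: "complex mat"
  assumes B: "B \<in> carrier_mat d d" "upper_triangular B" and diag: "\<And>i. i < d \<Longrightarrow> B $$ (i, i) = 1"
    and r: "r > 0" "B ^\<^sub>m r = 1\<^sub>m d"
  shows "B = 1\<^sub>m d"
proof -
  have "k < d \<Longrightarrow> \<forall>i<d. B $$ (i, k) = 1\<^sub>m d $$ (i, k)" for k
  proof (induction k rule: less_induct)
    case (less k)
    have pow: "(B ^\<^sub>m s) $$ (i, l) = 1\<^sub>m d $$ (i, l)" if "l < k" "i < d" for s i l
      using that
    proof (induction s arbitrary: i)
      case 0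
      then show ?case using B by simp
    next
      case (Suc s)
      have "(B ^\<^sub>m Suc s) $$ (i, l) = (\<Sum>x<d. (B ^\<^sub>m s) $$ (i, x) * B $$ (x, l))"
        using index_mult_mat_sum[OF pow_carrier_mat[OF B(1)] B(1)] Suc.prems less.prems by simp
      also have "\<dots> = (\<Sum>x<d. if x = l then (B ^\<^sub>m s) $$ (i, l) else 0)"
        using less.IH[OF Suc.prems(1)] Suc.prems less.prems by (intro sum.cong) auto
      also have "\<dots> = (B ^\<^sub>m s) $$ (i, l)" using Suc.prems less.prems by simp
      finally show ?case using Suc by simp
    qed
    have colk: "(B ^\<^sub>m s) $$ (i, k) = of_nat s * B $$ (i, k)" if i: "i < k" for s i
    proof (induction s)
      case 0
      then show ?case using B i less.prems by simp
    next
      case (Suc s)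
      have "(B ^\<^sub>m Suc s) $$ (i, k) = (\<Sum>x<d. (B ^\<^sub>m s) $$ (i, x) * B $$ (x, k))"
        using index_mult_mat_sum[OF pow_carrier_mat[OF B(1)] B(1)] i less.prems by simp
      also have "\<dots> = (\<Sum>x<d. (if x = i then B $$ (i, k) else 0) + (if x = k then (B ^\<^sub>m s) $$ (i, k) else 0))"
      proof (rule sum.cong[OF refl])
        fix x assume "x \<in> {..<d}"
        then have x: "x < d" by simp
        consider "x < k" | "x = k" | "k < x" by linarith
        then show "(B ^\<^sub>m s) $$ (i, x) * B $$ (x, k) =
            (if x = i then B $$ (i, k) else 0) + (if x = k then (B ^\<^sub>m s) $$ (i, k) else 0)"
        proof cases
          case 1
          then show ?thesis using pow[of x i s] i less.prems by simp
        next
          case 2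
          then show ?thesis using diag[OF less.prems] i by simp
        next
          case 3
          then show ?thesis using upper_triangularD[OF B(2), of k x] B(1) x i by simp
        qed
      qed
      also have "\<dots> = B $$ (i, k) + (B ^\<^sub>m s) $$ (i, k)"
        using i less.prems by (simp add: sum.distrib)
      finally show ?case unfolding Suc by (simp add: distrib_right)
    qed
    show ?case
    proof (intro allI impI)
      fix i assume i: "i < d"
      consider "i < k" | "i = k" | "k < i" by linarith
      then show "B $$ (i, k) = 1\<^sub>m d $$ (i, k)"
      proof cases
        case 1
        then have "of_nat r * B $$ (i, k) = 0" using colk[of i r] r(2) i less.prems by simp
        then show ?thesis using 1 r(1) i less.prems by simp
      next
        case 2
        then show ?thesis using diag i by simp
      next
        case 3
        then show ?thesis using upper_triangularD[OF B(2), of k i] B(1) i less.prems by simp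
      qed
    qed
  qed
  then show ?thesis using B by (intro eq_matI) auto
qed

locale faithful_covariant_bases = covariant_bases +
  assumes faithful: "faithful G R"
begin

text \<open>The quotient of \<open>\<Prod>\<^sub>i (1 - q\<^bsup>n\<^sub>i\<^esup>)\<close> by \<open>(1-q)\<^sup>d\<close>.\<close>

definition theta_quotient :: "complex poly" where
  "theta_quotient = (\<Prod>i<d. \<Sum>l<nk i. [:0, 1:] ^ l)"

lemma graded_char_product:
  assumes g: "g \<in> carrier G"
  shows "graded_char g * rev_charpoly d (R g) = [:1, -1:] ^ d * theta_quotient"
proof -
  have "1 - [:0, 1::complex:] = [:1, -1:]" by (simp add: one_pCons)
  then have eq: "1 - [:0, 1:] ^ k = [:1, -1:] * (\<Sum>l<k. [:0, 1::complex:] ^ l)" for k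
    using one_diff_power_eq[of "[:0, 1::complex:]" k] by (simp only:)
  have "(\<Prod>i<d. 1 - [:0, 1::complex:] ^ nk i) = [:1, -1:] ^ d * theta_quotient"
    unfolding eq theta_quotient_def prod.distrib by (simp only: prod_constant card_lessThan)
  then show ?thesis using graded_char_mult_rev_charpoly[OF g] by simp
qed

text \<open>If the value were nonzero, the factor \<open>(1-q)\<^sup>d\<close> of the product would divide
  \<open>det(1 - q R(g))\<close>, which has degree at most \<open>d\<close>. Then all eigenvalues of \<open>R(g)\<close> are one, hence
  \<open>R(g) = 1\<close>, and faithfulness gives \<open>g = 1\<close>.\<close>

lemma graded_char_at_one:
  assumes g: "g \<in> carrier G" "g \<noteq> \<one>"
  shows "poly (graded_char g) 1 = 0"
proof (rule ccontr)
  assume nz: "poly (graded_char g) 1 \<noteq> 0"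
  obtain B P Q where sim: "similar_mat_wit (R g) B P Q" and B: "B \<in> carrier_mat d d" "upper_triangular B"
    and BN: "B ^\<^sub>m N = 1\<^sub>m d" and pow: "\<forall>k. similar_mat_wit (R (g [^] k)) (B ^\<^sub>m k) P Q"
    by (rule triangular_form[OF R g(1)])
  let ?L = "rev_charpoly d (R g)"
  have L: "?L = (\<Prod>i<d. [:1, - B $$ (i, i):])"
    by (simp only: rev_charpoly_similar[OF repD(1)[OF R g(1)] sim] rev_charpoly_upper_triangular[OF B])
  have L0: "poly ?L 0 = 1" unfolding L by (simp add: poly_prod)
  have "[:1, -1:] ^ d dvd graded_char g * ?L" unfolding graded_char_product[OF g(1)] by simp
  from linear_power_dvd_cancel[OF nz this] obtain v where v: "?L = [:1, -1:] ^ d * v" by (rule dvdE)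
  have "v \<noteq> 0" using v L0 by auto
  then have "Polynomial.degree ?L = d + Polynomial.degree v"
    unfolding v by (subst degree_mult_eq) (simp_all add: degree_linear_power degree_power_eq)
  then have "Polynomial.degree v = 0" using degree_rev_charpoly[of d "R g"] by simp
  then obtain c where c: "v = [:c:]" by (rule degree_eq_zeroE)
  have "c = 1" using L0 unfolding v c by simp
  then have Ld: "?L = [:1, -1:] ^ d" unfolding v c by simp
  have diag: "B $$ (i, i) = 1" if i: "i < d" for i
  proof -
    let ?z = "B $$ (i, i)"
    have "?z ^ N = 1" using upper_triangular_pow[OF B, of N] BN i by simp
    then have z: "?z \<noteq> 0" using N_pos by (metis power_0_left zero_neq_one neq0_conv)
    have "poly ?L (1 / ?z) = 0" unfolding L poly_prod using i z by (intro prod_zero) auto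
    then have "(1 - 1 / ?z) ^ d = 0" unfolding Ld by (simp add: poly_power)
    then show ?thesis using z by simp
  qed
  have B1: "B = 1\<^sub>m d" by (rule unipotent_finite_order[OF B diag N_pos BN])
  note w = similar_mat_witD2[OF repD(1)[OF R g(1)] sim]
  have "R g = R \<one>" unfolding w(3) B1 repD(2)[OF R] using w by simp
  then show False using faithful g unfolding faithful_def by (auto dest: inj_onD)
qed

text \<open>The identity \<open>n\<^sub>1 \<cdots> n\<^sub>d = \<mu>\<^sub>0 |G|\<close>, obtained by averaging the graded characters at \<open>q = 1\<close>
  over the group: only \<open>g = 1\<close> contributes, and orthogonality to the trivial character leaves \<open>\<mu>\<^sub>0\<close>.\<close>

lemma theta_quotient_at_one: "poly theta_quotient 1 = of_nat (\<mu> 0 * N)"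
proof -
  have R1: "R \<one> = 1\<^sub>m d" by (rule repD(2)[OF R])
  have "rev_charpoly d (R \<one>) = (\<Prod>i<d. [:1, - 1\<^sub>m d $$ (i, i):])"
    unfolding R1 by (rule rev_charpoly_upper_triangular) (auto intro: upper_triangularI)
  then have "rev_charpoly d (R \<one>) = [:1, -1:] ^ d" by simp
  then have "[:1, -1:] ^ d * graded_char \<one> = [:1, -1:] ^ d * theta_quotient"
    using graded_char_product[OF one_closed] by (simp add: mult.commute)
  then have g1: "graded_char \<one> = theta_quotient" by simp
  have gc: "poly (graded_char g) 1 = (\<Sum>j\<le>n. of_nat (\<mu> j) * \<chi> j g)" for g
    by (simp add: graded_char_def poly_sum D_row_def poly_monom mult.commute)
  have triv: "\<chi> 0 g = 1" if "g \<in> carrier G" for g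
    using irr that by (simp add: irreducibles_def character_def)
  have "(\<Sum>g\<in>carrier G. poly (graded_char g) 1) = (\<Sum>g\<in>carrier G. if g = \<one> then poly theta_quotient 1 else 0)"
    using graded_char_at_one g1 by (intro sum.cong) auto
  also have "\<dots> = poly theta_quotient 1" using fin by simp
  finally have "poly theta_quotient 1 = (\<Sum>g\<in>carrier G. \<Sum>j\<le>n. of_nat (\<mu> j) * (\<chi> j g * \<chi> 0 (inv g)))"
    by (simp add: gc triv)
  also have "\<dots> = (\<Sum>j\<le>n. of_nat (\<mu> j) * (\<Sum>g\<in>carrier G. \<chi> j g * \<chi> 0 (inv g)))"
    by (subst sum.swap) (simp add: sum_distrib_left)
  also have "\<dots> = (\<Sum>j\<le>n. if j = 0 then of_nat (\<mu> 0) * of_nat N else 0)"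
    by (intro sum.cong) (auto simp: character_orthogonality_inv)
  also have "\<dots> = of_nat (\<mu> 0 * N)" by simp
  finally show ?thesis .
qed

section \<open>Assembling the matrices\<close>

definition deriv_at_one :: "nat \<Rightarrow> complex poly \<Rightarrow> complex" where
  "deriv_at_one i p = poly ((pderiv ^^ i) p) 1"

lemma deriv_at_one_linear:
  "deriv_at_one i (Polynomial.smult c p) = c * deriv_at_one i p"
  "deriv_at_one i (sum F A) = (\<Sum>x\<in>A. deriv_at_one i (F x))"
  by (simp_all add: deriv_at_one_def higher_pderiv_smult higher_pderiv_sum poly_sum)

lemma D_mat_acts: "acts (at_one (mat_deriv i (D_mat G n Rs \<mu> m))) (\<lambda>g. deriv_at_one i (graded_char g))"
proof (rule actsI)
  fix r g assume r: "r \<le> n" and g: "g \<in> carrier G"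
  have entry: "at_one (mat_deriv i (D_mat G n Rs \<mu> m)) $$ (r, j) =
      (\<Sum>k\<le>n. char_inner G (tensor_rep (Rs r) (Rs k)) (Rs j) * deriv_at_one i (D_row \<mu> m k))" if "j \<le> n" for j
    using r that by (simp add: at_one_def mat_deriv_def D_mat_def deriv_at_one_linear flip: deriv_at_one_def)
  have "(\<Sum>j\<le>n. at_one (mat_deriv i (D_mat G n Rs \<mu> m)) $$ (r, j) * \<chi> j g) =
      (\<Sum>j\<le>n. \<Sum>k\<le>n. deriv_at_one i (D_row \<mu> m k) * (char_inner G (tensor_rep (Rs r) (Rs k)) (Rs j) * \<chi> j g))"
    by (intro sum.cong refl) (simp add: entry sum_distrib_right sum_distrib_left mult_ac)
  also have "\<dots> = (\<Sum>k\<le>n. deriv_at_one i (D_row \<mu> m k) * (\<Sum>j\<le>n. char_inner G (tensor_rep (Rs r) (Rs k)) (Rs j) * \<chi> j g))"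
    by (subst sum.swap) (simp add: sum_distrib_left)
  also have "\<dots> = (\<Sum>k\<le>n. deriv_at_one i (D_row \<mu> m k) * (\<chi> r g * \<chi> k g))"
    using char_inner_expansion[OF Rs_carrier[OF r] character_conj[OF Rs_rep[OF r]] _ g]
    by (intro sum.cong refl) simp
  also have "\<dots> = deriv_at_one i (graded_char g) * \<chi> r g"
    by (simp add: graded_char_def deriv_at_one_linear sum_distrib_right sum_distrib_left mult_ac)
  finally show "(\<Sum>j\<le>n. at_one (mat_deriv i (D_mat G n Rs \<mu> m)) $$ (r, j) * \<chi> j g) =
      deriv_at_one i (graded_char g) * \<chi> r g" .
qed (simp add: at_one_def mat_deriv_def D_mat_def)

lemma ext_power_acts: "k \<le> d \<Longrightarrow> acts (CG G n Rs (ext_power d k R)) (character (ext_power d k R))"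
  by (rule CG_acts[where p = "length (ext_basis d k)"])
    (simp_all add: ext_power_def[of d k R] ext_power_class_function[OF R, simplified ext_power_def[of d k R]])

lemma CG_ext_acts: "acts (at_one (mat_deriv i (CG_ext G n Rs d R))) (\<lambda>g. deriv_at_one i (rev_charpoly d (R g)))"
proof (rule actsI)
  fix r g assume r: "r \<le> n" and g: "g \<in> carrier G"
  let ?M = "\<lambda>k. CG G n Rs (ext_power d k R)" and ?t = "\<lambda>k. (-1) ^ k * deriv_at_one i (Polynomial.monom 1 k)"
  have mono: "deriv_at_one i (Polynomial.monom c k) = c * deriv_at_one i (Polynomial.monom 1 k)" for c k
    using deriv_at_one_linear(1)[of i c "Polynomial.monom 1 k"] by (simp add: smult_monom)
  have entry: "at_one (mat_deriv i (CG_ext G n Rs d R)) $$ (r, j) = (\<Sum>k\<le>d. ?t k * ?M k $$ (r, j))" if "j \<le> n" for j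
  proof -
    have "at_one (mat_deriv i (CG_ext G n Rs d R)) $$ (r, j) =
        deriv_at_one i (\<Sum>k\<le>d. Polynomial.monom ((-1) ^ k * ?M k $$ (r, j)) k)"
      using r that by (simp add: at_one_def mat_deriv_def CG_ext_def deriv_at_one_def)
    then show ?thesis by (simp only: deriv_at_one_linear(2) mono[of "_ * _"] mult_ac)
  qed
  have "(\<Sum>j\<le>n. at_one (mat_deriv i (CG_ext G n Rs d R)) $$ (r, j) * \<chi> j g) =
      (\<Sum>j\<le>n. \<Sum>k\<le>d. ?t k * (?M k $$ (r, j) * \<chi> j g))"
    by (intro sum.cong refl) (simp add: entry sum_distrib_right mult.assoc)
  also have "\<dots> = (\<Sum>k\<le>d. ?t k * (\<Sum>j\<le>n. ?M k $$ (r, j) * \<chi> j g))"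
    by (subst sum.swap) (simp add: sum_distrib_left)
  also have "\<dots> = (\<Sum>k\<le>d. ?t k * (character (ext_power d k R) g * \<chi> r g))"
    by (intro sum.cong refl) (simp add: actsD(2)[OF ext_power_acts r g])
  also have "\<dots> = (\<Sum>k\<le>d. ?t k * character (ext_power d k R) g) * \<chi> r g"
    by (simp add: sum_distrib_right mult.assoc)
  also have "(\<Sum>k\<le>d. ?t k * character (ext_power d k R) g) = deriv_at_one i (rev_charpoly d (R g))"
    unfolding rev_charpoly_def deriv_at_one_linear(2) character_ext_power
    by (intro sum.cong refl) (simp only: mono[of "_ * _"] mult_ac)
  finally show "(\<Sum>j\<le>n. at_one (mat_deriv i (CG_ext G n Rs d R)) $$ (r, j) * \<chi> j g) =
      deriv_at_one i (rev_charpoly d (R g)) * \<chi> r g" .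
qed (simp add: at_one_def mat_deriv_def CG_ext_def)

end

lemma at_one_mult:
  assumes A: "A \<in> carrier_mat p r" and B: "B \<in> carrier_mat r s"
  shows "at_one (A * B) = at_one A * at_one B"
proof (rule eq_matI)
  fix i j assume "i < dim_row (at_one A * at_one B)" "j < dim_col (at_one A * at_one B)"
  then have ij: "i < p" "j < s" using A B by (simp_all add: at_one_def)
  have c: "at_one A \<in> carrier_mat p r" "at_one B \<in> carrier_mat r s" using A B by (simp_all add: at_one_def)
  have "at_one (A * B) $$ (i, j) = poly ((A * B) $$ (i, j)) 1" using A B ij by (simp add: at_one_def)
  also have "\<dots> = (\<Sum>l<r. at_one A $$ (i, l) * at_one B $$ (l, j))"
    using A B ij by (simp add: index_mult_mat_sum[OF A B ij] poly_sum at_one_def del: index_mult_mat)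
  also have "\<dots> = (at_one A * at_one B) $$ (i, j)" by (rule index_mult_mat_sum[OF c ij, symmetric])
  finally show "at_one (A * B) $$ (i, j) = (at_one A * at_one B) $$ (i, j)" .
qed (use A B in \<open>simp_all add: at_one_def\<close>)

lemma at_one_pow:
  assumes A: "A \<in> carrier_mat p p"
  shows "at_one (A ^\<^sub>m k) = at_one A ^\<^sub>m k"
proof (induction k)
  case 0
  show ?case using A by (intro eq_matI) (auto simp: at_one_def)
next
  case (Suc k)
  then show ?case using at_one_mult[OF pow_carrier_mat[OF A] A] by simp
qed

lemma mat_deriv_0: "mat_deriv 0 A = A"
  by (intro eq_matI) (auto simp: mat_deriv_def)

theorem mainTheorem3:
  fixes G :: "('g, 'b) monoid_scheme"
    and R :: "'g \<Rightarrow> complex mat" and d :: nat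
    and Rs :: "nat \<Rightarrow> 'g \<Rightarrow> complex mat" and n :: nat and e :: "nat \<Rightarrow> nat"
    and \<theta> :: "nat \<Rightarrow> mpoly"
    and \<mu> :: "nat \<Rightarrow> nat" and m :: "nat \<Rightarrow> nat \<Rightarrow> nat"
    and b :: "nat \<Rightarrow> nat \<Rightarrow> complex vec \<Rightarrow> mpoly"
  assumes "group G" and "finite (carrier G)"
    and "representation G d R" and "faithful G R"
    and "irreducibles G n e Rs"
    and "hsop G d R \<theta>"
    and "\<forall>j\<le>n. homogeneous_covariant_basis G d R \<theta> (e j) (Rs j) (\<mu> j) (m j) (b j)"
  shows
    "(\<forall>i<d.
        at_one (mat_deriv i (D_mat G n Rs \<mu> m) * CG_ext G n Rs d R ^\<^sub>m (i + 1))
          = 0\<^sub>m (n + 1) (n + 1) \<and>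
        at_one (D_mat G n Rs \<mu> m ^\<^sub>m (i + 1) * mat_deriv i (CG_ext G n Rs d R))
          = 0\<^sub>m (n + 1) (n + 1)) \<and>
     at_one (mat_deriv d (D_mat G n Rs \<mu> m) * CG_ext G n Rs d R ^\<^sub>m (d + 1))
       = ((-1) ^ d * fact d * of_nat (\<mu> 0 * card (carrier G))) \<cdot>\<^sub>m
           at_one (CG_ext G n Rs d R) ^\<^sub>m d \<and>
     at_one (D_mat G n Rs \<mu> m ^\<^sub>m (d + 1) * mat_deriv d (CG_ext G n Rs d R))
       = ((-1) ^ d * fact d * of_nat (\<mu> 0 * card (carrier G))) \<cdot>\<^sub>m
           at_one (D_mat G n Rs \<mu> m) ^\<^sub>m d \<and>
     at_one (D_mat G n Rs \<mu> m) ^\<^sub>m (d + 1) * CG G n Rs (det_rep d R)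
       = of_nat (\<mu> 0 * card (carrier G)) \<cdot>\<^sub>m at_one (D_mat G n Rs \<mu> m) ^\<^sub>m d"
proof -
  interpret group G by (rule assms(1))
  interpret faithful_covariant_bases G n e Rs R d \<theta> \<mu> m b
    by unfold_locales (use assms in auto)
  let ?D = "D_mat G n Rs \<mu> m" and ?M = "CG_ext G n Rs d R" and ?c = "of_nat (\<mu> 0 * card (carrier G)) :: complex"
  define f where "f i g = deriv_at_one i (graded_char g)" for i g
  define h where "h i g = deriv_at_one i (rev_charpoly d (R g))" for i g
  have cD: "mat_deriv i ?D \<in> carrier_mat (n + 1) (n + 1)" and cM: "mat_deriv i ?M \<in> carrier_mat (n + 1) (n + 1)" for i
    by (simp_all add: mat_deriv_def D_mat_def CG_ext_def)
  have cD0: "?D \<in> carrier_mat (n + 1) (n + 1)" and cM0: "?M \<in> carrier_mat (n + 1) (n + 1)"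
    by (simp_all add: D_mat_def CG_ext_def)
  have D: "acts (at_one (mat_deriv i ?D)) (f i)" and M: "acts (at_one (mat_deriv i ?M)) (h i)" for i
    using D_mat_acts[of i] CG_ext_acts[of i] by (simp_all add: f_def[abs_def] h_def[abs_def])
  have D0: "acts (at_one ?D) (f 0)" and M0: "acts (at_one ?M) (h 0)"
    using D[of 0] M[of 0] by (simp_all add: mat_deriv_0)
  have DM: "acts (at_one (mat_deriv i ?D * ?M ^\<^sub>m (k + 1))) (\<lambda>g. f i g * h 0 g ^ (k + 1))" for i k
    unfolding at_one_mult[OF cD pow_carrier_mat[OF cM0]] at_one_pow[OF cM0]
    by (rule acts_mult[OF D acts_pow[OF M0]])
  have MD: "acts (at_one (?D ^\<^sub>m (k + 1) * mat_deriv i ?M)) (\<lambda>g. f 0 g ^ (k + 1) * h i g)" for i k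
    unfolding at_one_mult[OF pow_carrier_mat[OF cD0] cM] at_one_pow[OF cD0]
    by (rule acts_mult[OF acts_pow[OF D0] M])
  have s: "\<And>i. i < d \<Longrightarrow> f i g * h 0 g ^ (i + 1) = 0"
    "f d g * h 0 g ^ (d + 1) = (-1) ^ d * fact d * ?c * h 0 g ^ d"
    "\<And>i. i < d \<Longrightarrow> f 0 g ^ (i + 1) * h i g = 0"
    "f 0 g ^ (d + 1) * h d g = (-1) ^ d * fact d * ?c * f 0 g ^ d" if g: "g \<in> carrier G" for g
  proof -
    note p = graded_char_product[OF g]
    have p': "rev_charpoly d (R g) * graded_char g = [:1, -1:] ^ d * theta_quotient" using p by (simp add: mult.commute)
    note 1 = factor_derivatives_at_one[OF p] and 2 = factor_derivatives_at_one[OF p']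
    show "f i g * h 0 g ^ (i + 1) = 0" if "i < d" for i
      using 1(1)[OF that] by (simp add: f_def h_def deriv_at_one_def)
    show "f d g * h 0 g ^ (d + 1) = (-1) ^ d * fact d * ?c * h 0 g ^ d"
      using 1(2) unfolding theta_quotient_at_one by (simp add: f_def h_def deriv_at_one_def)
    show "f 0 g ^ (i + 1) * h i g = 0" if "i < d" for i
      using 2(1)[OF that] by (auto simp: f_def h_def deriv_at_one_def)
    show "f 0 g ^ (d + 1) * h d g = (-1) ^ d * fact d * ?c * f 0 g ^ d"
      using 2(2) unfolding theta_quotient_at_one by (simp add: f_def h_def deriv_at_one_def mult.commute)
  qed
  have det: "acts (CG G n Rs (det_rep d R)) (character (ext_power d d R))"
    unfolding det_rep_def by (rule ext_power_acts) simp
  have top: "h d g = (-1) ^ d * fact d * character (ext_power d d R) g" for g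
    using top_pderiv[OF degree_rev_charpoly] coeff_rev_charpoly[of d d R g]
    by (simp add: h_def deriv_at_one_def)
  have "at_one (mat_deriv i ?D * ?M ^\<^sub>m (i + 1)) = 0\<^sub>m (n + 1) (n + 1)"
    "at_one (?D ^\<^sub>m (i + 1) * mat_deriv i ?M) = 0\<^sub>m (n + 1) (n + 1)" if i: "i < d" for i
    by (rule acts_unique[OF DM acts_zero s(1)[OF _ i]], assumption)
      (rule acts_unique[OF MD acts_zero s(3)[OF _ i]], assumption)
  moreover have "at_one (mat_deriv d ?D * ?M ^\<^sub>m (d + 1)) = ((-1) ^ d * fact d * ?c) \<cdot>\<^sub>m at_one ?M ^\<^sub>m d"
    by (rule acts_unique[OF DM acts_smult[OF acts_pow[OF M0]] s(2)])
  moreover have "at_one (?D ^\<^sub>m (d + 1) * mat_deriv d ?M) = ((-1) ^ d * fact d * ?c) \<cdot>\<^sub>m at_one ?D ^\<^sub>m d"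
    by (rule acts_unique[OF MD acts_smult[OF acts_pow[OF D0]] s(4)])
  moreover have "at_one ?D ^\<^sub>m (d + 1) * CG G n Rs (det_rep d R) = ?c \<cdot>\<^sub>m at_one ?D ^\<^sub>m d"
  proof (rule acts_unique[OF acts_mult[OF acts_pow[OF D0] det] acts_smult[OF acts_pow[OF D0]]])
    fix g assume "g \<in> carrier G"
    from s(4)[OF this]
    have "((-1) ^ d * fact d) * (f 0 g ^ (d + 1) * character (ext_power d d R) g) = ((-1) ^ d * fact d) * (?c * f 0 g ^ d)"
      unfolding top by (simp only: mult_ac)
    then show "f 0 g ^ (d + 1) * character (ext_power d d R) g = ?c * f 0 g ^ d"
      by (subst (asm) mult_cancel_left) simp
  qed
  ultimately show ?thesis by blast
qed

end
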